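(* Let $\mathbb{C}\subset^{\varphi_0}B\subset^{\varphi_1}A_1\subset^{\varphi_2}A_2\subset^{\varphi_3}\cdots$ be a tower of amalgamated noncommutative probability spaces, and let $k<m<n<N$ in $\mathbb{N}$, with the conditional expectations $E_{k,j}=\varphi_k\varphi_{k+1}\cdots\varphi_j:A_j\to A_{k-1}$ ($j\ge k$). Let $X=\{x_1,\dots,x_s\}\subset\bigcup_{j=k}^mA_j$ and $Y=\{y_1,\dots,y_s\}\subset\bigcup_{j=m+1}^nA_j$ ($s\in\mathbb{N}$), regarded as $A_{k-1}$-valued random variables in $(A_N,E_{k,N})$. If $X$ and $Y$ are free over $A_{k-1}$ in $(A_N,E_{k,N})$, then (1) $R^{(E_{k,N})}_{x_1,\dots,x_s,y_1,\dots,y_s}(z_1,\dots,z_{2s})=R^{(E_{k,m})}_{x_1,\dots,x_s}(z_1,\dots,z_s)+R^{(E_{k,n})}_{y_1,\dots,y_s}(z_{s+1},\dots,z_{2s})$; (2) $R^{(E_{k,N})}_{x_1+y_1,\dots,x_s+y_s}(z_1,\dots,z_s)=\bigl(R^{(E_{k,m})}_{x_1,\dots,x_s}+R^{(E_{k,n})}_{y_1,\dots,y_s}\bigr)(z_1,\dots,z_s)$; (3) $R^{(E_{k,N})}_{x_1y_1,\dots,x_sy_s}(z_1,\dots,z_s)=\bigl(R^{(E_{k,m})}_{x_1,\dots,x_s}\ast_{A_{k-1}}R^{(E_{k,n}):t}_{y_1,\dots,y_s}\bigr)(z_1,\dots,z_s)$, where $\ast_{A_{k-1}}$ denotes the $A_{k-1}$-valued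 boxed convolution.
   Context: Algebras are unital and complex. Tower of amalgamated noncommutative probability spaces: a sequence of unital algebras $A_0=B\subset A_1\subset A_2\subset\cdots$, each a unital subalgebra of the next (common unit), a fixed linear functional $\varphi_0:B\to\mathbb{C}$, and for each $n\ge1$ a conditional expectation $\varphi_n:A_n\to A_{n-1}$. A conditional expectation $\varphi:A\to D$ onto a unital subalgebra $D\subset A$ is a linear map with $\varphi(b)=b$ and $\varphi(bxb')=b\varphi(x)b'$ for $b,b'\in D$, $x\in A$. Juxtaposition means composition. $NC(p)$ is the lattice of noncrossing partitions of $\{1,\dots,p\}$ ordered by refinement, $1_p$ its maximal element, $\mu$ its Möbius function, $Kr$ the Kreweras complement; for $\pi\in NC(p)$, $\pi\cup Kr(\pi)\in NC(2p)$ is the alternating union, with $\pi$ on the odd positions $1,3,\dots,2p-1$ and $Kr(\pi)$ on the even positions $2,4,\dots,2p$. For a conditional expectation $\varphi:A\to D$ and $\pi\in NC(p)$, $\widehat\varphi(\pi)(a_1\otimes\cdots\otimes a_p)\in D$ is defined by nesting: $\widehat\varphi(1_p)(a_1\otimes\cdots\otimes a_p)=\varphi(a_1\cdots a_p)$, and if $\pi\ne1_p$ has an interval block $V=\{l+1,\dots,l+q\}$, then $\widehat\varphi(\pi)(a_1\otimes\cdots\otimes a_p)=\widehat\varphi(\pi\setminus V)(a_1\otimes\cdots\otimes a_l\varphi(a_{l+1}\cdots a_{l+q})\otimes a_{l+q+1}\otimes\cdots\otimes a_p)$ (if $l=0$ the value is multiplied on the left of $a_{q+1}$). The $D$-valued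 cumulants are $c_\varphi^{(p)}(a_1\otimes\cdots\otimes a_p)=\sum_{\pi\in NC(p)}\widehat\varphi(\pi)(a_1\otimes\cdots\otimes a_p)\mu(\pi,1_p)$, and $\widehat{c_\varphi}(\pi)$ is obtained from them by the same nesting rule, each block $\{v_1<\dots<v_q\}$ being evaluated by $c_\varphi^{(q)}$. R-transform: for $a_1,\dots,a_s\in A$, $R^{(\varphi)}_{a_1,\dots,a_s}(z_1,\dots,z_s)=\sum_{p\ge1}\sum_{i_1,\dots,i_p}k_p^{(\varphi)}(a_{i_1},\dots,a_{i_p})z_{i_1}\cdots z_{i_p}$ in noncommuting indeterminates, where $k_p^{(\varphi)}(a_{i_1},\dots,a_{i_p})=c_\varphi^{(p)}(a_{i_1}\otimes d_{i_2}a_{i_2}\otimes\cdots\otimes d_{i_p}a_{i_p})$ with $d_{i_2},\dots,d_{i_p}\in D$ arbitrary; equalities of R-transforms mean equality of coefficients for every choice of these elements of $D$, the same choice being used on both sides. The trivial R-transform $R^{(\varphi):t}$ is obtained with all $d_{i_r}=1$. Freeness: subsets $X,Y\subset A$ are free over $D$ in $(A,\varphi)$ if for the subalgebras $A_X,A_Y$ generated by $D\cup X$ and $D\cup Y$, $c_\varphi^{(p)}(a_1\otimes\cdots\otimes a_p)=0$ whenever $a_1,\dots,a_p\in A_X\cup A_Y$ do not all lie in $A_X$ and do not all lie in $A_Y$ (equivalently, Voiculescu's freeness with amalgamation over $D$). Boxed convolution (with $D=A_{k-1}$): the $(i_1,\dots,i_p)$-th coefficient of $R^{(E_{k,m})}_{x_1,\dots,x_s}\ast_{D}R^{(E_{k,n}):t}_{y_1,\dots,y_s}$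 is $$\sum_{\pi\in NC(p)}(\widehat{c_x}\oplus\widehat{c_y})(\pi\cup Kr(\pi))(x_{i_1}\otimes y_{i_1}\otimes d_{i_2}x_{i_2}\otimes y_{i_2}\otimes\cdots\otimes d_{i_p}x_{i_p}\otimes y_{i_p}),$$ evaluated by the nesting rule, where blocks of $\pi$ (containing only $x$-arguments) are evaluated by the cumulants of $E_{k,m}$ and blocks of $Kr(\pi)$ (containing only $y$-arguments) by the cumulants of $E_{k,n}$.
   Formalization: Freeness is taken with each position assigned to A_X or A_Y, both occurring (equivalent to Voiculescu's freeness); the literal wording "do not all lie in A_X and do not all lie in A_Y" is vacuous for X = Y, where claim (1) fails. *)

theory Defs
  imports Complex_Main "HOL-Library.Disjoint_Sets"
begin

section \<open>Towers of amalgamated noncommutative probability spaces\<close>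

locale complex_algebra = vector_space scale
  for scale :: "complex \<Rightarrow> 'a::ring_1 \<Rightarrow> 'a" +
  assumes scale_mult_left: "scale c x * y = scale c (x * y)"
    and scale_mult_right: "x * scale c y = scale c (x * y)"

definition unital_subalgebra :: "(complex \<Rightarrow> 'a::ring_1 \<Rightarrow> 'a) \<Rightarrow> 'a set \<Rightarrow> bool" where
  "unital_subalgebra scale S \<longleftrightarrow> 1 \<in> S \<and> (\<forall>a\<in>S. \<forall>b\<in>S. a + b \<in> S) \<and>
     (\<forall>a\<in>S. \<forall>b\<in>S. a * b \<in> S) \<and> (\<forall>c. \<forall>a\<in>S. scale c a \<in> S)"

text \<open>Maps on a subalgebra are total functions of which only the values on that subalgebra matter.\<close>

definition conditional_expectation ::
  "(complex \<Rightarrow> 'a::ring_1 \<Rightarrow> 'a) \<Rightarrow> 'a set \<Rightarrow> 'a set \<Rightarrow> ('a \<Rightarrow> 'a) \<Rightarrow> bool" where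
  "conditional_expectation scale A D \<phi> \<longleftrightarrow>
     (\<forall>a\<in>A. \<phi> a \<in> D) \<and>
     (\<forall>a\<in>A. \<forall>b\<in>A. \<phi> (a + b) = \<phi> a + \<phi> b) \<and>
     (\<forall>c. \<forall>a\<in>A. \<phi> (scale c a) = scale c (\<phi> a)) \<and>
     (\<forall>b\<in>D. \<phi> b = b) \<and>
     (\<forall>b\<in>D. \<forall>b'\<in>D. \<forall>a\<in>A. \<phi> (b * a * b') = b * \<phi> a * b')"

text \<open>All members of the tower live in one ambient algebra, for instance the union of the tower.
  The class \<^class>\<open>ring_1\<close> excludes the zero algebra, in accordance with \<open>\<complex> \<subseteq> B\<close>.\<close>

locale amalgamated_tower = complex_algebra scale
  for scale :: "complex \<Rightarrow> 'a::ring_1 \<Rightarrow> 'a" +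
  fixes A :: "nat \<Rightarrow> 'a set" and \<phi>\<^sub>0 :: "'a \<Rightarrow> complex" and \<phi> :: "nat \<Rightarrow> 'a \<Rightarrow> 'a"
  assumes subalgebra: "unital_subalgebra scale (A n)"
    and increasing: "A n \<subseteq> A (Suc n)"
    and \<phi>\<^sub>0_add: "a \<in> A 0 \<Longrightarrow> b \<in> A 0 \<Longrightarrow> \<phi>\<^sub>0 (a + b) = \<phi>\<^sub>0 a + \<phi>\<^sub>0 b"
    and \<phi>\<^sub>0_scale: "a \<in> A 0 \<Longrightarrow> \<phi>\<^sub>0 (scale c a) = c * \<phi>\<^sub>0 a"
    and cond_exp: "n \<ge> 1 \<Longrightarrow> conditional_expectation scale (A n) (A (n - 1)) (\<phi> n)"

definition tower_exp :: "(nat \<Rightarrow> 'a \<Rightarrow> 'a) \<Rightarrow> nat \<Rightarrow> nat \<Rightarrow> 'a \<Rightarrow> 'a" where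
  "tower_exp \<phi> k j = foldr (\<circ>) (map \<phi> [k..<Suc j]) id"


section \<open>Noncrossing partitions\<close>

definition noncrossing :: "nat set set \<Rightarrow> bool" where
  "noncrossing \<pi> \<longleftrightarrow> \<not> (\<exists>V\<in>\<pi>. \<exists>W\<in>\<pi>. V \<noteq> W \<and>
     (\<exists>a\<in>V. \<exists>b\<in>W. \<exists>c\<in>V. \<exists>d\<in>W. a < b \<and> b < c \<and> c < d))"

definition NC :: "nat \<Rightarrow> nat set set set" where
  "NC p = {\<pi>. partition_on {1..p} \<pi> \<and> noncrossing \<pi>}"

lemma finite_NC: "finite (NC p)"
  by (rule finite_subset[OF _ finitely_many_partition_on[of "{1..p}"]]) (auto simp: NC_def)

function NC_moebius :: "nat \<Rightarrow> nat set set \<Rightarrow> nat set set \<Rightarrow> int" where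
  "NC_moebius p \<pi> \<sigma> =
     (if \<pi> = \<sigma> then 1
      else if refines {1..p} \<pi> \<sigma>
      then - (\<Sum>\<tau> | \<tau> \<in> NC p \<and> refines {1..p} \<pi> \<tau> \<and> refines {1..p} \<tau> \<sigma> \<and> \<tau> \<noteq> \<sigma>.
                NC_moebius p \<pi> \<tau>)
      else 0)"
  by pat_completeness auto
termination
proof (relation "measure (\<lambda>(p, \<pi>, \<sigma>). card {\<tau> \<in> NC p. refines {1..p} \<tau> \<sigma> \<and> \<tau> \<noteq> \<sigma>})", goal_cases)
  case 1
  show ?case by simp
next
  case (2 p \<pi> \<sigma> \<tau>)
  then have \<tau>: "\<tau> \<in> NC p" "refines {1..p} \<tau> \<sigma>" "\<tau> \<noteq> \<sigma>" by auto
  have "{\<rho> \<in> NC p. refines {1..p} \<rho> \<tau> \<and> \<rho> \<noteq> \<tau>} \<subset> {\<rho> \<in> NC p. refines {1..p} \<rho> \<sigma> \<and> \<rho> \<noteq> \<sigma>}"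
    using \<tau> refines_trans[of "{1..p}" _ \<tau> \<sigma>] refines_asym[of "{1..p}" \<tau> \<sigma>] by blast
  then show ?case
    using finite_NC[of p] by (auto intro: psubset_card_mono)
qed

declare NC_moebius.simps [simp del]

text \<open>Here \<open>\<pi>\<close> is put on the odd positions \<open>1, 3, \<dots>\<close> and \<open>\<sigma>\<close> on the even positions \<open>2, 4, \<dots>\<close>.\<close>

definition alternating_union :: "nat set set \<Rightarrow> nat set set \<Rightarrow> nat set set" where
  "alternating_union \<pi> \<sigma> = (`) (\<lambda>i. 2 * i - 1) ` \<pi> \<union> (`) (\<lambda>i. 2 * i) ` \<sigma>"

definition Kreweras :: "nat \<Rightarrow> nat set set \<Rightarrow> nat set set" where
  "Kreweras p \<pi> = (THE \<sigma>. \<sigma> \<in> NC p \<and> noncrossing (alternating_union \<pi> \<sigma>) \<and>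
     (\<forall>\<sigma>'\<in>NC p. noncrossing (alternating_union \<pi> \<sigma>') \<longrightarrow> refines {1..p} \<sigma>' \<sigma>))"


section \<open>Nested evaluation, cumulants and freeness\<close>

text \<open>An elementary tensor \<open>a\<^sub>1 \<otimes> \<dots> \<otimes> a\<^sub>p\<close> is given by its entries: as a list, or as a function on the
  positions. When a block is removed from a partition, the remaining positions keep their names, so
  ``interval'' and ``neighbour'' refer to the set \<open>\<Union>\<pi>\<close> of positions that are still present.\<close>

definition interval_block :: "nat set set \<Rightarrow> nat set \<Rightarrow> bool" where
  "interval_block \<pi> V \<longleftrightarrow> V \<in> \<pi> \<and> (\<forall>i\<in>\<Union>\<pi>. Min V \<le> i \<and> i \<le> Max V \<longrightarrow> i \<in> V)"

text \<open>The value \<open>v\<close> of the block \<open>V\<close> is multiplied on the right of the last entry before \<open>V\<close>, or,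
  if there is none, on the left of the first entry after \<open>V\<close>.\<close>

definition absorb :: "nat set set \<Rightarrow> nat set \<Rightarrow> 'a::times \<Rightarrow> (nat \<Rightarrow> 'a) \<Rightarrow> nat \<Rightarrow> 'a" where
  "absorb \<pi> V v a =
     (let L = {i \<in> \<Union>\<pi> - V. i < Min V} in
      if L \<noteq> {} then a(Max L := a (Max L) * v)
      else a(Min (\<Union>\<pi> - V) := v * a (Min (\<Union>\<pi> - V))))"

definition entries :: "(nat \<Rightarrow> 'a) \<Rightarrow> nat set \<Rightarrow> 'a list" where
  "entries a V = map a (sorted_list_of_set V)"

text \<open>In \<open>nest F \<pi> a\<close> the block \<open>V\<close> of \<open>\<pi>\<close> is evaluated by \<open>F V\<close>. For a noncrossing \<open>\<pi>\<close> with several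
  blocks some interval block exists, so the last branch is only reached by one-block partitions.
  Which interval block is removed first is immaterial as soon as the block evaluations are
  bimodule maps that are balanced over the subalgebra in which they take their values.\<close>

function nest :: "(nat set \<Rightarrow> 'a::times list \<Rightarrow> 'a) \<Rightarrow> nat set set \<Rightarrow> (nat \<Rightarrow> 'a) \<Rightarrow> 'a" where
  "nest F \<pi> a =
     (if finite \<pi> \<and> card \<pi> > 1 \<and> (\<exists>V. interval_block \<pi> V)
      then let V = (SOME V. interval_block \<pi> V)
           in nest F (\<pi> - {V}) (absorb \<pi> V (F V (entries a V)) a)
      else F (\<Union>\<pi>) (entries a (\<Union>\<pi>)))"
  by pat_completeness auto
termination
proof (relation "measure (\<lambda>(F, \<pi>, a). card \<pi>)", goal_cases)
  case 1
  show ?case by simp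
next
  case (2 F \<pi> a V)
  then have "interval_block \<pi> V" by (metis someI_ex)
  then have "V \<in> \<pi>" by (simp add: interval_block_def)
  with 2 show ?case by (simp add: card_Diff1_less)
qed

declare nest.simps [simp del]

definition moment_ext :: "('a::ring_1 \<Rightarrow> 'a) \<Rightarrow> nat set set \<Rightarrow> 'a list \<Rightarrow> 'a" where
  "moment_ext \<phi> \<pi> as = nest (\<lambda>V bs. \<phi> (prod_list bs)) \<pi> (\<lambda>i. as ! (i - 1))"

definition cumulant :: "('a::ring_1 \<Rightarrow> 'a) \<Rightarrow> 'a list \<Rightarrow> 'a" where
  "cumulant \<phi> as = (\<Sum>\<pi>\<in>NC (length as).
     moment_ext \<phi> \<pi> as * of_int (NC_moebius (length as) \<pi> {{1..length as}}))"

text \<open>Vanishing of mixed cumulants. As usual, ``mixed'' refers to an assignment of the positions to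
  the two algebras: the entries at the positions in \<open>I\<close> are taken from the first algebra and the
  remaining ones from the second, and neither kind is absent. An element of the intersection may be
  used in either role. (If mixedness were read off the elements alone, then any \<open>X \<subseteq> Y\<close> would be
  free over \<open>D\<close>, in contrast to Voiculescu's notion.)\<close>

definition free_over ::
  "(complex \<Rightarrow> 'a::ring_1 \<Rightarrow> 'a) \<Rightarrow> 'a set \<Rightarrow> ('a \<Rightarrow> 'a) \<Rightarrow> 'a set \<Rightarrow> 'a set \<Rightarrow> bool" where
  "free_over scale D \<phi> X Y \<longleftrightarrow>
     (\<forall>as I. I \<subseteq> {..<length as} \<and> I \<noteq> {} \<and> I \<noteq> {..<length as} \<and>
        (\<forall>i<length as. as ! i \<in> (if i \<in> I then unital_subalgebra scale hull (D \<union> X)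
                                 else unital_subalgebra scale hull (D \<union> Y)))
        \<longrightarrow> cumulant \<phi> as = 0)"


section \<open>R-transforms\<close>

text \<open>A series in the noncommuting indeterminates \<open>z\<^sub>1, z\<^sub>2, \<dots>\<close> assigns a coefficient to each word
  \<open>[i\<^sub>1, \<dots>, i\<^sub>p]\<close>. The coefficients depend in addition on a choice \<open>d\<close> of elements of \<open>D\<close>; the element
  \<open>d r\<close> with \<open>2 \<le> r \<le> p\<close> stands for \<open>d\<^bsub>i\<^sub>r\<^esub>\<close>. It belongs to the position \<open>r\<close>, so that equal letters may
  come with different elements of \<open>D\<close>.\<close>

type_synonym 'a rseries = "(nat \<Rightarrow> 'a) \<Rightarrow> nat list \<Rightarrow> 'a"

definition rseries_eq :: "'a set \<Rightarrow> 'a rseries \<Rightarrow> 'a rseries \<Rightarrow> bool" where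
  "rseries_eq D R S \<longleftrightarrow> (\<forall>d. (\<forall>r. d r \<in> D) \<longrightarrow> (\<forall>w. R d w = S d w))"

definition rseries_add :: "'a::plus rseries \<Rightarrow> 'a rseries \<Rightarrow> 'a rseries" where
  "rseries_add R S = (\<lambda>d w. R d w + S d w)"

text \<open>\<open>shift_vars s R\<close> is the series \<open>R(z\<^bsub>s+1\<^esub>, z\<^bsub>s+2\<^esub>, \<dots>)\<close>.\<close>

definition shift_vars :: "nat \<Rightarrow> 'a::zero rseries \<Rightarrow> 'a rseries" where
  "shift_vars s R = (\<lambda>d w. if \<forall>i\<in>set w. s < i then R d (map (\<lambda>i. i - s) w) else 0)"

definition concat_vars :: "nat \<Rightarrow> (nat \<Rightarrow> 'a) \<Rightarrow> (nat \<Rightarrow> 'a) \<Rightarrow> nat \<Rightarrow> 'a" where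
  "concat_vars s x y = (\<lambda>i. if i \<le> s then x i else y (i - s))"

definition twisted_entry :: "(nat \<Rightarrow> 'a::times) \<Rightarrow> (nat \<Rightarrow> 'a) \<Rightarrow> nat list \<Rightarrow> nat \<Rightarrow> 'a" where
  "twisted_entry d a w r = (if r = 1 then a (w ! (r - 1)) else d r * a (w ! (r - 1)))"

definition R_transform :: "('a::ring_1 \<Rightarrow> 'a) \<Rightarrow> nat \<Rightarrow> (nat \<Rightarrow> 'a) \<Rightarrow> 'a rseries" where
  "R_transform \<phi> s a = (\<lambda>d w.
     if w \<noteq> [] \<and> set w \<subseteq> {1..s}
     then cumulant \<phi> (map (twisted_entry d a w) [1..<Suc (length w)])
     else 0)"

text \<open>\<open>boxed_conv \<phi> \<psi> s x y\<close> is the boxed convolution of the R-transform of \<open>x\<close> with respect to \<open>\<phi>\<close>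
  and the trivial R-transform of \<open>y\<close> with respect to \<open>\<psi>\<close>: the entries from \<open>y\<close> carry no elements of
  \<open>D\<close>. Both positions \<open>2 r - 1\<close> and \<open>2 r\<close> belong to the letter number \<open>r\<close>.\<close>

definition boxed_conv ::
  "('a::ring_1 \<Rightarrow> 'a) \<Rightarrow> ('a \<Rightarrow> 'a) \<Rightarrow> nat \<Rightarrow> (nat \<Rightarrow> 'a) \<Rightarrow> (nat \<Rightarrow> 'a) \<Rightarrow> 'a rseries" where
  "boxed_conv \<phi> \<psi> s x y = (\<lambda>d w.
     if w \<noteq> [] \<and> set w \<subseteq> {1..s}
     then \<Sum>\<pi>\<in>NC (length w).
            nest (\<lambda>V. if \<forall>i\<in>V. odd i then cumulant \<phi> else cumulant \<psi>)
              (alternating_union \<pi> (Kreweras (length w) \<pi>))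
              (\<lambda>j. let r = (j + 1) div 2
                   in if odd j then twisted_entry d x w r else y (w ! (r - 1)))
     else 0)"

end

theory Submission
  imports Defs
begin

text \<open>The nested evaluation of a noncrossing partition does not depend on the order in which interval
  blocks are removed, because the block evaluations are bimodule maps. Evaluating a block by the
  moment-cumulant formula and composing the nestings shows that the moment of \<open>\<pi>\<close> is the sum of the
  cumulants of all \<open>\<sigma> \<le> \<pi>\<close>. The first two claims follow from this by vanishing of mixed cumulants and
  multilinearity.

  For the third one, expand a cumulant with products as entries over the moments of the partitions
  \<open>\<rho>\<close> of the letters, and each moment over the cumulants of the \<open>\<sigma>\<close> below the doubling of \<open>\<rho>\<close>. In the
  total, the cumulant of \<open>\<sigma>\<close> is multiplied by the sum of \<open>\<mu>(\<rho>, 1)\<close> over all \<open>\<rho>\<close> whose doubling is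
  coarser than \<open>\<sigma>\<close>, which vanishes unless \<open>\<rho> = 1\<close> is the only one. By freeness only \<open>\<sigma> = \<pi> \<union> \<tau>\<close>
  with \<open>\<pi>\<close> on the odd and \<open>\<tau>\<close> on the even positions contributes, and for such a \<open>\<sigma>\<close> the condition means
  that \<open>\<tau>\<close> is the Kreweras complement of \<open>\<pi>\<close>.\<close>

section \<open>Nested evaluation\<close>

text \<open>\<open>nest\<close> removes an interval block selected by \<open>SOME\<close>, so no
  nesting can be reorganised before independence of the order is available; it is shown for an
  abstract block evaluation that covers moments and cumulants alike. Removed blocks leave gaps in
  the positions, which forces partitions of arbitrary finite sets (\<open>NC_on P\<close>), whereas
  cumulants are defined on \<open>{1..p}\<close>; the increasing enumeration of a block reconciles
  the two. The moment-cumulant relation is obtained by induction on block size, since a cumulant is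
  defined by inversion at the one-block partition only. Joins are replaced by the partitions that
  bound them: that the join of \<sigma> with the pairing {1,2}, {3,4}, ... is 1 becomes a condition
  on all \<rho> whose doubling is coarser than \<sigma>. The Kreweras complement becomes an explicit
  relation between positions. The three expectations take values in the same
  \<open>A (k - 1)\<close>, and that of \<open>A N\<close> restricts to those of \<open>A m\<close>
  and \<open>A n\<close>. Freeness is therefore applied in \<open>A N\<close> throughout, and the
  cumulants are exchanged at the end, for the boxed convolution inside the nesting.\<close>

definition NC_on :: "nat set \<Rightarrow> nat set set set" where
  "NC_on P = {\<pi>. partition_on P \<pi> \<and> noncrossing \<pi>}"

lemma NC_eq: "NC p = NC_on {1..p}"
  by (simp add: NC_def NC_on_def)

lemma finite_NC_on: "finite P \<Longrightarrow> finite (NC_on P)"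
  by (rule finite_subset[OF _ finitely_many_partition_on[of P]]) (auto simp: NC_on_def)

lemma noncrossingD:
  assumes "noncrossing \<pi>" "V \<in> \<pi>" "W \<in> \<pi>" "a \<in> V" "b \<in> W" "c \<in> V" "d \<in> W" "a < b" "b < c" "c < d"
  shows "V = W"
proof (rule ccontr)
  assume "V \<noteq> W"
  then have "\<exists>V\<in>\<pi>. \<exists>W\<in>\<pi>. V \<noteq> W \<and> (\<exists>a\<in>V. \<exists>b\<in>W. \<exists>c\<in>V. \<exists>d\<in>W. a < b \<and> b < c \<and> c < d)"
    by (intro bexI[of _ V] bexI[of _ W] conjI bexI[of _ a] bexI[of _ b] bexI[of _ c] bexI[of _ d] assms)
  then show False using assms(1) unfolding noncrossing_def by (rule notE[rotated])
qed

lemma noncrossingI: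
  assumes "\<And>V W a b c d. V \<in> \<pi> \<Longrightarrow> W \<in> \<pi> \<Longrightarrow> a \<in> V \<Longrightarrow> b \<in> W \<Longrightarrow> c \<in> V \<Longrightarrow> d \<in> W \<Longrightarrow>
    a < b \<Longrightarrow> b < c \<Longrightarrow> c < d \<Longrightarrow> V = W"
  shows "noncrossing \<pi>"
  unfolding noncrossing_def
proof (rule notI, elim bexE conjE)
  fix V W a b c d
  assume "V \<in> \<pi>" "W \<in> \<pi>" "V \<noteq> W" "a \<in> V" "b \<in> W" "c \<in> V" "d \<in> W" "a < b" "b < c" "c < d"
  then show False using assms[of V W a b c d] by simp
qed

lemma noncrossing_subset: "noncrossing \<pi> \<Longrightarrow> \<sigma> \<subseteq> \<pi> \<Longrightarrow> noncrossing \<sigma>"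
  by (rule noncrossingI) (meson noncrossingD subsetD)

lemma NC_onD:
  assumes "\<pi> \<in> NC_on P"
  shows "\<Union>\<pi> = P" "noncrossing \<pi>" "disjoint \<pi>" "{} \<notin> \<pi>" "partition_on P \<pi>"
  using assms by (auto simp: NC_on_def partition_on_def)

lemma NC_on_finite: "\<pi> \<in> NC_on P \<Longrightarrow> finite P \<Longrightarrow> finite \<pi>"
  by (metis NC_onD(5) finite_elements)

lemma NC_on_block:
  assumes "\<pi> \<in> NC_on P" "finite P" "V \<in> \<pi>"
  shows "finite V" "V \<noteq> {}" "V \<subseteq> P"
  using NC_onD[OF assms(1)] assms(2,3) finite_subset[of V P] by auto

lemma NC_on_disjoint:
  assumes "\<pi> \<in> NC_on P" "V \<in> \<pi>" "W \<in> \<pi>" "i \<in> V" "i \<in> W"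
  shows "V = W"
  using NC_onD(3)[OF assms(1)] assms(2-) by (auto simp: disjoint_def)

lemma one_block_NC_on: "P \<noteq> {} \<Longrightarrow> {P} \<in> NC_on P"
  by (auto simp: NC_on_def noncrossing_def partition_on_space)

lemma NC_on_diff:
  assumes "\<pi> \<in> NC_on P" "V \<in> \<pi>"
  shows "\<pi> - {V} \<in> NC_on (P - V)"
proof -
  have "\<Union>(\<pi> - {V}) = P - V"
    using NC_onD[OF assms(1)] assms(2) by (auto simp: disjoint_def)
  then show ?thesis
    using NC_onD[OF assms(1)] noncrossing_subset[of \<pi> "\<pi> - {V}"]
    by (auto simp: NC_on_def partition_on_def disjoint_def)
qed

lemma NC_on_card1:
  assumes "\<pi> \<in> NC_on P" "finite P" "P \<noteq> {}" "\<not> card \<pi> > 1"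
  shows "\<pi> = {P}"
proof -
  have "finite \<pi>" using NC_on_finite assms by blast
  moreover have "\<pi> \<noteq> {}" using NC_onD(1)[OF assms(1)] assms(3) by auto
  ultimately have "card \<pi> = 1" using assms(4) by (metis card_0_eq less_one linorder_neqE_nat)
  then obtain V where "\<pi> = {V}" using card_1_singletonE by blast
  then show ?thesis using NC_onD(1)[OF assms(1)] by auto
qed

lemma interval_blockD:
  assumes "interval_block \<pi> V" "\<pi> \<in> NC_on P" "i \<in> P" "i \<notin> V"
  shows "i < Min V \<or> Max V < i"
  using assms NC_onD(1)[OF assms(2)] unfolding interval_block_def by force

lemma interval_block_in: "interval_block \<pi> V \<Longrightarrow> V \<in> \<pi>"
  by (simp add: interval_block_def)

lemma interval_block_subset:
  "interval_block \<pi> V \<Longrightarrow> \<sigma> \<subseteq> \<pi> \<Longrightarrow> V \<in> \<sigma> \<Longrightarrow> interval_block \<sigma> V"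
  unfolding interval_block_def by (meson Union_mono subsetD)

text \<open>Among the blocks that avoid the first position, one of least span is an interval: any
  other block meeting its span is trapped in it by noncrossingness and would have smaller span.
  Avoiding the first position guarantees a left neighbour that absorbs the value.\<close>

lemma exists_interval_block:
  assumes \<pi>: "\<pi> \<in> NC_on P" "finite P" "card \<pi> > 1"
  obtains V where "interval_block \<pi> V" "Min P \<notin> V"
proof -
  define S where "S = {V \<in> \<pi>. Min P \<notin> V}"
  have fin: "finite S" using NC_on_finite[OF \<pi>(1,2)] by (simp add: S_def)
  have "S \<noteq> {}"
  proof
    assume "S = {}"
    then have all: "Min P \<in> V" if "V \<in> \<pi>" for V using that by (auto simp: S_def)
    have "V = W" if "V \<in> \<pi>" "W \<in> \<pi>" for V W
      using all that NC_on_disjoint[OF \<pi>(1)] by blast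
    then have "card \<pi> \<le> 1" using \<pi> by (metis card_le_Suc0_iff_eq NC_on_finite One_nat_def)
    then show False using \<pi> by simp
  qed
  define V where "V = arg_min_on (\<lambda>V. Max V - Min V) S"
  have V: "V \<in> S" unfolding V_def by (rule arg_min_if_finite(1)[OF fin \<open>S \<noteq> {}\<close>])
  have minV: "\<not> (Max W - Min W < Max V - Min V)" if "W \<in> S" for W
    using arg_min_if_finite(2)[OF fin \<open>S \<noteq> {}\<close>, of "\<lambda>V. Max V - Min V"] that V_def by blast
  have V\<pi>: "V \<in> \<pi>" "Min P \<notin> V" using V by (auto simp: S_def)
  note b = NC_on_block[OF \<pi>(1,2)]
  have "i \<in> V" if i: "i \<in> \<Union>\<pi>" "Min V \<le> i" "i \<le> Max V" for i
  proof (rule ccontr)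
    assume niV: "i \<notin> V"
    obtain W where W: "W \<in> \<pi>" "i \<in> W" using i by blast
    have WV: "W \<noteq> V" using W niV by auto
    have mm: "Min V \<in> V" "Max V \<in> V" using b[OF V\<pi>(1)] by auto
    have lt: "Min V < i" "i < Max V" using i niV mm by (metis le_less)+
    have in_between: "Min V < j \<and> j < Max V" if j: "j \<in> W" for j
    proof -
      have "j \<noteq> Min V" "j \<noteq> Max V" using j mm NC_on_disjoint[OF \<pi>(1) W(1) V\<pi>(1)] WV by auto
      moreover have "\<not> j < Min V"
        using noncrossingD[OF NC_onD(2)[OF \<pi>(1)] W(1) V\<pi>(1) j mm(1) W(2) mm(2)] lt WV by auto
      moreover have "\<not> Max V < j"
        using noncrossingD[OF NC_onD(2)[OF \<pi>(1)] V\<pi>(1) W(1) mm(1) W(2) mm(2) j] lt WV by auto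
      ultimately show ?thesis by linarith
    qed
    \<comment> \<open>Being trapped strictly to the right of \<open>Min V\<close>, the block
      \<open>W\<close> avoids the first position as well and competes for the least span.\<close>
    have "Min P \<le> Min V" using \<pi>(2) b(3)[OF V\<pi>(1)] mm by auto
    then have "Min P \<notin> W" using in_between by fastforce
    then have "W \<in> S" using W by (simp add: S_def)
    moreover have "Min V < Min W" "Max W < Max V"
      using in_between b[OF W(1)] by auto
    moreover have "Min W \<le> Max W" using b[OF W(1)] by auto
    ultimately show False using minV[of W] by linarith
  qed
  then have "interval_block \<pi> V" using V\<pi> by (simp add: interval_block_def)
  then show ?thesis using V\<pi> that by blast
qed

text \<open>Removing a block that avoids the first position, its value is always absorbed on the right.\<close>

definition left_nbr :: "nat set \<Rightarrow> nat set \<Rightarrow> nat" where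
  "left_nbr P V = Max {i \<in> P. i < Min V}"

lemma left_nbr:
  assumes "finite P" "V \<subseteq> P" "V \<noteq> {}" "Min P \<notin> V"
  shows "left_nbr P V \<in> P" "left_nbr P V < Min V" "left_nbr P V \<notin> V"
    "\<And>i. i \<in> P \<Longrightarrow> i < Min V \<Longrightarrow> i \<le> left_nbr P V"
proof -
  have fV: "finite V" using assms finite_subset by blast
  have "Min V \<in> V" using fV assms by auto
  then have "Min P < Min V" using assms by (metis Min_in Min_le in_mono le_neq_implies_less)
  moreover have "Min P \<in> P" using assms(1) \<open>Min V \<in> V\<close> assms(2) by (intro Min_in) auto
  ultimately have ne: "{i \<in> P. i < Min V} \<noteq> {}" by blast
  have "left_nbr P V \<in> {i \<in> P. i < Min V}"
    unfolding left_nbr_def using assms ne by (intro Max_in) auto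
  then show "left_nbr P V \<in> P" "left_nbr P V < Min V" by auto
  then show "left_nbr P V \<notin> V" using Min_le[OF fV] by force
  show "i \<in> P \<Longrightarrow> i < Min V \<Longrightarrow> i \<le> left_nbr P V" for i
    unfolding left_nbr_def using assms by (intro Max_ge) auto
qed

lemma absorb_eq_left_nbr:
  assumes "\<Union>\<pi> = P" "finite P" "V \<subseteq> P" "V \<noteq> {}" "Min P \<notin> V"
  shows "absorb \<pi> V v a = a(left_nbr P V := a (left_nbr P V) * v)"
proof -
  have "finite V" using assms finite_subset by blast
  then have "{i \<in> \<Union>\<pi> - V. i < Min V} = {i \<in> P. i < Min V}"
    using assms(1) by (auto dest: Min_le)
  moreover have "{i \<in> P. i < Min V} \<noteq> {}" using left_nbr[OF assms(2-5)] by blast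
  ultimately show ?thesis by (simp add: absorb_def left_nbr_def Let_def)
qed

text \<open>The absorbing position and the side of multiplication depend on \<open>\<pi>\<close> and
  \<open>V\<close> alone, so two tensors or two block evaluations are modified at the same
  place.\<close>

lemma absorb_other:
  assumes "\<Union>\<pi> = P" "finite P" "V \<subseteq> P" "P - V \<noteq> {}"
  obtains l where "l \<in> P - V" "\<And>v (a :: nat \<Rightarrow> 'a::times). absorb \<pi> V v a = a(l := a l * v)"
    | l where "l \<in> P - V" "\<And>v (a :: nat \<Rightarrow> 'a::times). absorb \<pi> V v a = a(l := v * a l)"
proof (cases "{i \<in> \<Union>\<pi> - V. i < Min V} = {}")
  case False
  have "Max {i \<in> \<Union>\<pi> - V. i < Min V} \<in> {i \<in> \<Union>\<pi> - V. i < Min V}"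
    using False assms by (intro Max_in) auto
  moreover have "absorb \<pi> V v a = a(Max {i \<in> \<Union>\<pi> - V. i < Min V} := a (Max {i \<in> \<Union>\<pi> - V. i < Min V}) * v)" for v and a :: "nat \<Rightarrow> 'a"
    unfolding absorb_def Let_def by (simp only: False not_False_eq_True if_True)
  ultimately show ?thesis using that(1) assms(1) by blast
next
  case True
  have "Min (\<Union>\<pi> - V) \<in> P - V" using assms by (metis Min_in finite_Diff)
  moreover have "absorb \<pi> V v a = a(Min (\<Union>\<pi> - V) := v * a (Min (\<Union>\<pi> - V)))" for v and a :: "nat \<Rightarrow> 'a"
    unfolding absorb_def Let_def by (subst True, simp)
  ultimately show ?thesis using that(2) by blast
qed

section \<open>Nested evaluation: unfolding, congruence, induction\<close>

lemma entries_cong: "finite V \<Longrightarrow> (\<And>i. i \<in> V \<Longrightarrow> a i = b i) \<Longrightarrow> entries a V = entries b V"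
  by (simp add: entries_def)

lemma nest_one_block: "nest F {P} a = F P (entries a P)"
  by (subst nest.simps) simp

text \<open>The block selected by \<open>SOME\<close> depends on \<open>\<pi>\<close> only. One
  \<open>V\<close> thus serves all evaluations and all tensors, which allows two nestings to be
  compared before the order of removal is known to be immaterial.\<close>

lemma nest_choice:
  assumes "\<pi> \<in> NC_on P" "finite P" "card \<pi> > 1"
  obtains V where "interval_block \<pi> V"
    "\<And>F :: nat set \<Rightarrow> 'a::times list \<Rightarrow> 'a. \<And>a. nest F \<pi> a = nest F (\<pi> - {V}) (absorb \<pi> V (F V (entries a V)) a)"
proof (rule that)
  have ex: "\<exists>V. interval_block \<pi> V" using exists_interval_block[OF assms] by metis
  then show "interval_block \<pi> (SOME V. interval_block \<pi> V)" by (rule someI_ex)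
  fix F :: "nat set \<Rightarrow> 'a list \<Rightarrow> 'a" and a
  let ?V = "SOME V. interval_block \<pi> V"
  show "nest F \<pi> a = nest F (\<pi> - {?V}) (absorb \<pi> ?V (F ?V (entries a ?V)) a)"
    using assms(3) ex NC_on_finite[OF assms(1,2)] by (subst nest.simps) (simp add: Let_def)
qed

lemma NC_on_diff_nonempty:
  assumes "\<pi> \<in> NC_on P" "finite P" "card \<pi> > 1" "V \<in> \<pi>"
  shows "P - V \<noteq> {}" 
proof -
  have "\<not> \<pi> \<subseteq> {V}" using assms(3) card_mono[of "{V}" \<pi>] by auto
  then obtain W where "W \<in> \<pi>" "W \<noteq> V" by blast
  then show ?thesis using NC_on_block[OF assms(1,2), of W] NC_on_disjoint[OF assms(1) assms(4)] by blast
qed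

text \<open>The sets \<open>B i\<close> accompany the positions through the removals: an entry may
  pick up values from \<open>D\<close> on either side and has to stay where the two evaluations are
  known to agree.\<close>

lemma nest_cong:
  fixes F G :: "nat set \<Rightarrow> 'a::times list \<Rightarrow> 'a"
  assumes "\<pi> \<in> NC_on P" "finite P" "P \<noteq> {}"
    and "\<And>i. i \<in> P \<Longrightarrow> a i = b i" "\<And>i. i \<in> P \<Longrightarrow> a i \<in> B i"
    and "\<And>i z d. i \<in> P \<Longrightarrow> z \<in> B i \<Longrightarrow> d \<in> D \<Longrightarrow> z * d \<in> B i \<and> d * z \<in> B i"
    and "\<And>V c. V \<in> \<pi> \<Longrightarrow> (\<And>i. i \<in> V \<Longrightarrow> c i \<in> B i) \<Longrightarrow>
           F V (entries c V) = G V (entries c V) \<and> F V (entries c V) \<in> D"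
  shows "nest F \<pi> a = nest G \<pi> b \<and> nest F \<pi> a \<in> D"
  using assms
proof (induction "card \<pi>" arbitrary: \<pi> P a b rule: less_induct)
  case less
  note \<pi> = less.prems(1-3)
  show ?case
  proof (cases "card \<pi> > 1")
    case False
    then have eq: "\<pi> = {P}" using NC_on_card1 \<pi> by blast
    have "entries a P = entries b P" using less.prems(4) \<pi>(2) by (intro entries_cong) auto
    moreover have "F P (entries a P) = G P (entries a P) \<and> F P (entries a P) \<in> D"
      using less.prems(7)[of P a] less.prems(5) eq by blast
    ultimately show ?thesis unfolding eq nest_one_block by metis
  next
    case True
    obtain V where V: "interval_block \<pi> V"
      "\<And>F :: nat set \<Rightarrow> 'a list \<Rightarrow> 'a. \<And>a. nest F \<pi> a = nest F (\<pi> - {V}) (absorb \<pi> V (F V (entries a V)) a)"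
      using nest_choice[OF \<pi>(1,2) True] by blast
    have V\<pi>: "V \<in> \<pi>" using V(1) interval_block_in by blast
    note bl = NC_on_block[OF \<pi>(1,2) V\<pi>]
    have ne: "P - V \<noteq> {}" using NC_on_diff_nonempty[OF \<pi>(1,2) True V\<pi>] .
    have ev: "F V (entries a V) = G V (entries b V) \<and> F V (entries a V) \<in> D"
    proof -
      have "entries a V = entries b V" using less.prems(4) bl by (intro entries_cong) auto
      then show ?thesis using less.prems(7)[OF V\<pi>, of a] less.prems(5) bl by auto
    qed
    define v where "v = F V (entries a V)"
    have ab: "absorb \<pi> V v a i = absorb \<pi> V v b i \<and> absorb \<pi> V v a i \<in> B i" if "i \<in> P - V" for i
    proof (rule absorb_other[OF NC_onD(1)[OF \<pi>(1)] \<pi>(2) bl(3) ne])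
      have v: "v \<in> D" and ai: "a i = b i" "a i * v \<in> B i" "v * a i \<in> B i" "a i \<in> B i"
        using that ev less.prems(4,5,6) by (auto simp: v_def)
      show ?thesis if "l \<in> P - V" "\<And>v (a :: nat \<Rightarrow> 'a). absorb \<pi> V v a = a(l := a l * v)" for l :: nat
        unfolding that(2) using ai by (cases "i = l") auto
      show ?thesis if "l \<in> P - V" "\<And>v (a :: nat \<Rightarrow> 'a). absorb \<pi> V v a = a(l := v * a l)" for l :: nat
        unfolding that(2) using ai by (cases "i = l") auto
    qed
    have "nest F (\<pi> - {V}) (absorb \<pi> V v a) = nest G (\<pi> - {V}) (absorb \<pi> V v b) \<and>
       nest F (\<pi> - {V}) (absorb \<pi> V v a) \<in> D"
    proof (rule less.hyps[of "\<pi> - {V}" "P - V"])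
      show "card (\<pi> - {V}) < card \<pi>" using V\<pi> NC_on_finite[OF \<pi>(1,2)] by (rule card_Diff1_less[rotated])
      show "\<pi> - {V} \<in> NC_on (P - V)" using NC_on_diff[OF \<pi>(1) V\<pi>] .
      show "F W (entries c W) = G W (entries c W) \<and> F W (entries c W) \<in> D"
        if "W \<in> \<pi> - {V}" "\<And>i. i \<in> W \<Longrightarrow> c i \<in> B i" for W c
        using less.prems(7)[of W c] that by blast
      show "z * d \<in> B i \<and> d * z \<in> B i" if "i \<in> P - V" "z \<in> B i" "d \<in> D" for i z d
        using less.prems(6) that by blast
      show "absorb \<pi> V v a i = absorb \<pi> V v b i" "absorb \<pi> V v a i \<in> B i" if "i \<in> P - V" for i
        using ab[OF that] by (rule conjunct1 conjunct2)+
    qed (use \<pi> ne in simp_all)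
    moreover have "nest F \<pi> a = nest F (\<pi> - {V}) (absorb \<pi> V v a)" "nest G \<pi> b = nest G (\<pi> - {V}) (absorb \<pi> V v b)"
      using V(2)[of F a] V(2)[of G b] ev by (simp_all add: v_def)
    ultimately show ?thesis by metis
  qed
qed

lemma nest_cong_entries:
  assumes "\<pi> \<in> NC_on P" "finite P" "P \<noteq> {}" "\<And>i. i \<in> P \<Longrightarrow> a i = b i"
  shows "nest F \<pi> a = nest F \<pi> b"
  using nest_cong[OF assms, where B = "\<lambda>_. UNIV" and D = UNIV and F = F and G = F] by auto

text \<open>Removing only blocks without the first position keeps \<open>Min P\<close> fixed along
  the induction and makes every absorption happen on the right of an entry.\<close>

lemma NC_induct [consumes 3, case_names one_block remove]:
  assumes "\<pi> \<in> NC_on P" "finite P" "P \<noteq> {}"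
    and one: "\<And>P. finite P \<Longrightarrow> P \<noteq> {} \<Longrightarrow> Q P {P}"
    and rem: "\<And>\<pi> P V. \<pi> \<in> NC_on P \<Longrightarrow> finite P \<Longrightarrow> interval_block \<pi> V \<Longrightarrow> V \<in> \<pi> \<Longrightarrow> V \<subseteq> P \<Longrightarrow>
        finite V \<Longrightarrow> V \<noteq> {} \<Longrightarrow> Min P \<in> P - V \<Longrightarrow> Min (P - V) = Min P \<Longrightarrow> Q (P - V) (\<pi> - {V}) \<Longrightarrow> Q P \<pi>"
  shows "Q P \<pi>"
  using assms(1-3)
proof (induction "card \<pi>" arbitrary: \<pi> P rule: less_induct)
  case less
  note \<pi> = less.prems
  show ?case
  proof (cases "card \<pi> > 1")
    case False
    then show ?thesis using NC_on_card1[OF \<pi>] one[OF \<pi>(2,3)] by simp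
  next
    case True
    obtain V where V: "interval_block \<pi> V" "Min P \<notin> V" using exists_interval_block[OF \<pi>(1,2) True] .
    have V\<pi>: "V \<in> \<pi>" using V interval_block_in by blast
    have m: "Min P \<in> P - V" using V \<pi> by simp
    then have "Min (P - V) = Min P" using \<pi>(2) by (intro Min_eqI) auto
    moreover have "Q (P - V) (\<pi> - {V})"
    proof (rule less.hyps)
      show "card (\<pi> - {V}) < card \<pi>" using V\<pi> NC_on_finite[OF \<pi>(1,2)] by (rule card_Diff1_less[rotated])
    qed (use NC_on_diff[OF \<pi>(1) V\<pi>] \<pi> m in blast)+
    ultimately show ?thesis using rem[OF \<pi>(1,2) V(1) V\<pi>] NC_on_block[OF \<pi>(1,2) V\<pi>] m by blast
  qed
qed

section \<open>Independence of the order of removal\<close>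

lemma absorb_left:
  assumes "\<Union>\<pi> = P" "finite P" "l \<in> P - V" "l < Min V" "\<And>i. i \<in> P - V \<Longrightarrow> i < Min V \<Longrightarrow> i \<le> l"
  shows "absorb \<pi> V v a = a(l := a l * v)"
proof -
  have ne: "{i \<in> \<Union>\<pi> - V. i < Min V} \<noteq> {}" using assms by blast
  have "Max {i \<in> \<Union>\<pi> - V. i < Min V} = l"
    using assms by (intro Max_eqI) auto
  then show ?thesis unfolding absorb_def Let_def by (simp only: ne if_True not_False_eq_True)
qed

lemma absorb_right:
  assumes "\<Union>\<pi> = P" "finite P" "r \<in> P - V" "\<And>i. i \<in> P - V \<Longrightarrow> \<not> i < Min V" "\<And>i. i \<in> P - V \<Longrightarrow> r \<le> i"
  shows "absorb \<pi> V v a = a(r := v * a r)"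
proof -
  have e: "{i \<in> \<Union>\<pi> - V. i < Min V} = {}" using assms by blast
  have "Min (\<Union>\<pi> - V) = r" using assms by (intro Min_eqI) auto
  then show ?thesis unfolding absorb_def Let_def by (subst e) simp
qed

text \<open>Common abstraction of moments and cumulants. The module axioms concern the two outer
  entries of a block, because these are the entries at which one interval block can absorb the value
  of an adjacent one.\<close>

locale bimodule_eval =
  fixes D A :: "'a::ring_1 set" and F :: "nat set \<Rightarrow> 'a list \<Rightarrow> 'a"
  assumes D_subset: "D \<subseteq> A" and A_zero: "0 \<in> A"
    and A_add: "x \<in> A \<Longrightarrow> y \<in> A \<Longrightarrow> x + y \<in> A"
    and A_mult: "x \<in> A \<Longrightarrow> y \<in> A \<Longrightarrow> x * y \<in> A"
    and D_mult: "x \<in> D \<Longrightarrow> y \<in> D \<Longrightarrow> x * y \<in> D"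
    and F_closed: "finite V \<Longrightarrow> V \<noteq> {} \<Longrightarrow> a ` V \<subseteq> A \<Longrightarrow> F V (entries a V) \<in> D"
    and F_left: "finite V \<Longrightarrow> V \<noteq> {} \<Longrightarrow> a ` V \<subseteq> A \<Longrightarrow> d \<in> D \<Longrightarrow>
      F V (entries (a(Min V := d * a (Min V))) V) = d * F V (entries a V)"
    and F_right: "finite V \<Longrightarrow> V \<noteq> {} \<Longrightarrow> a ` V \<subseteq> A \<Longrightarrow> d \<in> D \<Longrightarrow>
      F V (entries (a(Max V := a (Max V) * d)) V) = F V (entries a V) * d"
    and F_add: "finite V \<Longrightarrow> i \<in> V \<Longrightarrow> a ` V \<subseteq> A \<Longrightarrow> b \<in> A \<Longrightarrow> c \<in> A \<Longrightarrow>
      F V (entries (a(i := b + c)) V) = F V (entries (a(i := b)) V) + F V (entries (a(i := c)) V)"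
begin

text \<open>\<open>L\<close> collects the positions before \<open>V\<close>, and \<open>M\<close>
  those between the blocks. The blocks influence each other only if \<open>M\<close> is empty:
  \<open>w\<close> then lands on the last entry of \<open>V\<close> and leaves \<open>F V\<close> on
  the right. If \<open>L\<close> is empty too, the other order puts \<open>v\<close> on the first
  entry of \<open>W\<close>, and it leaves \<open>F W\<close> on the left. Either way
  \<open>v * w\<close> reaches the same position.\<close>

lemma absorb_commute:
  assumes \<pi>: "\<pi> \<in> NC_on P" "finite P" and V: "interval_block \<pi> V" and W: "interval_block \<pi> W"
    and VW: "Max V < Min W" and aA: "a ` P \<subseteq> A" and ne: "P - V - W \<noteq> {}" and i: "i \<in> P - V - W"
    and v: "v = F V (entries a V)" and w: "w = F W (entries a W)"
    and a1: "a1 = absorb \<pi> W w a" and a2: "a2 = absorb \<pi> V v a"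
  shows "absorb (\<pi> - {W}) V (F V (entries a1 V)) a1 i = absorb (\<pi> - {V}) W (F W (entries a2 W)) a2 i"
proof -
  have V\<pi>: "V \<in> \<pi>" and W\<pi>: "W \<in> \<pi>" using V W interval_block_in by auto
  note bV = NC_on_block[OF \<pi> V\<pi>] and bW = NC_on_block[OF \<pi> W\<pi>]
  have U: "\<Union>\<pi> = P" "\<Union>(\<pi> - {V}) = P - V" "\<Union>(\<pi> - {W}) = P - W"
    using NC_onD(1) NC_on_diff \<pi> V\<pi> W\<pi> by metis+
  have mm: "Min V \<in> V" "Max V \<in> V" "Min W \<in> W" "Max W \<in> W" "Min V \<le> Max V" "Min W \<le> Max W"
    using bV bW by auto
  have dVW: "j \<notin> W" if "j \<in> V" for j
    using that VW bV bW by (metis Max_ge Min_le leD le_trans)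
  have oV: "j < Min V \<or> Max V < j" if "j \<in> P" "j \<notin> V" for j
    using interval_blockD[OF V \<pi>(1)] that by blast
  have oW: "j < Min W \<or> Max W < j" if "j \<in> P" "j \<notin> W" for j
    using interval_blockD[OF W \<pi>(1)] that by blast
  have inV: "Min V \<le> j \<and> j \<le> Max V" if "j \<in> V" for j using that bV by auto
  have inW: "Min W \<le> j \<and> j \<le> Max W" if "j \<in> W" for j using that bW by auto
  have aV: "a ` V \<subseteq> A" and aW: "a ` W \<subseteq> A" using aA bV bW by auto
  have vw: "v \<in> D" "w \<in> D" using F_closed aV aW bV bW v w by auto
  define L where "L = {j \<in> P. j < Min V}"
  define M where "M = {j \<in> P. Max V < j \<and> j < Min W}"
  have fin: "finite L" "finite M" using \<pi>(2) by (auto simp: L_def M_def)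
  show ?thesis
  proof (cases "M = {}")
    case False
    define q where "q = Max M"
    have q: "q \<in> P" "Max V < q" "q < Min W" "\<And>j. j \<in> M \<Longrightarrow> j \<le> q"
      using Max_in[OF fin(2) False] Max_ge[OF fin(2)] by (auto simp: q_def M_def)
    have qVW: "q \<notin> V" "q \<notin> W" using q inV inW by fastforce+
    have a1': "a1 = a(q := a q * w)"
      unfolding a1 using U(1) \<pi>(2)
    proof (rule absorb_left)
      show "j \<le> q" if "j \<in> P - W" "j < Min W" for j
        using q(2) q(4)[of j] that by (force simp: M_def)
    qed (use q qVW in auto)
    have e1: "F V (entries a1 V) = v"
      unfolding v a1' using bV qVW by (intro arg_cong[of _ _ "F V"] entries_cong) auto
    show ?thesis
    proof (cases "L = {}")
      case L: False
      define l where "l = Max L"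
      have l: "l \<in> P" "l < Min V" "\<And>j. j \<in> L \<Longrightarrow> j \<le> l"
        using Max_in[OF fin(1) L] Max_ge[OF fin(1)] by (auto simp: l_def L_def)
      have lVW: "l \<notin> V" "l \<notin> W" using l inV inW VW mm by fastforce+
      have a2': "a2 = a(l := a l * v)"
        unfolding a2 using U(1) \<pi>(2) by (rule absorb_left) (use l lVW in \<open>auto simp: L_def\<close>)
      have e2: "F W (entries a2 W) = w"
        unfolding w a2' using bW lVW by (intro arg_cong[of _ _ "F W"] entries_cong) auto
      have "absorb (\<pi> - {W}) V v a1 = a1(l := a1 l * v)"
        using U(3) by (rule absorb_left) (use l lVW \<pi>(2) in \<open>auto simp: L_def\<close>)
      moreover have "absorb (\<pi> - {V}) W w a2 = a2(q := a2 q * w)"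
        using U(2)
      proof (rule absorb_left)
        show "j \<le> q" if "j \<in> P - V - W" "j < Min W" for j
          using q(2) q(4)[of j] that by (force simp: M_def)
      qed (use q qVW \<pi>(2) in auto)
      moreover have "l \<noteq> q" using l q mm by linarith
      ultimately show ?thesis unfolding e1 e2 by (simp add: a1' a2')
    next
      case L: True
      \<comment> \<open>Nothing precedes \<open>V\<close>, so \<open>v\<close> moves to the right,
        to the first element of \<open>M\<close>, while \<open>w\<close> moves to the last one. If
        both are the same entry, the two orders differ by associativity only.\<close>
      define r where "r = Min M"
      have r: "r \<in> P" "Max V < r" "r < Min W" "\<And>j. j \<in> M \<Longrightarrow> r \<le> j"
        using Min_in[OF fin(2) False] Min_le[OF fin(2)] by (auto simp: r_def M_def)
      have rVW: "r \<notin> V" "r \<notin> W" using r inV inW by fastforce+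
      have noL: "\<not> j < Min V" if "j \<in> P" for j using that L by (auto simp: L_def)
      have rle: "r \<le> j" if "j \<in> P - V" for j
        using r(4)[of j] oV[of j] noL[of j] that r(3) by (force simp: M_def)
      have a2': "a2 = a(r := v * a r)"
        unfolding a2 using U(1) \<pi>(2) by (rule absorb_right) (use r rVW noL rle in auto)
      have e2: "F W (entries a2 W) = w"
        unfolding w a2' using bW rVW by (intro arg_cong[of _ _ "F W"] entries_cong) auto
      have "absorb (\<pi> - {W}) V v a1 = a1(r := v * a1 r)"
        using U(3) by (rule absorb_right) (use r rVW noL rle \<pi>(2) in auto)
      moreover have "absorb (\<pi> - {V}) W w a2 = a2(q := a2 q * w)"
        using U(2)
      proof (rule absorb_left)
        show "j \<le> q" if "j \<in> P - V - W" "j < Min W" for j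
          using q(2) q(4)[of j] that by (force simp: M_def)
      qed (use q qVW \<pi>(2) in auto)
      ultimately show ?thesis unfolding e1 e2 by (simp add: a1' a2' mult.assoc)
    qed
  next
    case M: True
    have noM: "\<not> (Max V < j \<and> j < Min W)" if "j \<in> P" for j using that M by (auto simp: M_def)
    have a1': "a1 = a(Max V := a (Max V) * w)"
      unfolding a1 using U(1) \<pi>(2)
    proof (rule absorb_left)
      show "j \<le> Max V" if "j \<in> P - W" "j < Min W" for j
        using noM[of j] that by auto
    qed (use VW mm(2) bV(3) dVW in blast)+
    have e1: "F V (entries a1 V) = v * w"
      unfolding v a1' using F_right[OF bV(1,2) aV vw(2)] by simp
    show ?thesis
    proof (cases "L = {}")
      case L: False
      define l where "l = Max L"
      have l: "l \<in> P" "l < Min V" "\<And>j. j \<in> L \<Longrightarrow> j \<le> l"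
        using Max_in[OF fin(1) L] Max_ge[OF fin(1)] by (auto simp: l_def L_def)
      have lVW: "l \<notin> V" "l \<notin> W" using l inV inW VW mm by fastforce+
      have a2': "a2 = a(l := a l * v)"
        unfolding a2 using U(1) \<pi>(2) by (rule absorb_left) (use l lVW in \<open>auto simp: L_def\<close>)
      have e2: "F W (entries a2 W) = w"
        unfolding w a2' using bW lVW by (intro arg_cong[of _ _ "F W"] entries_cong) auto
      have "absorb (\<pi> - {W}) V (v * w) a1 = a1(l := a1 l * (v * w))"
        using U(3) by (rule absorb_left) (use l lVW \<pi>(2) in \<open>auto simp: L_def\<close>)
      moreover have "absorb (\<pi> - {V}) W w a2 = a2(l := a2 l * w)"
        using U(2)
      proof (rule absorb_left)
        show "j \<le> l" if "j \<in> P - V - W" "j < Min W" for j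
          using noM[of j] oV[of j] l(3)[of j] that by (auto simp: L_def)
      qed (use l lVW \<pi>(2) VW mm in auto)
      moreover have "l \<noteq> Max V" "i \<noteq> Max V" using lVW mm i by auto
      ultimately show ?thesis unfolding e1 e2 by (simp add: a1' a2' mult.assoc)
    next
      case L: True
      have noL: "\<not> j < Min V" if "j \<in> P" for j using that L by (auto simp: L_def)
      have all_gt: "Max W < j" if "j \<in> P" "j \<notin> V" "j \<notin> W" for j
        using noL noM oV oW that by blast
      define r where "r = Min (P - V - W)"
      have r: "r \<in> P" "r \<notin> V" "r \<notin> W" "\<And>j. j \<in> P - V - W \<Longrightarrow> r \<le> j"
        using Min_in[OF _ ne] Min_le[of "P - V - W"] \<pi>(2) by (auto simp: r_def)
      have a2': "a2 = a(Min W := v * a (Min W))"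
        unfolding a2 using U(1) \<pi>(2)
      proof (rule absorb_right)
        show "Min W \<le> j" if "j \<in> P - V" for j using that all_gt[of j] inW[of j] mm by fastforce
      qed (use mm(3) bW(3) dVW noL in blast)+
      have e2: "F W (entries a2 W) = v * w"
        unfolding w a2' using F_left[OF bW(1,2) aW vw(1)] by simp
      have PWV: "P - W - V = P - V - W" by blast
      have "absorb (\<pi> - {W}) V (v * w) a1 = a1(r := v * w * a1 r)"
        using U(3) by (rule absorb_right) (use r noL \<pi>(2) in \<open>auto simp: PWV\<close>)
      moreover have "absorb (\<pi> - {V}) W (v * w) a2 = a2(r := v * w * a2 r)"
        using U(2)
      proof (rule absorb_right)
        show "\<not> j < Min W" if "j \<in> P - V - W" for j using that all_gt[of j] mm by fastforce
      qed (use r \<pi>(2) in auto)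
      moreover have "r \<noteq> Max V" "i \<noteq> Max V" "r \<noteq> Min W" "i \<noteq> Min W" using r mm i by auto
      ultimately show ?thesis unfolding e1 e2 by (simp add: a1' a2')
    qed
  qed
qed

text \<open>Terminal case of the exchange: no third position remains, so the comparison is one of
  final values of \<open>F\<close> instead of tensors.\<close>

lemma absorb_two_blocks:
  assumes \<pi>: "\<pi> \<in> NC_on P" "finite P" and V: "V \<in> \<pi>" and W: "W \<in> \<pi>"
    and VW: "Max V < Min W" and aA: "a ` P \<subseteq> A" and PVW: "P \<subseteq> V \<union> W"
    and v: "v = F V (entries a V)" and w: "w = F W (entries a W)"
  shows "F V (entries (absorb \<pi> W w a) V) = v * w" "F W (entries (absorb \<pi> V v a) W) = v * w"
proof -
  note bV = NC_on_block[OF \<pi> V] and bW = NC_on_block[OF \<pi> W]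
  have dVW: "j \<notin> W" if "j \<in> V" for j
    using that VW bV bW by (metis Max_ge Min_le leD le_trans)
  then have PV: "P - V = W" and PW: "P - W = V" using PVW bV bW by auto
  have aV: "a ` V \<subseteq> A" and aW: "a ` W \<subseteq> A" using aA bV bW by auto
  have vw: "v \<in> D" "w \<in> D" using F_closed aV aW bV bW v w by auto
  have mm: "Min V \<le> Max V" using bV by auto
  have "absorb \<pi> W w a = a(Max V := a (Max V) * w)"
    using NC_onD(1)[OF \<pi>(1)] \<pi>(2) by (rule absorb_left) (use bV VW in \<open>auto simp: PW\<close>)
  then show "F V (entries (absorb \<pi> W w a) V) = v * w"
    using F_right[OF bV(1,2) aV vw(2)] v by simp
  have "absorb \<pi> V v a = a(Min W := v * a (Min W))"
    using NC_onD(1)[OF \<pi>(1)] \<pi>(2)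
  proof (rule absorb_right)
    show "\<not> i < Min V" if "i \<in> P - V" for i
      using that VW mm Min_le[OF bW(1), of i] by (auto simp: PV)
  qed (use bW in \<open>auto simp: PV\<close>)
  then show "F W (entries (absorb \<pi> V v a) W) = v * w"
    using F_left[OF bW(1,2) aW vw(1)] w by simp
qed

lemma absorb_closed:
  assumes "\<pi> \<in> NC_on P" "finite P" "V \<in> \<pi>" "P - V \<noteq> {}" "a ` P \<subseteq> A" "v \<in> D"
  shows "absorb \<pi> V v a ` (P - V) \<subseteq> A"
proof -
  have vA: "v \<in> A" using assms D_subset by auto
  show ?thesis
    by (rule absorb_other[where 'a = 'a, OF NC_onD(1)[OF assms(1)] assms(2) NC_on_block(3)[OF assms(1-3)] assms(4)])
      (use assms(5) vA A_mult in \<open>auto simp: image_subset_iff\<close>)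
qed

text \<open>Two interval blocks may be removed in either order: the remaining entries agree by associativity,
  and if nothing remains, both orders give the product of the two values.\<close>

lemma nest_step:
  assumes "\<pi> \<in> NC_on P" "finite P" "card \<pi> > 1" "interval_block \<pi> V" "a ` P \<subseteq> A"
  shows "nest F \<pi> a = nest F (\<pi> - {V}) (absorb \<pi> V (F V (entries a V)) a)"
  using assms
proof (induction "card \<pi>" arbitrary: \<pi> P a V rule: less_induct)
  case less
  note \<pi> = less.prems(1-3) and V = less.prems(4) and aA = less.prems(5)
  obtain W where W: "interval_block \<pi> W"
    "\<And>F :: nat set \<Rightarrow> 'a list \<Rightarrow> 'a. \<And>a. nest F \<pi> a = nest F (\<pi> - {W}) (absorb \<pi> W (F W (entries a W)) a)"
    using nest_choice[OF \<pi>] by blast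
  have V\<pi>: "V \<in> \<pi>" and W\<pi>: "W \<in> \<pi>" using V W interval_block_in by auto
  note bV = NC_on_block[OF \<pi>(1,2) V\<pi>] and bW = NC_on_block[OF \<pi>(1,2) W\<pi>]
  show ?case
  proof (cases "V = W")
    case True
    then show ?thesis using W(2) by simp
  next
    case False
    define v w where "v = F V (entries a V)" and "w = F W (entries a W)"
    define a1 a2 where "a1 = absorb \<pi> W w a" and "a2 = absorb \<pi> V v a"
    have vw: "v \<in> D" "w \<in> D"
      unfolding v_def w_def using F_closed[OF bV(1,2), of a] F_closed[OF bW(1,2), of a] aA bV(3) bW(3)
      by (meson image_mono subset_trans)+
    have ndis: "Min W \<notin> V" "Min V \<notin> W"
      using NC_on_disjoint[OF \<pi>(1) V\<pi> W\<pi>] False Min_in[OF bV(1,2)] Min_in[OF bW(1,2)] by blast+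
    have order: "Max V < Min W \<or> Max W < Min V"
      using interval_blockD[OF V \<pi>(1), of "Min W"] interval_blockD[OF W(1) \<pi>(1), of "Min V"] ndis
        bV bW by (metis Min_in less_asym subsetD)
    have fin: "finite \<pi>" using NC_on_finite[OF \<pi>(1,2)] .
    note d1 = NC_on_diff[OF \<pi>(1) V\<pi>] and d2 = NC_on_diff[OF \<pi>(1) W\<pi>]
    have nV: "P - V \<noteq> {}" and nW: "P - W \<noteq> {}"
      using NC_on_diff_nonempty[OF \<pi>] V\<pi> W\<pi> by auto
    show ?thesis
    proof (cases "P - V - W = {}")
      case True
      then have "P - V \<subseteq> W" "P - W \<subseteq> V" by auto
      moreover have "W \<subseteq> P - V" "V \<subseteq> P - W"
        using NC_on_disjoint[OF \<pi>(1) V\<pi> W\<pi>] False bV bW by auto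
      ultimately have PV: "P - V = W" "P - W = V" by auto
      have "\<pi> - {V} = {W}" "\<pi> - {W} = {V}"
      proof -
        have "U = V \<or> U = W" if "U \<in> \<pi>" for U
          using NC_on_block[OF \<pi>(1,2) that] NC_on_disjoint[OF \<pi>(1) that V\<pi>]
            NC_on_disjoint[OF \<pi>(1) that W\<pi>] True by blast
        then show "\<pi> - {V} = {W}" "\<pi> - {W} = {V}" using V\<pi> W\<pi> False by blast+
      qed
      moreover have "P \<subseteq> V \<union> W" "P \<subseteq> W \<union> V" using True by auto
      then have "F V (entries (absorb \<pi> W w a) V) = F W (entries (absorb \<pi> V v a) W)"
        using order absorb_two_blocks[OF \<pi>(1,2) V\<pi> W\<pi> _ aA _ v_def w_def]
          absorb_two_blocks[OF \<pi>(1,2) W\<pi> V\<pi> _ aA _ w_def v_def] by metis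
      ultimately show ?thesis using W(2)[of F a] by (simp add: nest_one_block v_def w_def)
    next
      case ne: False
      have aA1: "a1 ` (P - W) \<subseteq> A" and aA2: "a2 ` (P - V) \<subseteq> A"
        using absorb_closed[OF \<pi>(1,2) W\<pi> nW aA vw(2)] absorb_closed[OF \<pi>(1,2) V\<pi> nV aA vw(1)]
        by (auto simp: a1_def a2_def)
      have c1: "card (\<pi> - {W}) < card \<pi>" "card (\<pi> - {V}) < card \<pi>"
        using card_Diff1_less[OF fin W\<pi>] card_Diff1_less[OF fin V\<pi>] by (simp_all only:)
      have c2: "card (\<pi> - {W}) > 1" "card (\<pi> - {V}) > 1"
      proof -
        have n1: "\<pi> - {W} \<noteq> {P - W}"
          using V\<pi> False bV ne by blast
        have n2: "\<pi> - {V} \<noteq> {P - V}"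
          using W\<pi> False bW ne by blast
        show "card (\<pi> - {W}) > 1" using NC_on_card1[OF d2 _ nW] \<pi>(2) n1 by blast
        show "card (\<pi> - {V}) > 1" using NC_on_card1[OF d1 _ nV] \<pi>(2) n2 by blast
      qed
      \<comment> \<open>Diamond argument: \<open>W\<close> is the block that \<open>nest\<close>
        itself selects. The induction hypothesis removes \<open>V\<close> after \<open>W\<close>
        and, read backwards, puts \<open>W\<close> back after the removal of
        \<open>V\<close>.\<close>
      have "nest F \<pi> a = nest F (\<pi> - {W}) a1" using W(2) by (simp add: a1_def w_def)
      also have "\<dots> = nest F (\<pi> - {W} - {V}) (absorb (\<pi> - {W}) V (F V (entries a1 V)) a1)"
        using c1 c2 d2 \<pi>(2) aA1 interval_block_subset[OF V] V\<pi> False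
        by (intro less.hyps[of "\<pi> - {W}" "P - W"]) auto
      also have "\<dots> = nest F (\<pi> - {V} - {W}) (absorb (\<pi> - {V}) W (F W (entries a2 W)) a2)"
      proof -
        have eq: "\<pi> - {W} - {V} = \<pi> - {V} - {W}" by blast
        have nc: "\<pi> - {V} - {W} \<in> NC_on (P - V - W)"
          using NC_on_diff[OF d1, of W] W\<pi> False by auto
        have ne': "P - W - V \<noteq> {}" using ne by blast
        have ab: "absorb (\<pi> - {W}) V (F V (entries a1 V)) a1 i = absorb (\<pi> - {V}) W (F W (entries a2 W)) a2 i"
          if "i \<in> P - V - W" for i
          using order
        proof
          assume "Max V < Min W"
          then show ?thesis using absorb_commute[OF \<pi>(1,2) V W(1) _ aA ne that v_def w_def a1_def a2_def] by simp
        next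
          assume "Max W < Min V"
          then show ?thesis
            using absorb_commute[OF \<pi>(1,2) W(1) V _ aA ne' _ w_def v_def a2_def a1_def, of i] that by auto
        qed
        show ?thesis unfolding eq by (rule nest_cong_entries[OF nc _ ne]) (use \<pi>(2) ab in auto)
      qed
      also have "\<dots> = nest F (\<pi> - {V}) a2"
        using c1 c2 d1 \<pi>(2) aA2 interval_block_subset[OF W(1)] W\<pi> False
        by (intro less.hyps[of "\<pi> - {V}" "P - V", symmetric]) auto
      finally show ?thesis by (simp add: a2_def v_def)
    qed
  qed
qed

end

section \<open>Intervals of positions that need not be blocks\<close>

definition interval_in :: "nat set \<Rightarrow> nat set \<Rightarrow> bool" where
  "interval_in P Q \<longleftrightarrow> Q \<subseteq> P \<and> Q \<noteq> {} \<and> (\<forall>i\<in>P. Min Q \<le> i \<and> i \<le> Max Q \<longrightarrow> i \<in> Q)"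

lemma interval_block_interval_in:
  "\<pi> \<in> NC_on P \<Longrightarrow> finite P \<Longrightarrow> interval_block \<pi> V \<longleftrightarrow> V \<in> \<pi> \<and> interval_in P V"
  using NC_onD(1)[of \<pi> P] NC_on_block[of \<pi> P V] by (auto simp: interval_block_def interval_in_def)

text \<open>A block inside \<open>Q\<close> and one outside cannot alternate: of four alternating
  points, an outer one would lie between two points of the interval \<open>Q\<close>.\<close>

lemma NC_on_union:
  assumes "finite P" "interval_in P Q" "\<tau> \<in> NC_on Q" "\<rho> \<in> NC_on (P - Q)"
  shows "\<rho> \<union> \<tau> \<in> NC_on P"
proof -
  have finQ: "finite Q" using assms(1,2) finite_subset by (auto simp: interval_in_def)
  have un: "\<Union>(\<rho> \<union> \<tau>) = P"
    using NC_onD(1)[OF assms(3)] NC_onD(1)[OF assms(4)] assms(2) by (auto simp: interval_in_def)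
  have "disjoint (\<rho> \<union> \<tau>)"
    using NC_onD(1,3)[OF assms(3)] NC_onD(1,3)[OF assms(4)] by (intro disjoint_union) auto
  moreover have "{} \<notin> \<rho> \<union> \<tau>" using NC_onD(4)[OF assms(3)] NC_onD(4)[OF assms(4)] by auto
  moreover have "noncrossing (\<rho> \<union> \<tau>)"
  proof (rule noncrossingI)
    fix V W a b c d
    assume VW: "V \<in> \<rho> \<union> \<tau>" "W \<in> \<rho> \<union> \<tau>" and ab: "a \<in> V" "b \<in> W" "c \<in> V" "d \<in> W" "a < b" "b < c" "c < d"
    have conv: "j \<in> Q" if "i \<in> Q" "k \<in> Q" "j \<in> P" "i < j" "j < k" for i j k
    proof -
      have "Min Q \<le> j" using that Min_le[OF finQ that(1)] by simp
      moreover have "j \<le> Max Q" using that Max_ge[OF finQ that(2)] by simp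
      ultimately show ?thesis using assms(2) that(3) by (auto simp: interval_in_def)
    qed
    have P: "b \<in> P" "c \<in> P" using VW ab un by auto
    have \<rho>: "i \<notin> Q" if "i \<in> U" "U \<in> \<rho>" for i U using NC_onD(1)[OF assms(4)] that by auto
    have \<tau>: "i \<in> Q" if "i \<in> U" "U \<in> \<tau>" for i U using NC_onD(1)[OF assms(3)] that by auto
    show "V = W"
    proof (cases "V \<in> \<rho>")
      case True
      have "W \<in> \<rho>"
      proof (rule ccontr)
        assume "W \<notin> \<rho>"
        then have "b \<in> Q" "d \<in> Q" using VW ab \<tau> by auto
        then show False using conv[of b d c] P ab \<rho> True by blast
      qed
      then show ?thesis using noncrossingD[OF NC_onD(2)[OF assms(4)] True _ ab] by blast
    next
      case False
      then have V: "V \<in> \<tau>" using VW by blast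
      then have "a \<in> Q" "c \<in> Q" using ab \<tau> by auto
      then have "b \<in> Q" using conv[of a c b] P ab by blast
      then have "W \<in> \<tau>" using VW ab \<rho> by blast
      then show ?thesis using noncrossingD[OF NC_onD(2)[OF assms(3)] V _ ab] by blast
    qed
  qed
  ultimately show ?thesis using un by (auto simp: NC_on_def partition_on_def)
qed

section \<open>Bimodule property, additivity and composition of nestings\<close>

context bimodule_eval
begin

lemma nest_remove:
  assumes "\<pi> \<in> NC_on P" "finite P" "interval_block \<pi> V" "Min P \<in> P - V" "a ` P \<subseteq> A"
    and l: "l = left_nbr P V" and v: "v = F V (entries a V)"
  shows "nest F \<pi> a = nest F (\<pi> - {V}) (a(l := a l * v))"
    and "a(l := a l * v) ` (P - V) \<subseteq> A" "l \<in> P - V" "v \<in> D" "l < Min V"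
    "\<And>i. i \<in> P \<Longrightarrow> i < Min V \<Longrightarrow> i \<le> l"
proof -
  have V: "V \<in> \<pi>" using assms(3) interval_block_in by blast
  note b = NC_on_block[OF assms(1,2) V]
  have mV: "Min P \<notin> V" using assms(4) by blast
  note ln = left_nbr[OF assms(2) b(3,2) mV, folded l]
  show lP: "l \<in> P - V" and "l < Min V" and "\<And>i. i \<in> P \<Longrightarrow> i < Min V \<Longrightarrow> i \<le> l" using ln by blast+
  have "a ` V \<subseteq> A" using assms(5) b(3) by blast
  then show vD: "v \<in> D" using F_closed[OF b(1,2)] v by blast
  show "a(l := a l * v) ` (P - V) \<subseteq> A"
    using assms(5) lP vD D_subset A_mult by (auto simp: image_subset_iff)
  have "card \<pi> > 1"
  proof (rule ccontr)
    assume "\<not> card \<pi> > 1"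
    then have "\<pi> = {P}" using NC_on_card1[OF assms(1,2)] assms(4) by blast
    then show False using V assms(4) by blast
  qed
  then show "nest F \<pi> a = nest F (\<pi> - {V}) (a(l := a l * v))"
    using nest_step[OF assms(1,2) _ assms(3,5)]
      absorb_eq_left_nbr[OF NC_onD(1)[OF assms(1)] assms(2) b(3,2) mV, of v a] l v by metis
qed

lemma nest_closed:
  assumes "\<pi> \<in> NC_on P" "finite P" "P \<noteq> {}" "a ` P \<subseteq> A"
  shows "nest F \<pi> a \<in> D"
proof -
  have "F V (entries c V) \<in> D" if "V \<in> \<pi>" "\<And>i. i \<in> V \<Longrightarrow> c i \<in> A" for V c
    using F_closed NC_on_block[OF assms(1,2) that(1)] that(2) by blast
  moreover have "z * d \<in> A \<and> d * z \<in> A" if "z \<in> A" "d \<in> D" for z d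
    using that A_mult D_subset by blast
  ultimately show ?thesis
    using nest_cong[OF assms(1-3), where B = "\<lambda>_. A" and D = D and F = F and G = F and a = a and b = a]
      assms(4) by blast
qed

lemma nest_left:
  assumes "\<pi> \<in> NC_on P" "finite P" "P \<noteq> {}" "a ` P \<subseteq> A" "d \<in> D"
  shows "nest F \<pi> (a(Min P := d * a (Min P))) = d * nest F \<pi> a"
  using assms
proof (induction arbitrary: a rule: NC_induct)
  case (one_block P)
  then show ?case unfolding nest_one_block by (intro F_left)
next
  case (remove \<pi> P V)
  define a' where "a' = a(Min P := d * a (Min P))"
  define l v b where "l = left_nbr P V" and "v = F V (entries a V)" and "b = a(l := a l * v)"
  note r = nest_remove[OF remove.hyps(1-3,8) remove.prems(1) l_def v_def]
  have dA: "d \<in> A" using remove.prems D_subset by blast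
  have a'A: "a' ` P \<subseteq> A" using remove.prems remove.hyps dA A_mult by (auto simp: a'_def image_subset_iff)
  have "F V (entries a' V) = v"
    unfolding v_def a'_def using remove.hyps by (intro arg_cong[of _ _ "F V"] entries_cong) auto
  then have "nest F \<pi> a' = nest F (\<pi> - {V}) (a'(l := a' l * v))"
    using nest_remove(1)[OF remove.hyps(1-3) _ a'A l_def, of v] remove.hyps by simp
  also have "a'(l := a' l * v) = b(Min P := d * b (Min P))"
    by (auto simp: a'_def b_def mult.assoc)
  also have "nest F (\<pi> - {V}) \<dots> = d * nest F (\<pi> - {V}) b"
    using remove.IH[OF r(2)[folded b_def] remove.prems(2)] remove.hyps(9) by (simp only:)
  also have "nest F (\<pi> - {V}) b = nest F \<pi> a"
    using r(1)[folded b_def] by (simp only:)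
  finally show ?case unfolding a'_def .
qed

text \<open>Unlike the first position, the last one may belong to the removed block
  \<open>V\<close>. In that case \<open>d\<close> leaves \<open>F V\<close> on the right and travels
  with its value to the left neighbour, which is the last position that remains.\<close>

lemma nest_right:
  assumes "\<pi> \<in> NC_on P" "finite P" "P \<noteq> {}" "a ` P \<subseteq> A" "d \<in> D"
  shows "nest F \<pi> (a(Max P := a (Max P) * d)) = nest F \<pi> a * d"
  using assms
proof (induction arbitrary: a rule: NC_induct)
  case (one_block P)
  then show ?case unfolding nest_one_block by (intro F_right)
next
  case (remove \<pi> P V)
  define a' where "a' = a(Max P := a (Max P) * d)"
  define l v b where "l = left_nbr P V" and "v = F V (entries a V)" and "b = a(l := a l * v)"
  note r = nest_remove[OF remove.hyps(1-3,8) remove.prems(1) l_def v_def]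
  have MP: "Max P \<in> P" using remove.hyps by (intro Max_in) auto
  have dA: "d \<in> A" using remove.prems D_subset by blast
  have a'A: "a' ` P \<subseteq> A" using remove.prems MP dA A_mult by (auto simp: a'_def image_subset_iff)
  note r' = nest_remove[OF remove.hyps(1-3,8) a'A l_def refl]
  have nc: "\<pi> - {V} \<in> NC_on (P - V)" using NC_on_diff remove.hyps by blast
  have ne: "P - V \<noteq> {}" using remove.hyps by blast
  have "nest F \<pi> a' = nest F (\<pi> - {V}) (b(Max (P - V) := b (Max (P - V)) * d))"
  proof (cases "Max P \<in> V")
    case True
    have MV: "Max P = Max V"
      using True remove.hyps MP by (intro antisym) (auto intro: Max_mono)
    have "Max (P - V) = l"
    proof (rule Max_eqI)
      show "i \<le> l" if "i \<in> P - V" for i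
      proof -
        have "i \<le> Max V" using that remove.hyps(2) MV by (metis DiffD1 Max_ge)
        then show ?thesis using r(6)[of i] that interval_blockD[OF remove.hyps(3,1), of i] by auto
      qed
    qed (use remove.hyps r(3) in auto)
    moreover have "F V (entries a' V) = v * d"
      unfolding a'_def MV v_def using remove.hyps remove.prems by (intro F_right) auto
    ultimately show ?thesis
      unfolding r'(1) using r(3) remove.hyps True
      by (intro nest_cong_entries[OF nc _ ne]) (auto simp: b_def a'_def mult.assoc)
  next
    case False
    have "Max (P - V) = Max P"
      using False MP remove.hyps(2) by (intro Max_eqI) auto
    moreover have "l \<noteq> Max P"
    proof -
      have "Min V \<in> P" using remove.hyps by (meson Min_in subsetD)
      then have "Min V \<le> Max P" using remove.hyps by simp
      then show ?thesis using r(5) by linarith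
    qed
    moreover have "F V (entries a' V) = v"
      unfolding v_def a'_def using remove.hyps False by (intro arg_cong[of _ _ "F V"] entries_cong) auto
    ultimately show ?thesis unfolding r'(1)
      by (intro arg_cong[of _ _ "nest F (\<pi> - {V})"]) (auto simp: b_def a'_def)
  qed
  also have "\<dots> = nest F (\<pi> - {V}) b * d"
    using remove.IH[OF r(2)[folded b_def] remove.prems(2)] .
  also have "nest F (\<pi> - {V}) b = nest F \<pi> a" using r(1)[folded b_def] by (simp only:)
  finally show ?case unfolding a'_def .
qed

text \<open>If the varying position lies in the removed block, the variation passes to the absorbing
  entry; if it is the absorbing entry, the value of the block multiplies the sum from the right;
  otherwise the two updates commute.\<close>

lemma nest_add:
  assumes "\<pi> \<in> NC_on P" "finite P" "P \<noteq> {}" "a ` P \<subseteq> A" "i \<in> P" "b \<in> A" "c \<in> A"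
  shows "nest F \<pi> (a(i := b + c)) = nest F \<pi> (a(i := b)) + nest F \<pi> (a(i := c))"
  using assms
proof (induction arbitrary: a i b c rule: NC_induct)
  case (one_block P)
  then show ?case unfolding nest_one_block by (intro F_add)
next
  case (remove \<pi> P V)
  define l where "l = left_nbr P V"
  have nc: "\<pi> - {V} \<in> NC_on (P - V)" using NC_on_diff remove.hyps by blast
  have ne: "P - V \<noteq> {}" and fin: "finite (P - V)" using remove.hyps by auto
  have aA: "a(i := z) ` P \<subseteq> A" if "z \<in> A" for z using remove.prems(1) that by auto
  have bcA: "b + c \<in> A" using remove.prems A_add by blast
  define v where "v = (\<lambda>z. F V (entries (a(i := z)) V))"
  have r: "nest F \<pi> (a(i := z)) = nest F (\<pi> - {V}) ((a(i := z))(l := (a(i := z)) l * v z))"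
      "(a(i := z))(l := (a(i := z)) l * v z) ` (P - V) \<subseteq> A" "l \<in> P - V" "v z \<in> D" if "z \<in> A" for z
    using nest_remove[OF remove.hyps(1-3,8) aA[OF that] l_def] unfolding v_def by blast+
  have lPV: "l \<in> P - V" using r(3) A_zero by blast
  have aV: "a ` V \<subseteq> A" using remove by blast
  have al: "a l \<in> A" using lPV remove.prems by blast
  show ?case
  proof (cases "i \<in> V")
    case True
    have v_add: "v (b + c) = v b + v c"
      unfolding v_def using remove.hyps True aV remove.prems by (intro F_add) auto
    have red: "nest F \<pi> (a(i := z)) = nest F (\<pi> - {V}) (a(l := a l * v z))" if "z \<in> A" for z
      unfolding r(1)[OF that] by (rule nest_cong_entries[OF nc fin ne]) (use True lPV in auto)
    have mA: "a l * v z \<in> A" if "z \<in> A" for z using al r(4)[OF that] A_mult D_subset by blast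
    show ?thesis
      unfolding red[OF bcA] red[OF remove.prems(3)] red[OF remove.prems(4)] v_add distrib_left
      using remove.prems mA lPV by (intro remove.IH) auto
  next
    case False
    have vz: "v z = F V (entries a V)" for z
      unfolding v_def using remove.hyps False by (intro arg_cong[of _ _ "F V"] entries_cong) auto
    define w where "w = F V (entries a V)"
    have wA: "w \<in> A" using r(4)[OF A_zero] D_subset vz w_def by auto
    show ?thesis
    proof (cases "i = l")
      case True
      have red: "nest F \<pi> (a(i := z)) = nest F (\<pi> - {V}) (a(l := z * w))" if "z \<in> A" for z
        unfolding r(1)[OF that] vz w_def[symmetric] using True by simp
      show ?thesis
        unfolding red[OF bcA] red[OF remove.prems(3)] red[OF remove.prems(4)] distrib_right
        using remove.prems wA A_mult lPV by (intro remove.IH) auto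
    next
      case il: False
      have red: "nest F \<pi> (a(i := z)) = nest F (\<pi> - {V}) ((a(l := a l * w))(i := z))" if "z \<in> A" for z
        unfolding r(1)[OF that] vz w_def[symmetric] using il by (simp add: fun_upd_twist)
      have "(a(l := a l * w)) ` (P - V) \<subseteq> A" using remove.prems al wA A_mult by auto
      then show ?thesis
        unfolding red[OF bcA] red[OF remove.prems(3)] red[OF remove.prems(4)]
        using remove.prems False by (intro remove.IH) auto
    qed
  qed
qed

lemma nest_zero_entry:
  assumes "\<pi> \<in> NC_on P" "finite P" "P \<noteq> {}" "a ` P \<subseteq> A" "i \<in> P"
  shows "nest F \<pi> (a(i := 0)) = 0"
  using nest_add[OF assms A_zero A_zero] by (metis add_0 add_cancel_right_right)

lemma A_sum: "finite T \<Longrightarrow> (\<And>t. t \<in> T \<Longrightarrow> f t \<in> A) \<Longrightarrow> sum f T \<in> A"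
  by (induction T rule: finite_induct) (auto simp: A_zero A_add)

lemma nest_sum:
  assumes "\<pi> \<in> NC_on P" "finite P" "P \<noteq> {}" "a ` P \<subseteq> A" "i \<in> P"
    and "finite T" "\<And>t. t \<in> T \<Longrightarrow> f t \<in> A"
  shows "nest F \<pi> (a(i := sum f T)) = (\<Sum>t\<in>T. nest F \<pi> (a(i := f t)))"
  using assms(6,7)
proof (induction T rule: finite_induct)
  case empty
  show ?case unfolding sum.empty by (rule nest_zero_entry[OF assms(1-5)])
next
  case (insert t T)
  have "nest F \<pi> (a(i := f t + sum f T)) = nest F \<pi> (a(i := f t)) + nest F \<pi> (a(i := sum f T))"
    using insert by (intro nest_add[OF assms(1-5)] A_sum) auto
  then show ?case using insert unfolding sum.insert[OF insert.hyps] by (metis insertCI)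
qed

text \<open>Before \<open>V\<close> is evaluated, its entries may have absorbed values of other
  blocks. Vanishing is therefore required for all entries from sets stable under right
  multiplication by \<open>D\<close>; the zero then annihilates the entry that absorbs it.\<close>

lemma nest_zero_block:
  assumes "\<pi> \<in> NC_on P" "finite P" "P \<noteq> {}" "\<And>i. i \<in> P \<Longrightarrow> a i \<in> B i" "\<And>i. i \<in> P \<Longrightarrow> B i \<subseteq> A"
    and "\<And>i z d. i \<in> P \<Longrightarrow> z \<in> B i \<Longrightarrow> d \<in> D \<Longrightarrow> z * d \<in> B i"
    and "V \<in> \<pi>" "\<And>c. (\<And>i. i \<in> V \<Longrightarrow> c i \<in> B i) \<Longrightarrow> F V (entries c V) = 0"
  shows "nest F \<pi> a = 0"
  using assms
proof (induction arbitrary: a rule: NC_induct)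
  case (one_block P)
  then show ?case by (auto simp: nest_one_block)
next
  case (remove \<pi> P U)
  define l u where "l = left_nbr P U" and "u = F U (entries a U)"
  have aA: "a ` P \<subseteq> A" using remove.prems(1,2) by blast
  note r = nest_remove[OF remove.hyps(1-3,8) aA l_def u_def]
  have nc: "\<pi> - {U} \<in> NC_on (P - U)" using NC_on_diff remove.hyps by blast
  show ?case
  proof (cases "U = V")
    case True
    have "u = 0" unfolding u_def True using remove.prems(1) remove.hyps(5) True
      by (intro remove.prems(5)) auto
    then show ?thesis
      unfolding r(1) using nest_zero_entry[OF nc _ _ _ r(3), of a] remove.hyps(2) aA r(3) by auto
  next
    case False
    show ?thesis unfolding r(1)
    proof (rule remove.IH)
      show "(a(l := a l * u)) i \<in> B i" if "i \<in> P - U" for i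
        using that remove.prems(1,3) r(4) by auto
    qed (use remove.prems False in auto)
  qed
qed

text \<open>A block of \<open>\<tau>\<close> without \<open>Min Q\<close> has the same left
  neighbour in \<open>P\<close> as in \<open>Q\<close>, because \<open>Min Q\<close> lies before it
  and \<open>Q\<close> is an interval. Its value thus stays within \<open>Q\<close>. The block that
  remains last contains \<open>Min Q\<close> and hands its value to \<open>l\<close>.\<close>

lemma nest_compose:
  assumes "\<tau> \<in> NC_on Q" "finite Q" "Q \<noteq> {}" "finite P" "interval_in P Q" "Min P \<notin> Q"
    "\<rho> \<in> NC_on (P - Q)" "a ` P \<subseteq> A" "l = left_nbr P Q"
  shows "nest F (\<rho> \<union> \<tau>) a = nest F \<rho> (a(l := a l * nest F \<tau> a))"
  using assms
proof (induction arbitrary: P a rule: NC_induct)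
  case (one_block Q)
  have un: "\<rho> \<union> {Q} \<in> NC_on P"
    using NC_on_union[of P Q] one_block one_block_NC_on by blast
  have "Q \<notin> \<rho>" using NC_onD(1)[OF one_block.prems(4)] one_block.hyps by blast
  then have eq: "\<rho> \<union> {Q} - {Q} = \<rho>" by blast
  have ib: "interval_block (\<rho> \<union> {Q}) Q"
    using interval_block_interval_in[OF un] one_block by blast
  have "Q \<subseteq> P" using one_block by (auto simp: interval_in_def)
  then have "Min P \<in> P - Q" using one_block Min_in[of P] by blast
  then show ?case
    using nest_remove(1)[OF un one_block.prems(1) ib _ one_block.prems(5,6) refl]
    unfolding eq nest_one_block by (rule meta_mp[rotated])
next
  case (remove \<tau> Q V)
  note Q = remove.prems(2)[unfolded interval_in_def]
  have un: "\<rho> \<union> \<tau> \<in> NC_on P"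
    using NC_on_union[of P Q] remove by blast
  have inV: "interval_in Q V" using remove.hyps interval_block_interval_in[of \<tau> Q V] by blast
  have Vmm: "Min V \<in> V" "Max V \<in> V" using remove.hyps by auto
  then have VQ: "Min Q \<le> Min V" "Max V \<le> Max Q" using remove.hyps by auto
  have inPV: "interval_in P V"
    using inV Q VQ remove.hyps unfolding interval_in_def by (metis dual_order.trans subset_trans)
  have ib: "interval_block (\<rho> \<union> \<tau>) V"
    using interval_block_interval_in[OF un] remove inPV by blast
  have mP: "Min P \<in> P - V" using remove.prems(1,3) Q remove.hyps(5) Min_in[of P] by blast
  define v where "v = F V (entries a V)"
  define k where "k = left_nbr Q V"
  have aQ: "a ` Q \<subseteq> A" using remove.prems(5) Q by blast
  note rQ = nest_remove[OF remove.hyps(1-3,8) aQ k_def v_def]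
  note rP = nest_remove[OF un remove.prems(1) ib mP remove.prems(5) refl v_def]
  have kQ: "k \<in> Q" using rQ by blast
  have mQV: "Min Q < Min V"
    using VQ remove.hyps Vmm by (metis Diff_iff le_neq_implies_less)
  have kP: "left_nbr P V = k"
  proof (rule antisym)
    have "Min Q \<le> left_nbr P V" using rP(6)[of "Min Q"] mQV remove.hyps(8) Q by blast
    moreover have "left_nbr P V \<le> Max Q" using rP(5) VQ Vmm remove.hyps by (metis Min_le Max_ge less_imp_le le_trans)
    ultimately have "left_nbr P V \<in> Q" using Q rP(3) by blast
    then show "left_nbr P V \<le> k" using rQ(6) rP(5) by blast
    show "k \<le> left_nbr P V" using rP(6) rQ(5) kQ Q by blast
  qed
  define a' where "a' = a(k := a k * v)"
  have "\<rho> \<union> \<tau> - {V} = \<rho> \<union> (\<tau> - {V})"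
    using NC_onD(1)[OF remove.prems(4)] remove.hyps by blast
  then have "nest F (\<rho> \<union> \<tau>) a = nest F (\<rho> \<union> (\<tau> - {V})) a'"
    using rP(1) by (simp add: kP a'_def)
  also have "\<dots> = nest F \<rho> (a'(l := a' l * nest F (\<tau> - {V}) a'))"
  proof (rule remove.IH)
    have fQ: "finite Q" using remove.hyps by blast
    have "Max (Q - V) \<le> Max Q" using remove.hyps by (intro Max_mono) auto
    then show "interval_in (P - V) (Q - V)"
      using Q remove.hyps unfolding interval_in_def by (metis DiffI DiffD1 DiffD2 Diff_mono empty_iff order_refl le_trans)
    have "Min (P - V) = Min P" using mP remove.prems(1) by (intro Min_eqI) auto
    then show "Min (P - V) \<notin> Q - V" using remove.prems(3) by simp
    have "P - V - (Q - V) = P - Q" using remove.hyps by blast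
    then show "\<rho> \<in> NC_on (P - V - (Q - V))" using remove.prems(4) by simp
    show "a' ` (P - V) \<subseteq> A" using rP(2) by (simp add: a'_def kP)
    have "{i \<in> P - V. i < Min Q} = {i \<in> P. i < Min Q}" using VQ remove.hyps by (auto dest: Min_le)
    then show "l = left_nbr (P - V) (Q - V)"
      using remove.prems(6) remove.hyps(9) by (simp add: left_nbr_def)
  qed (use remove.prems in auto)
  also have "nest F (\<tau> - {V}) a' = nest F \<tau> a" using rQ(1) by (simp add: a'_def)
  also have "nest F \<rho> (a'(l := a' l * nest F \<tau> a)) = nest F \<rho> (a(l := a l * nest F \<tau> a))"
  proof (rule nest_cong_entries[OF remove.prems(4)])
    have "l \<in> P" "l \<notin> Q"
      using left_nbr[OF remove.prems(1) _ _ remove.prems(3)] Q remove.prems(6) by blast+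
    then show "(a'(l := a' l * nest F \<tau> a)) i = (a(l := a l * nest F \<tau> a)) i" if "i \<in> P - Q" for i
      using that kQ by (auto simp: a'_def)
    show "P - Q \<noteq> {}" using \<open>l \<in> P\<close> \<open>l \<notin> Q\<close> by blast
  qed (use remove.prems in auto)
  finally show ?case .
qed

end

section \<open>Relabelling and refinement\<close>

text \<open>Cumulants sum over partitions of an initial segment, whereas a block of a larger
  partition keeps its own positions; this enumeration, with indices starting at 1, translates
  between the two.\<close>

definition enum :: "nat set \<Rightarrow> nat \<Rightarrow> nat" where
  "enum V i = sorted_list_of_set V ! (i - 1)"

lemma enum:
  assumes "finite V"
  shows "bij_betw (enum V) {1..card V} V" "strict_mono_on {1..card V} (enum V)"
proof -
  have b: "bij_betw ((!) (sorted_list_of_set V)) {..<card V} V"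
    using bij_betw_nth[of "sorted_list_of_set V" "{..<card V}" V] assms by simp
  have "bij_betw (\<lambda>i. i - 1) {1..card V} {..<card V}"
    by (rule bij_betwI[of _ _ _ Suc]) auto
  from bij_betw_trans[OF this b] show "bij_betw (enum V) {1..card V} V"
    by (simp add: enum_def[abs_def] comp_def)
  show "strict_mono_on {1..card V} (enum V)"
    by (rule strict_mono_onI) (auto simp: enum_def intro!: sorted_wrt_nth_less[of "(<)"])
qed

lemma strict_mono_on_Min:
  assumes "strict_mono_on P h" "finite P" "P \<noteq> {}"
  shows "Min (h ` P) = h (Min P)"
proof (rule Min_eqI)
  show "h (Min P) \<le> y" if y: "y \<in> h ` P" for y
  proof -
    obtain i where i: "i \<in> P" "y = h i" using y by blast
    have "Min P \<le> i" using i assms by simp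
    then show ?thesis using strict_mono_on_leD[OF assms(1) _ i(1)] i assms by auto
  qed
qed (use assms in auto)

lemma strict_mono_on_Max:
  assumes "strict_mono_on P h" "finite P" "P \<noteq> {}"
  shows "Max (h ` P) = h (Max P)"
proof (rule Max_eqI)
  show "y \<le> h (Max P)" if y: "y \<in> h ` P" for y
  proof -
    obtain i where i: "i \<in> P" "y = h i" using y by blast
    have "i \<le> Max P" using i assms by simp
    then show ?thesis using strict_mono_on_leD[OF assms(1) i(1)] i assms by auto
  qed
qed (use assms in auto)

lemma enum_Min_Max:
  assumes "finite V" "V \<noteq> {}"
  shows "enum V 1 = Min V" "enum V (card V) = Max V" "card V \<ge> 1"
proof -
  have im: "enum V ` {1..card V} = V" using enum(1)[OF assms(1)] by (simp add: bij_betw_def)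
  show c: "card V \<ge> 1" using assms by (simp add: Suc_le_eq card_gt_0_iff)
  then have "Min {1..card V} = 1" "Max {1..card V} = card V" by (auto intro: Min_eqI Max_eqI)
  then show "enum V 1 = Min V" "enum V (card V) = Max V"
    using strict_mono_on_Min[OF enum(2)[OF assms(1)]] strict_mono_on_Max[OF enum(2)[OF assms(1)]] c im
    by auto
qed

lemma strict_mono_on_less_iff:
  assumes "strict_mono_on P (h :: nat \<Rightarrow> nat)" "i \<in> P" "j \<in> P"
  shows "h i < h j \<longleftrightarrow> i < j"
  using assms strict_mono_onD[OF assms(1)] by (metis less_asym linorder_neqE_nat order_less_irrefl)

lemma inj_on_image_blocks:
  assumes "inj_on h P"
  shows "inj_on ((`) h) (Pow P)"
  using assms by (meson inj_on_image_Pow)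

lemma NC_on_image:
  assumes "strict_mono_on P h" "\<pi> \<in> NC_on P"
  shows "(`) h ` \<pi> \<in> NC_on (h ` P)"
proof -
  have inj: "inj_on h P" using assms(1) by (rule strict_mono_on_imp_inj_on)
  note \<pi> = NC_onD[OF assms(2)]
  have "disjoint ((`) h ` \<pi>)" using disjoint_image[of h \<pi>] inj \<pi> by simp
  moreover have "\<Union>((`) h ` \<pi>) = h ` P" using \<pi>(1) by blast
  moreover have "{} \<notin> (`) h ` \<pi>" using \<pi>(4) by auto
  moreover have "noncrossing ((`) h ` \<pi>)"
  proof (rule noncrossingI)
    fix V W a b c d
    assume "V \<in> (`) h ` \<pi>" "W \<in> (`) h ` \<pi>" "a \<in> V" "b \<in> W" "c \<in> V" "d \<in> W"
      and less: "a < b" "b < c" "c < d"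
    then obtain V' W' a' b' c' d' where *: "V' \<in> \<pi>" "W' \<in> \<pi>" "a' \<in> V'" "b' \<in> W'" "c' \<in> V'" "d' \<in> W'"
      "V = h ` V'" "W = h ` W'" "a = h a'" "b = h b'" "c = h c'" "d = h d'"
      by (auto elim!: imageE)
    then have "a' \<in> P" "b' \<in> P" "c' \<in> P" "d' \<in> P" using \<pi>(1) by auto
    then have "a' < b'" "b' < c'" "c' < d'"
      using less * strict_mono_on_less_iff[OF assms(1)] by auto
    then have "V' = W'" using noncrossingD[OF \<pi>(2)] * by blast
    then show "V = W" using * by simp
  qed
  ultimately show ?thesis by (auto simp: NC_on_def partition_on_def)
qed

lemma strict_mono_on_inv_into:
  assumes "strict_mono_on P (h :: nat \<Rightarrow> nat)"
  shows "strict_mono_on (h ` P) (inv_into P h)"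
proof (rule strict_mono_onI)
  have inj: "inj_on h P" using assms by (rule strict_mono_on_imp_inj_on)
  fix r s assume "r \<in> h ` P" "s \<in> h ` P" "r < s"
  then show "inv_into P h r < inv_into P h s"
    using strict_mono_on_less_iff[OF assms] inv_into_f_f[OF inj] by auto
qed

lemma bij_betw_NC_on_image:
  assumes "strict_mono_on P (h :: nat \<Rightarrow> nat)"
  shows "bij_betw ((`) ((`) h)) (NC_on P) (NC_on (h ` P))"
proof (rule bij_betw_byWitness[where f' = "(`) ((`) (inv_into P h))"])
  have inj: "inj_on h P" using assms by (rule strict_mono_on_imp_inj_on)
  show "(`) ((`) h) ` NC_on P \<subseteq> NC_on (h ` P)" using NC_on_image[OF assms] by blast
  show "(`) ((`) (inv_into P h)) ` NC_on (h ` P) \<subseteq> NC_on P"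
    using NC_on_image[OF strict_mono_on_inv_into[OF assms]] inv_into_image_cancel[OF inj order_refl] by auto
  show "\<forall>\<pi>\<in>NC_on P. (`) (inv_into P h) ` (`) h ` \<pi> = \<pi>"
  proof
    fix \<pi> assume "\<pi> \<in> NC_on P"
    then have "inv_into P h ` h ` V = V" if "V \<in> \<pi>" for V
      using that NC_onD(1) inv_into_image_cancel[OF inj] by blast
    then show "(`) (inv_into P h) ` (`) h ` \<pi> = \<pi>" by (simp add: image_image)
  qed
  show "\<forall>\<pi>\<in>NC_on (h ` P). (`) h ` (`) (inv_into P h) ` \<pi> = \<pi>"
  proof
    fix \<pi> assume "\<pi> \<in> NC_on (h ` P)"
    then have "h ` inv_into P h ` V = V" if "V \<in> \<pi>" for V
      using that NC_onD(1)[of \<pi> "h ` P"] image_inv_into_cancel[of h P "h ` P" V] by blast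
    then show "(`) h ` (`) (inv_into P h) ` \<pi> = \<pi>" by (simp add: image_image)
  qed
qed

lemma sorted_list_of_set_strict_mono_image:
  assumes "strict_mono_on P (h :: nat \<Rightarrow> nat)" "finite P"
  shows "sorted_list_of_set (h ` P) = map h (sorted_list_of_set P)"
proof (rule sorted_distinct_set_unique)
  have inj: "inj_on h P" using assms(1) by (rule strict_mono_on_imp_inj_on)
  show "sorted (map h (sorted_list_of_set P))"
    unfolding sorted_map
    by (rule sorted_wrt_mono_rel[OF _ sorted_sorted_list_of_set]) (use assms strict_mono_on_leD[OF assms(1)] in auto)
qed (use assms strict_mono_on_imp_inj_on[OF assms(1)] in \<open>auto simp: distinct_map\<close>)

context bimodule_eval
begin

text \<open>Relabelling changes the names of the blocks, hence \<open>F\<close> may not look at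
  them. All else in a nesting (minima, maxima, left neighbours) is determined by the order of the
  positions.\<close>

lemma nest_relabel:
  assumes "\<pi> \<in> NC_on P" "finite P" "P \<noteq> {}" "strict_mono_on P h" "a ` h ` P \<subseteq> A" "F = (\<lambda>_. f)"
  shows "nest F ((`) h ` \<pi>) a = nest F \<pi> (a \<circ> h)"
  using assms
proof (induction arbitrary: a rule: NC_induct)
  case (one_block P)
  then show ?case
    by (simp add: nest_one_block entries_def sorted_list_of_set_strict_mono_image comp_def)
next
  case (remove \<pi> P V)
  have inj: "inj_on h P" using remove.prems by (simp add: strict_mono_on_imp_inj_on)
  have mono: "strict_mono_on V h" "strict_mono_on (P - V) h"
    using remove.prems(1) remove.hyps(5) by (auto intro: monotone_on_subset)
  note less_iff = strict_mono_on_less_iff[OF remove.prems(1)]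
  have h\<pi>: "(`) h ` \<pi> \<in> NC_on (h ` P)" using NC_on_image remove by blast
  have hdiff: "h ` P - h ` V = h ` (P - V)"
    using inj remove.hyps(5) by (simp add: inj_on_image_set_diff)
  have hVdiff: "(`) h ` \<pi> - {h ` V} = (`) h ` (\<pi> - {V})"
  proof -
    have "\<pi> \<subseteq> Pow P" using NC_onD(1)[OF remove.hyps(1)] by blast
    then show ?thesis
      using inj_on_image_set_diff[OF inj_on_image_blocks[OF inj], of \<pi> "{V}"] remove.hyps by auto
  qed
  have Min_hV: "Min (h ` V) = h (Min V)" and Max_hV: "Max (h ` V) = h (Max V)"
    using strict_mono_on_Min strict_mono_on_Max mono remove.hyps by blast+
  have VP: "Min V \<in> P" "Max V \<in> P" using remove.hyps by (meson Min_in Max_in subsetD)+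
  have int: "interval_block ((`) h ` \<pi>) (h ` V)"
    unfolding interval_block_def
  proof (intro conjI ballI impI)
    show "h ` V \<in> (`) h ` \<pi>" using remove.hyps by blast
    fix j assume j: "j \<in> \<Union>((`) h ` \<pi>)" "Min (h ` V) \<le> j \<and> j \<le> Max (h ` V)"
    then obtain i where i: "i \<in> P" "j = h i" using NC_onD(1)[OF h\<pi>] by auto
    have "\<not> i < Min V" "\<not> Max V < i"
      using j(2) less_iff[OF i(1) VP(1)] less_iff[OF VP(2) i(1)] i(2) Min_hV Max_hV by auto
    then have "i \<in> V" using interval_blockD[OF remove.hyps(3,1) i(1)] by blast
    then show "j \<in> h ` V" using i by blast
  qed
  have ne: "P \<noteq> {}" using remove.hyps by blast
  have "Min (h ` P) = h (Min P)"
    using strict_mono_on_Min remove ne by blast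
  then have minh: "Min (h ` P) \<in> h ` P - h ` V"
    unfolding hdiff using remove.hyps(8) by auto
  define l where "l = left_nbr P V"
  define v where "v = F (h ` V) (entries a (h ` V))"
  have lprops: "l \<in> P - V" "l < Min V" "\<And>i. i \<in> P \<Longrightarrow> i < Min V \<Longrightarrow> i \<le> l"
    unfolding l_def using left_nbr[of P V] remove.hyps by auto
  have hl: "left_nbr (h ` P) (h ` V) = h l"
    unfolding left_nbr_def Min_hV
  proof (rule Max_eqI)
    show "y \<le> h l" if y: "y \<in> {i \<in> h ` P. i < h (Min V)}" for y
    proof -
      obtain i where i: "i \<in> P" "y = h i" "h i < h (Min V)" using y by blast
      then have "i < Min V" using less_iff VP by blast
      then have "i \<le> l" using lprops i by blast
      then show ?thesis using strict_mono_on_leD[OF remove.prems(1) i(1)] lprops i by auto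
    qed
  qed (use remove.hyps lprops less_iff VP in auto)
  have v_eq: "v = F V (entries (a \<circ> h) V)"
    using mono remove.hyps remove.prems(3)
    by (simp add: v_def entries_def sorted_list_of_set_strict_mono_image)
  have aA: "(a \<circ> h) ` P \<subseteq> A" using remove.prems(2) by (simp add: image_comp)
  note r1 = nest_remove[OF h\<pi> _ int minh remove.prems(2) hl[symmetric] v_def, unfolded hVdiff hdiff]
  note r2 = nest_remove[OF remove.hyps(1-3,8) aA l_def v_eq]
  have fin: "finite (h ` P)" using remove.hyps by simp
  have nc: "\<pi> - {V} \<in> NC_on (P - V)" using NC_on_diff remove.hyps by blast
  have "nest F ((`) h ` \<pi>) a = nest F ((`) h ` (\<pi> - {V})) (a(h l := a (h l) * v))"
    using r1(1)[OF fin] .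
  also have "\<dots> = nest F (\<pi> - {V}) (a(h l := a (h l) * v) \<circ> h)"
    by (rule remove.IH) (use mono r1(2)[OF fin] remove.prems(3) in blast)+
  also have "\<dots> = nest F (\<pi> - {V}) ((a \<circ> h)(l := (a \<circ> h) l * v))"
  proof (rule nest_cong_entries[OF nc])
    show "(a(h l := a (h l) * v) \<circ> h) i = ((a \<circ> h)(l := (a \<circ> h) l * v)) i" if "i \<in> P - V" for i
      using inj_onD[OF inj, of i l] that lprops by auto
  qed (use remove.hyps in auto)
  also have "\<dots> = nest F \<pi> (a \<circ> h)" using r2(1) by simp
  finally show ?case .
qed

end

section \<open>Sums over all refinements of a partition\<close>

definition below :: "nat set \<Rightarrow> nat set set \<Rightarrow> nat set set set" where
  "below P \<pi> = {\<sigma> \<in> NC_on P. refines P \<sigma> \<pi>}"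

lemma below_one_block: "P \<noteq> {} \<Longrightarrow> below P {P} = NC_on P"
  using partition_on_space[of P] by (auto simp: below_def refines_def NC_on_def partition_on_def)

text \<open>A refinement may be chosen independently inside and outside \<open>V\<close>; the two
  choices never cross, since \<open>V\<close> is an interval of \<open>P\<close>.\<close>

lemma below_split:
  assumes "\<pi> \<in> NC_on P" "finite P" "interval_block \<pi> V"
  shows "bij_betw (\<lambda>(\<tau>, \<rho>). \<rho> \<union> \<tau>) (NC_on V \<times> below (P - V) (\<pi> - {V})) (below P \<pi>)"
proof (rule bij_betw_byWitness[where f' = "\<lambda>\<sigma>. ({U \<in> \<sigma>. U \<subseteq> V}, {U \<in> \<sigma>. \<not> U \<subseteq> V})"])
  have V: "V \<in> \<pi>" "interval_in P V" using interval_block_interval_in[OF assms(1,2)] assms(3) by auto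
  note d = NC_on_diff[OF assms(1) V(1)]
  show "\<forall>x\<in>NC_on V \<times> below (P - V) (\<pi> - {V}).
      (case case x of (\<tau>, \<rho>) \<Rightarrow> \<rho> \<union> \<tau> of \<sigma> \<Rightarrow> ({U \<in> \<sigma>. U \<subseteq> V}, {U \<in> \<sigma>. \<not> U \<subseteq> V})) = x"
  proof (rule ballI)
    fix x assume "x \<in> NC_on V \<times> below (P - V) (\<pi> - {V})"
    then obtain \<tau> \<rho> where x: "x = (\<tau>, \<rho>)" "\<tau> \<in> NC_on V" "\<rho> \<in> below (P - V) (\<pi> - {V})" by blast
    then have un: "\<Union>\<tau> = V" "\<Union>\<rho> = P - V" "{} \<notin> \<rho>"
      using NC_onD(1)[of \<tau> V] NC_onD(1,4)[of \<rho> "P - V"] by (auto simp: below_def)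
    have "U \<subseteq> V" if "U \<in> \<tau>" for U using un(1) that by blast
    moreover have "\<not> U \<subseteq> V" if "U \<in> \<rho>" for U
    proof
      assume "U \<subseteq> V"
      moreover have "U \<subseteq> P - V" using that un(2) by blast
      ultimately have "U = {}" by blast
      then show False using un(3) that by simp
    qed
    ultimately have "{U \<in> \<rho> \<union> \<tau>. U \<subseteq> V} = \<tau>" "{U \<in> \<rho> \<union> \<tau>. \<not> U \<subseteq> V} = \<rho>" by blast+
    then show "(case case x of (\<tau>, \<rho>) \<Rightarrow> \<rho> \<union> \<tau> of \<sigma> \<Rightarrow> ({U \<in> \<sigma>. U \<subseteq> V}, {U \<in> \<sigma>. \<not> U \<subseteq> V})) = x"
      by (simp add: x(1))
  qed
  show "\<forall>\<sigma>\<in>below P \<pi>. (case ({U \<in> \<sigma>. U \<subseteq> V}, {U \<in> \<sigma>. \<not> U \<subseteq> V}) of (\<tau>, \<rho>) \<Rightarrow> \<rho> \<union> \<tau>) = \<sigma>"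
    by auto
  show "(\<lambda>(\<tau>, \<rho>). \<rho> \<union> \<tau>) ` (NC_on V \<times> below (P - V) (\<pi> - {V})) \<subseteq> below P \<pi>"
  proof clarify
    fix \<tau> \<rho> assume \<tau>: "\<tau> \<in> NC_on V" and \<rho>: "\<rho> \<in> below (P - V) (\<pi> - {V})"
    have un: "\<rho> \<union> \<tau> \<in> NC_on P" using NC_on_union[OF assms(2) V(2) \<tau>] \<rho> by (simp add: below_def)
    moreover have "\<exists>W\<in>\<pi>. U \<subseteq> W" if "U \<in> \<rho> \<union> \<tau>" for U
      using that \<rho> NC_onD(1)[OF \<tau>] V(1) by (auto simp: below_def refines_def)
    ultimately show "\<rho> \<union> \<tau> \<in> below P \<pi>"
      using NC_onD(5)[OF un] NC_onD(5)[OF assms(1)] by (simp add: below_def refines_def)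
  qed
  show "(\<lambda>\<sigma>. ({U \<in> \<sigma>. U \<subseteq> V}, {U \<in> \<sigma>. \<not> U \<subseteq> V})) ` below P \<pi> \<subseteq> NC_on V \<times> below (P - V) (\<pi> - {V})"
  proof clarify
    fix \<sigma> assume \<sigma>: "\<sigma> \<in> below P \<pi>"
    then have \<sigma>P: "\<sigma> \<in> NC_on P" and r: "refines P \<sigma> \<pi>" by (auto simp: below_def)
    note nc = noncrossing_subset[OF NC_onD(2)[OF \<sigma>P]]
    have "partition_on V {U \<in> \<sigma>. U \<subseteq> V}" using refines_obtains_subset[OF r V(1)] .
    then have t: "{U \<in> \<sigma>. U \<subseteq> V} \<in> NC_on V" using nc by (simp add: NC_on_def)
    have sub: "\<exists>W\<in>\<pi> - {V}. U \<subseteq> W" if "U \<in> \<sigma>" "\<not> U \<subseteq> V" for U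
      using r that by (auto simp: refines_def)
    have "\<Union>{U \<in> \<sigma>. \<not> U \<subseteq> V} = P - V"
    proof -
      have "U \<subseteq> P - V" if "U \<in> \<sigma>" "\<not> U \<subseteq> V" for U
        using sub[OF that] NC_onD(1)[OF d] by blast
      moreover have "i \<in> \<Union>{U \<in> \<sigma>. \<not> U \<subseteq> V}" if "i \<in> P - V" for i
        using that NC_onD(1)[OF \<sigma>P] by blast
      ultimately show ?thesis by blast
    qed
    then have p: "partition_on (P - V) {U \<in> \<sigma>. \<not> U \<subseteq> V}"
      using NC_onD(3,4)[OF \<sigma>P] by (auto simp: partition_on_def disjoint_def)
    then have "{U \<in> \<sigma>. \<not> U \<subseteq> V} \<in> NC_on (P - V)" using nc by (simp add: NC_on_def)
    then have "{U \<in> \<sigma>. \<not> U \<subseteq> V} \<in> below (P - V) (\<pi> - {V})"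
      using p sub NC_onD(5)[OF d] by (simp add: below_def refines_def)
    then show "{U \<in> \<sigma>. U \<subseteq> V} \<in> NC_on V \<and> {U \<in> \<sigma>. \<not> U \<subseteq> V} \<in> below (P - V) (\<pi> - {V})"
      using t by blast
  qed
qed

text \<open>An interval block is peeled off, its value is expanded by multilinearity, and each
  summand is merged with the refinements of the remaining blocks by composition of nestings. The
  relation between \<open>F\<close> and \<open>G\<close> is required for the blocks of
  \<open>\<pi>\<close> only, so that it can come from an induction on block size.\<close>

lemma nest_sum_below:
  assumes "bimodule_eval D A F" "bimodule_eval D A G"
    and "\<pi> \<in> NC_on P" "finite P" "P \<noteq> {}" "a ` P \<subseteq> A"
    and "\<And>V b. V \<in> \<pi> \<Longrightarrow> b ` V \<subseteq> A \<Longrightarrow> F V (entries b V) = (\<Sum>\<tau>\<in>NC_on V. nest G \<tau> b)"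
  shows "nest F \<pi> a = (\<Sum>\<sigma>\<in>below P \<pi>. nest G \<sigma> a)"
  using assms(3-)
proof (induction arbitrary: a rule: NC_induct)
  case (one_block P)
  then show ?case by (simp add: nest_one_block below_one_block)
next
  case (remove \<pi> P V)
  interpret F: bimodule_eval D A F by fact
  interpret G: bimodule_eval D A G by fact
  define l where "l = left_nbr P V"
  note r = F.nest_remove[OF remove.hyps(1-3,8) remove.prems(1) l_def refl]
  have aV: "a ` V \<subseteq> A" using remove.prems remove.hyps by blast
  have V: "interval_in P V" using interval_block_interval_in[OF remove.hyps(1,2)] remove.hyps(3) by blast
  have al: "a l \<in> A" using r(3) remove.prems by blast
  have GA: "nest G \<tau> a \<in> D" if "\<tau> \<in> NC_on V" for \<tau>
    using G.nest_closed[OF that] remove.hyps aV by blast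
  have GA': "a l * nest G \<tau> a \<in> A" if "\<tau> \<in> NC_on V" for \<tau>
    using GA[OF that] al F.A_mult F.D_subset by blast
  have upd: "a(l := z) ` (P - V) \<subseteq> A" if "z \<in> A" for z using remove.prems(1) that by auto
  have "nest F \<pi> a = nest F (\<pi> - {V}) (a(l := (\<Sum>\<tau>\<in>NC_on V. a l * nest G \<tau> a)))"
    unfolding r(1) remove.prems(2)[OF remove.hyps(4) aV] sum_distrib_left ..
  also have "\<dots> = (\<Sum>\<tau>\<in>NC_on V. nest F (\<pi> - {V}) (a(l := a l * nest G \<tau> a)))"
  proof (rule F.nest_sum)
    show "\<pi> - {V} \<in> NC_on (P - V)" using NC_on_diff remove.hyps by blast
  qed (use remove.hyps remove.prems r(3) GA' finite_NC_on in auto)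
  also have "\<dots> = (\<Sum>\<tau>\<in>NC_on V. \<Sum>\<rho>\<in>below (P - V) (\<pi> - {V}). nest G \<rho> (a(l := a l * nest G \<tau> a)))"
  proof (rule sum.cong[OF refl])
    fix \<tau> assume \<tau>: "\<tau> \<in> NC_on V"
    show "nest F (\<pi> - {V}) (a(l := a l * nest G \<tau> a)) =
        (\<Sum>\<rho>\<in>below (P - V) (\<pi> - {V}). nest G \<rho> (a(l := a l * nest G \<tau> a)))"
      by (rule remove.IH[OF upd[OF GA'[OF \<tau>]]]) (use remove.prems(2) in blast)
  qed
  also have "\<dots> = (\<Sum>\<tau>\<in>NC_on V. \<Sum>\<rho>\<in>below (P - V) (\<pi> - {V}). nest G (\<rho> \<union> \<tau>) a)"
  proof (intro sum.cong refl)
    fix \<tau> \<rho> assume "\<tau> \<in> NC_on V" "\<rho> \<in> below (P - V) (\<pi> - {V})"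
    then show "nest G \<rho> (a(l := a l * nest G \<tau> a)) = nest G (\<rho> \<union> \<tau>) a"
      using remove.hyps remove.prems V
      by (intro G.nest_compose[symmetric, where Q = V and P = P]) (auto simp: below_def l_def)
  qed
  also have "\<dots> = (\<Sum>(\<tau>, \<rho>)\<in>NC_on V \<times> below (P - V) (\<pi> - {V}). nest G (\<rho> \<union> \<tau>) a)"
    by (simp add: sum.cartesian_product)
  also have "\<dots> = (\<Sum>x\<in>NC_on V \<times> below (P - V) (\<pi> - {V}). nest G ((\<lambda>(\<tau>, \<rho>). \<rho> \<union> \<tau>) x) a)"
    by (simp add: case_prod_unfold)
  also have "\<dots> = (\<Sum>\<sigma>\<in>below P \<pi>. nest G \<sigma> a)"
    by (rule sum.reindex_bij_betw[OF below_split[OF remove.hyps(1-3)]])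
  finally show ?case .
qed

section \<open>Moebius inversion and cumulants\<close>

text \<open>The recursion that defines \<open>NC_moebius\<close> fixes the first argument, whereas the inversion of
  the moment-cumulant relation needs the second one fixed.\<close>

lemma moebius_dual:
  fixes m :: "'b \<Rightarrow> 'b \<Rightarrow> int"
  assumes fin: "finite X" and refl: "\<And>x. x \<in> X \<Longrightarrow> le x x"
    and antisym: "\<And>x y. le x y \<Longrightarrow> le y x \<Longrightarrow> x = y" and trans: "\<And>x y z. le x y \<Longrightarrow> le y z \<Longrightarrow> le x z"
    and m: "\<And>x z. x \<in> X \<Longrightarrow> z \<in> X \<Longrightarrow> le x z \<Longrightarrow>
      (\<Sum>y | y \<in> X \<and> le x y \<and> le y z. m x y) = (if x = z then 1 else 0)"
    and xz: "x \<in> X" "z \<in> X" "le x z"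
  shows "(\<Sum>y | y \<in> X \<and> le x y \<and> le y z. m y z) = (if x = z then 1 else 0)"
  using xz(1,3)
proof (induction "card {y \<in> X. le x y \<and> le y z}" arbitrary: x rule: less_induct)
  case less
  define I where "I x z = {y \<in> X. le x y \<and> le y z}" for x z
  have I_eq: "{y. y \<in> X \<and> le x y \<and> le y z} = I x z" for x z by (auto simp: I_def)
  have finI: "finite (I x z)" for x z using fin by (simp add: I_def)
  define S where "S u = (\<Sum>y\<in>I u z. m y z)" for u
  have mxx: "m u u = 1" if "u \<in> X" for u
  proof -
    have "{y. y \<in> X \<and> le u y \<and> le y u} = {u}" using refl antisym that by blast
    then show ?thesis using m[OF that that refl[OF that]] by simp
  qed
  show ?case
  proof (cases "x = z")
    case True
    have "{y. y \<in> X \<and> le z y \<and> le y z} = {z}" using refl antisym xz by blast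
    then show ?thesis using mxx[OF xz(2)] True by simp
  next
    case False
    have xI: "x \<in> I x z" and zI: "z \<in> I x z - {x}" using less.prems refl xz False by (auto simp: I_def)
    \<comment> \<open>The products \<open>m x u * m y z\<close> over x \<le> u \<le> y \<le> z are
      summed in two ways. For fixed y the inner sum is the given relation, which leaves y = x and
      the total \<open>m x z\<close>.\<close>
    have "(\<Sum>u\<in>I x z. m x u * S u) = (\<Sum>u\<in>I x z. \<Sum>y | y \<in> I x z \<and> le u y. m x u * m y z)"
    proof (rule sum.cong[OF HOL.refl])
      fix u assume "u \<in> I x z"
      then have "{y. y \<in> I x z \<and> le u y} = I u z" using trans by (auto simp: I_def)
      then show "m x u * S u = (\<Sum>y | y \<in> I x z \<and> le u y. m x u * m y z)"
        by (simp add: S_def sum_distrib_left)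
    qed
    also have "\<dots> = (\<Sum>y\<in>I x z. \<Sum>u | u \<in> I x z \<and> le u y. m x u * m y z)"
      by (rule sum.swap_restrict[OF finI finI])
    also have "\<dots> = (\<Sum>y\<in>I x z. if y = x then m x z else 0)"
    proof (rule sum.cong[OF HOL.refl])
      fix y assume y: "y \<in> I x z"
      then have "{u. u \<in> I x z \<and> le u y} = {u. u \<in> X \<and> le x u \<and> le u y}" using trans by (auto simp: I_def)
      then show "(\<Sum>u | u \<in> I x z \<and> le u y. m x u * m y z) = (if y = x then m x z else 0)"
        using m[of x y] y less.prems by (simp add: sum_distrib_right[symmetric] I_def)
    qed
    also have "\<dots> = m x z" using xI finI by simp
    finally have 1: "(\<Sum>u\<in>I x z. m x u * S u) = m x z" .
    \<comment> \<open>For fixed u \<noteq> x the interval above u is smaller, so induction leaves u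
      = z, again with the total \<open>m x z\<close>. What remains of the comparison is
      \<open>m x x * S x = 0\<close>, where \<open>m x x = 1\<close>.\<close>
    have "(\<Sum>u\<in>I x z - {x}. m x u * S u) = (\<Sum>u\<in>I x z - {x}. if u = z then m x z else 0)"
    proof (rule sum.cong[OF HOL.refl])
      fix u assume u: "u \<in> I x z - {x}"
      have "I u z \<subset> I x z"
      proof
        have xu: "le x u" "u \<noteq> x" using u by (auto simp: I_def)
        show "I u z \<subseteq> I x z" using trans[OF xu(1)] by (auto simp: I_def)
        have "x \<notin> I u z" using xu antisym[of x u] by (auto simp: I_def)
        then show "I u z \<noteq> I x z" using xI by blast
      qed
      then have "card (I u z) < card (I x z)" using finI psubset_card_mono by blast
      then have "S u = (if u = z then 1 else 0)"
        using less.hyps[of u] u unfolding S_def I_def[symmetric] I_eq by (auto simp: I_def)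
      then show "m x u * S u = (if u = z then m x z else 0)" by simp
    qed
    also have "\<dots> = m x z" using zI finI by simp
    finally have "(\<Sum>u\<in>I x z. m x u * S u) = m x x * S x + m x z"
      using sum.remove[OF finI xI, of "\<lambda>u. m x u * S u"] by simp
    then have "S x = 0" using 1 mxx[OF less.prems(1)] by simp
    then show ?thesis using False unfolding S_def I_eq by simp
  qed
qed

section \<open>Moebius inversion at the one-block partition\<close>

lemma refines_one_block: "P \<noteq> {} \<Longrightarrow> partition_on P \<sigma> \<Longrightarrow> refines P \<sigma> {P}"
  by (auto simp: refines_def partition_on_space partition_on_def)

lemma NC_moebius_sum:
  assumes "\<sigma> \<in> NC p" "\<rho> \<in> NC p" "refines {1..p} \<sigma> \<rho>"
  shows "(\<Sum>\<tau> | \<tau> \<in> NC p \<and> refines {1..p} \<sigma> \<tau> \<and> refines {1..p} \<tau> \<rho>. NC_moebius p \<sigma> \<tau>) = (if \<sigma> = \<rho> then 1 else 0)"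
proof (cases "\<sigma> = \<rho>")
  case True
  have "{\<tau>. \<tau> \<in> NC p \<and> refines {1..p} \<sigma> \<tau> \<and> refines {1..p} \<tau> \<rho>} = {\<sigma>}"
    using assms True refines_asym by blast
  then show ?thesis using True by (simp add: NC_moebius.simps)
next
  case False
  have "{\<tau>. \<tau> \<in> NC p \<and> refines {1..p} \<sigma> \<tau> \<and> refines {1..p} \<tau> \<rho>} =
      insert \<rho> {\<tau>. \<tau> \<in> NC p \<and> refines {1..p} \<sigma> \<tau> \<and> refines {1..p} \<tau> \<rho> \<and> \<tau> \<noteq> \<rho>}"
    using assms refines_refl[of "{1..p}" \<rho>] by (auto simp: NC_def)
  then show ?thesis
    using False assms(3) finite_NC[of p] by (subst NC_moebius.simps[of p \<sigma> \<rho>] | simp)+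
qed

lemma NC_moebius_sum_above:
  assumes "\<sigma> \<in> NC p" "p \<ge> 1"
  shows "(\<Sum>\<pi> | \<pi> \<in> NC p \<and> refines {1..p} \<sigma> \<pi>. NC_moebius p \<pi> {{1..p}}) = (if \<sigma> = {{1..p}} then 1 else 0)"
proof -
  have ne: "{1..p} \<noteq> {}" using assms(2) by simp
  have one: "{{1..p}} \<in> NC p" unfolding NC_eq using one_block_NC_on[OF ne] .
  have le1: "refines {1..p} \<pi> {{1..p}}" if "\<pi> \<in> NC p" for \<pi>
    using refines_one_block[OF ne] that by (simp add: NC_def)
  have "(\<Sum>\<pi> | \<pi> \<in> NC p \<and> refines {1..p} \<sigma> \<pi> \<and> refines {1..p} \<pi> {{1..p}}. NC_moebius p \<pi> {{1..p}}) =
      (if \<sigma> = {{1..p}} then 1 else 0)"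
    by (rule moebius_dual[OF finite_NC _ refines_asym refines_trans NC_moebius_sum assms(1) one le1[OF assms(1)]])
      (auto intro: refines_refl simp: NC_def)
  moreover have "{\<pi>. \<pi> \<in> NC p \<and> refines {1..p} \<sigma> \<pi> \<and> refines {1..p} \<pi> {{1..p}}} = {\<pi>. \<pi> \<in> NC p \<and> refines {1..p} \<sigma> \<pi>}"
    using le1 by blast
  ultimately show ?thesis by simp
qed

text \<open>If every \<open>g \<pi>\<close> in the formula for \<open>f {{1..p}}\<close> is replaced
  by the sum of \<open>f\<close> below \<open>\<pi>\<close>, the Moebius sums collapse and return
  \<open>f {{1..p}}\<close>. The replacement is correct for all \<open>\<pi>\<close> but the top one
  by assumption, so it is correct there too, the top coefficient being 1.\<close>

lemma NC_moebius_inversion: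
  fixes f g :: "nat set set \<Rightarrow> 'a::ring_1"
  assumes "p \<ge> 1"
    and g: "\<And>\<pi>. \<pi> \<in> NC p \<Longrightarrow> \<pi> \<noteq> {{1..p}} \<Longrightarrow> g \<pi> = (\<Sum>\<sigma>\<in>below {1..p} \<pi>. f \<sigma>)"
    and f: "f {{1..p}} = (\<Sum>\<pi>\<in>NC p. g \<pi> * of_int (NC_moebius p \<pi> {{1..p}}))"
  shows "g {{1..p}} = (\<Sum>\<sigma>\<in>NC p. f \<sigma>)"
proof -
  let ?\<mu> = "\<lambda>\<pi>. of_int (NC_moebius p \<pi> {{1..p}}) :: 'a"
  have ne: "{1..p} \<noteq> {}" using assms(1) by simp
  have one: "{{1..p}} \<in> NC p" unfolding NC_eq using one_block_NC_on[OF ne] .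
  have "(\<Sum>\<pi>\<in>NC p. (\<Sum>\<sigma>\<in>below {1..p} \<pi>. f \<sigma>) * ?\<mu> \<pi>) =
      (\<Sum>\<pi>\<in>NC p. \<Sum>\<sigma> | \<sigma> \<in> NC p \<and> refines {1..p} \<sigma> \<pi>. f \<sigma> * ?\<mu> \<pi>)"
    by (simp add: sum_distrib_right below_def NC_eq)
  also have "\<dots> = (\<Sum>\<sigma>\<in>NC p. \<Sum>\<pi> | \<pi> \<in> NC p \<and> refines {1..p} \<sigma> \<pi>. f \<sigma> * ?\<mu> \<pi>)"
    using sum.swap_restrict[OF finite_NC[of p] finite_NC[of p], of "\<lambda>\<pi> \<sigma>. f \<sigma> * ?\<mu> \<pi>" "\<lambda>\<pi> \<sigma>. refines {1..p} \<sigma> \<pi>"]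
    by simp
  also have "\<dots> = (\<Sum>\<sigma>\<in>NC p. f \<sigma> * of_int (\<Sum>\<pi> | \<pi> \<in> NC p \<and> refines {1..p} \<sigma> \<pi>. NC_moebius p \<pi> {{1..p}}))"
    by (simp add: sum_distrib_left)
  also have "\<dots> = (\<Sum>\<sigma>\<in>NC p. if \<sigma> = {{1..p}} then f \<sigma> else 0)"
    using NC_moebius_sum_above[OF _ assms(1)] by (intro sum.cong) auto
  also have "\<dots> = f {{1..p}}" using one finite_NC by simp
  finally have 1: "(\<Sum>\<pi>\<in>NC p. (\<Sum>\<sigma>\<in>below {1..p} \<pi>. f \<sigma>) * ?\<mu> \<pi>) = (\<Sum>\<pi>\<in>NC p. g \<pi> * ?\<mu> \<pi>)"
    using f by simp
  have "(\<Sum>\<pi>\<in>NC p - {{{1..p}}}. (\<Sum>\<sigma>\<in>below {1..p} \<pi>. f \<sigma>) * ?\<mu> \<pi>) = (\<Sum>\<pi>\<in>NC p - {{{1..p}}}. g \<pi> * ?\<mu> \<pi>)"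
    using g by (intro sum.cong) auto
  then have "(\<Sum>\<sigma>\<in>below {1..p} {{1..p}}. f \<sigma>) * ?\<mu> {{1..p}} = g {{1..p}} * ?\<mu> {{1..p}}"
    using 1 unfolding sum.remove[OF finite_NC one] by simp
  then show ?thesis using below_one_block[OF ne] by (simp add: NC_moebius.simps NC_eq)
qed

lemma sorted_list_of_set_insert_greater:
  assumes "finite W" "\<And>w. w \<in> W \<Longrightarrow> w < (b :: nat)"
  shows "sorted_list_of_set (insert b W) = sorted_list_of_set W @ [b]"
proof (rule sorted_distinct_set_unique[OF sorted_sorted_list_of_set distinct_sorted_list_of_set])
  show "set (sorted_list_of_set (insert b W)) = set (sorted_list_of_set W @ [b])"
    unfolding set_sorted_list_of_set[OF finite.insertI[OF assms(1)]] using assms(1) by simp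
qed (use assms in \<open>auto simp: sorted_append less_imp_le\<close>)

lemma entries_update_split:
  assumes "finite V" "i \<in> V"
  obtains xs ys where "\<And>z. entries (a(i := z)) V = xs @ z # ys"
    "i = Min V \<Longrightarrow> xs = []" "i = Max V \<Longrightarrow> ys = []" "set xs \<union> set ys \<subseteq> a ` V"
proof -
  obtain us vs where s: "sorted_list_of_set V = us @ i # vs"
    using assms split_list[of i "sorted_list_of_set V"] by auto
  have d: "distinct (us @ i # vs)" and o: "sorted (us @ i # vs)" and V: "set (us @ i # vs) = V"
    using assms(1) s by (metis distinct_sorted_list_of_set, metis sorted_sorted_list_of_set, metis set_sorted_list_of_set)
  have "entries (a(i := z)) V = map a us @ z # map a vs" for z
    using d unfolding entries_def s by auto
  moreover have "map a us = []" if "i = Min V"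
  proof -
    have "u \<notin> set us" for u
    proof
      assume u: "u \<in> set us"
      then have "u \<le> i" using o by (simp add: sorted_append)
      moreover have "i \<le> u" using that u V Min_le[OF assms(1), of u] by auto
      ultimately show False using u d by auto
    qed
    then show ?thesis by (cases us) auto
  qed
  moreover have "map a vs = []" if "i = Max V"
  proof -
    have "u \<notin> set vs" for u
    proof
      assume u: "u \<in> set vs"
      then have "i \<le> u" using o by (simp add: sorted_append)
      moreover have "u \<le> i" using that u V Max_ge[OF assms(1), of u] by auto
      ultimately show False using u d by auto
    qed
    then show ?thesis by (cases vs) auto
  qed
  moreover have "set (map a us) \<union> set (map a vs) \<subseteq> a ` V" using V by auto
  ultimately show ?thesis using that by blast
qed

text \<open>The Moebius coefficients enter the cumulants as ring integers, while
  \<open>unital_subalgebra\<close> speaks of complex scalars.\<close>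

lemma (in complex_algebra) of_int_in_subalgebra:
  assumes "unital_subalgebra scale S"
  shows "of_int z \<in> S"
proof -
  have n: "of_nat n = scale (of_nat n) 1" for n
    by (induction n) (simp_all add: scale_left_distrib)
  have "of_int z = scale (of_int z) 1"
    by (cases z) (simp_all add: n[symmetric] scale_left_distrib scale_minus_left scale_left_diff_distrib del: of_nat_Suc)
  then show ?thesis using assms by (metis unital_subalgebra_def)
qed

section \<open>Moments and cumulants in a single amalgamated space\<close>

locale amalgamated_space = complex_algebra scale
  for scale :: "complex \<Rightarrow> 'a::ring_1 \<Rightarrow> 'a" +
  fixes A D :: "'a set" and \<phi> :: "'a \<Rightarrow> 'a"
  assumes subalgebra_A: "unital_subalgebra scale A" and subalgebra_D: "unital_subalgebra scale D"
    and D_le_A: "D \<subseteq> A" and cond_exp: "conditional_expectation scale A D \<phi>"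
begin

abbreviation \<Phi> :: "nat set \<Rightarrow> 'a list \<Rightarrow> 'a" where "\<Phi> \<equiv> \<lambda>_ bs. \<phi> (prod_list bs)"

abbreviation \<kappa> :: "nat set \<Rightarrow> 'a list \<Rightarrow> 'a" where "\<kappa> \<equiv> \<lambda>_. cumulant \<phi>"

lemma
  shows D_closed: "x \<in> D \<Longrightarrow> y \<in> D \<Longrightarrow> x + y \<in> D" "x \<in> D \<Longrightarrow> y \<in> D \<Longrightarrow> x * y \<in> D" "of_int z \<in> D"
    and A_closed: "x \<in> A \<Longrightarrow> y \<in> A \<Longrightarrow> x + y \<in> A" "x \<in> A \<Longrightarrow> y \<in> A \<Longrightarrow> x * y \<in> A" "of_int z \<in> A"
    and one_D: "1 \<in> D" and one_A: "1 \<in> A"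
  using subalgebra_A subalgebra_D of_int_in_subalgebra by (auto simp: unital_subalgebra_def)

lemma prod_list_A: "set bs \<subseteq> A \<Longrightarrow> prod_list bs \<in> A"
  by (induction bs) (auto simp: one_A A_closed)

lemma \<phi>_left: "d \<in> D \<Longrightarrow> x \<in> A \<Longrightarrow> \<phi> (d * x) = d * \<phi> x"
  and \<phi>_right: "d \<in> D \<Longrightarrow> x \<in> A \<Longrightarrow> \<phi> (x * d) = \<phi> x * d"
  using cond_exp one_D unfolding conditional_expectation_def by (metis mult_1 mult_1_right)+

lemma \<phi>_D: "x \<in> A \<Longrightarrow> \<phi> x \<in> D"
  and \<phi>_add: "x \<in> A \<Longrightarrow> y \<in> A \<Longrightarrow> \<phi> (x + y) = \<phi> x + \<phi> y"
  using cond_exp unfolding conditional_expectation_def by blast+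

lemma set_entries: "finite V \<Longrightarrow> set (entries a V) = a ` V"
  by (simp add: entries_def)

sublocale moment: bimodule_eval D A \<Phi>
proof
  show "D \<subseteq> A" by (rule D_le_A)
  show "0 \<in> A" using A_closed(3)[of 0] by simp
  fix x y :: 'a
  show "x \<in> A \<Longrightarrow> y \<in> A \<Longrightarrow> x + y \<in> A" "x \<in> A \<Longrightarrow> y \<in> A \<Longrightarrow> x * y \<in> A" "x \<in> D \<Longrightarrow> y \<in> D \<Longrightarrow> x * y \<in> D"
    using A_closed D_closed by auto
next
  fix V :: "nat set" and a :: "nat \<Rightarrow> 'a" and d
  assume V: "finite V" "V \<noteq> {}" and aV: "a ` V \<subseteq> A"
  have pA: "prod_list (entries a V) \<in> A"
    using V aV by (intro prod_list_A) (simp add: set_entries)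
  then show "\<phi> (prod_list (entries a V)) \<in> D" by (rule \<phi>_D)
  assume d: "d \<in> D"
  show "\<phi> (prod_list (entries (a(Min V := d * a (Min V))) V)) = d * \<phi> (prod_list (entries a V))"
  proof -
    obtain xs ys where e: "\<And>z. entries (a(Min V := z)) V = xs @ z # ys" "Min V = Min V \<Longrightarrow> xs = []"
      using entries_update_split[OF V(1) Min_in[OF V], of a] by metis
    have "entries a V = a (Min V) # ys" using e(1)[of "a (Min V)"] e(2) by simp
    then show ?thesis using e \<phi>_left[OF d pA] by (simp add: mult.assoc)
  qed
  show "\<phi> (prod_list (entries (a(Max V := a (Max V) * d)) V)) = \<phi> (prod_list (entries a V)) * d"
  proof -
    obtain xs ys where e: "\<And>z. entries (a(Max V := z)) V = xs @ z # ys" "Max V = Max V \<Longrightarrow> ys = []"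
      using entries_update_split[OF V(1) Max_in[OF V], of a] by metis
    have "entries a V = xs @ [a (Max V)]" using e(1)[of "a (Max V)"] e(2) by simp
    then show ?thesis using e \<phi>_right[OF d pA] by (simp add: mult.assoc)
  qed
next
  fix V :: "nat set" and i and a :: "nat \<Rightarrow> 'a" and b c
  assume V: "finite V" "i \<in> V" and aV: "a ` V \<subseteq> A" and bc: "b \<in> A" "c \<in> A"
  obtain xs ys where e: "\<And>z. entries (a(i := z)) V = xs @ z # ys" and s: "set xs \<union> set ys \<subseteq> a ` V"
    using entries_update_split[OF V, of a] by metis
  have pl: "prod_list xs \<in> A" "prod_list ys \<in> A" using s aV by (auto intro!: prod_list_A)
  have "prod_list xs * (z * prod_list ys) \<in> A" if "z \<in> A" for z by (intro A_closed(2) pl that)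
  from \<phi>_add[OF this[OF bc(1)] this[OF bc(2)]]
  show "\<phi> (prod_list (entries (a(i := b + c)) V)) =
      \<phi> (prod_list (entries (a(i := b)) V)) + \<phi> (prod_list (entries (a(i := c)) V))"
    by (simp only: e prod_list.append prod_list.Cons distrib_left distrib_right)
qed

lemma cumulant_entries:
  assumes "finite V" "V \<noteq> {}"
  shows "cumulant \<phi> (entries a V) = (\<Sum>\<pi>\<in>NC_on {1..card V}. nest \<Phi> \<pi> (a \<circ> enum V) *
    of_int (NC_moebius (card V) \<pi> {{1..card V}}))"
proof -
  have len: "length (entries a V) = card V" using assms by (simp add: entries_def)
  have ne: "{1..card V} \<noteq> {}" using enum_Min_Max(3)[OF assms] by simp
  have "moment_ext \<phi> \<pi> (entries a V) = nest \<Phi> \<pi> (a \<circ> enum V)" if "\<pi> \<in> NC_on {1..card V}" for \<pi>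
    unfolding moment_ext_def
    by (rule nest_cong_entries[OF that _ ne]) (auto simp: entries_def enum_def assms)
  then show ?thesis unfolding cumulant_def len NC_eq by (intro sum.cong) auto
qed

lemma cumulant_entries_update:
  assumes "finite V" "V \<noteq> {}" "j \<in> {1..card V}"
  shows "cumulant \<phi> (entries (a(enum V j := z)) V) = (\<Sum>\<pi>\<in>NC_on {1..card V}. nest \<Phi> \<pi> ((a \<circ> enum V)(j := z)) *
    of_int (NC_moebius (card V) \<pi> {{1..card V}}))"
proof -
  have ne: "{1..card V} \<noteq> {}" using enum_Min_Max(3)[OF assms(1,2)] by simp
  have inj: "inj_on (enum V) {1..card V}" using enum(1)[OF assms(1)] by (simp add: bij_betw_def)
  have "nest \<Phi> \<pi> (a(enum V j := z) \<circ> enum V) = nest \<Phi> \<pi> ((a \<circ> enum V)(j := z))"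
    if "\<pi> \<in> NC_on {1..card V}" for \<pi>
    by (rule nest_cong_entries[OF that _ ne]) (use inj_onD[OF inj _ _ assms(3)] in auto)
  then show ?thesis unfolding cumulant_entries[OF assms(1,2)] by (intro sum.cong) auto
qed

text \<open>All properties pass from the nested moments to their combination with Moebius
  coefficients. On the right this uses that these coefficients, being integers, commute with
  \<open>d\<close>.\<close>

sublocale cumul: bimodule_eval D A \<kappa>
proof
  show "D \<subseteq> A" by (rule D_le_A)
  show "0 \<in> A" by (rule moment.A_zero)
  fix x y :: 'a
  show "x \<in> A \<Longrightarrow> y \<in> A \<Longrightarrow> x + y \<in> A" "x \<in> A \<Longrightarrow> y \<in> A \<Longrightarrow> x * y \<in> A" "x \<in> D \<Longrightarrow> y \<in> D \<Longrightarrow> x * y \<in> D"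
    using A_closed D_closed by auto
next
  fix V :: "nat set" and a :: "nat \<Rightarrow> 'a" and d
  assume V: "finite V" "V \<noteq> {}" and aV: "a ` V \<subseteq> A"
  note c = enum_Min_Max[OF V]
  let ?P = "{1..card V}"
  have P: "?P \<noteq> {}" "finite ?P" using c by auto
  have MP: "Min ?P = 1" "Max ?P = card V" using c by (auto intro: Min_eqI Max_eqI)
  have aP: "(a \<circ> enum V) ` ?P \<subseteq> A" using aV enum(1)[OF V(1)] by (auto simp: bij_betw_def)
  have sumD: "(\<Sum>t\<in>T. f t) \<in> D" if "finite T" "\<And>t. t \<in> T \<Longrightarrow> f t \<in> D" for f and T :: "nat set set set"
    using that D_closed(1) D_closed(3)[of 0] by (induction T rule: finite_induct) auto
  show "cumulant \<phi> (entries a V) \<in> D"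
    unfolding cumulant_entries[OF V]
    using moment.nest_closed[OF _ P(2,1) aP] D_closed finite_NC_on[OF P(2)] by (intro sumD) auto
  assume d: "d \<in> D"
  show "cumulant \<phi> (entries (a(Min V := d * a (Min V))) V) = d * cumulant \<phi> (entries a V)"
  proof -
    have one: "1 \<in> ?P" using c by simp
    have "cumulant \<phi> (entries (a(enum V 1 := d * a (enum V 1))) V) =
        (\<Sum>\<pi>\<in>NC_on ?P. nest \<Phi> \<pi> ((a \<circ> enum V)(1 := d * a (enum V 1))) * of_int (NC_moebius (card V) \<pi> {?P}))"
      by (rule cumulant_entries_update[OF V one])
    also have "\<dots> = (\<Sum>\<pi>\<in>NC_on ?P. d * (nest \<Phi> \<pi> (a \<circ> enum V) * of_int (NC_moebius (card V) \<pi> {?P})))"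
      using moment.nest_left[OF _ P(2,1) aP d] unfolding MP
      by (intro sum.cong refl) (simp only: mult.assoc[symmetric] comp_apply)
    also have "\<dots> = d * cumulant \<phi> (entries a V)"
      unfolding cumulant_entries[OF V] sum_distrib_left ..
    finally have "cumulant \<phi> (entries (a(enum V 1 := d * a (enum V 1))) V) = d * cumulant \<phi> (entries a V)" .
    then show ?thesis by (simp only: c)
  qed
  show "cumulant \<phi> (entries (a(Max V := a (Max V) * d)) V) = cumulant \<phi> (entries a V) * d"
  proof -
    have last: "card V \<in> ?P" using c by simp
    have "cumulant \<phi> (entries (a(enum V (card V) := a (enum V (card V)) * d)) V) =
        (\<Sum>\<pi>\<in>NC_on ?P. nest \<Phi> \<pi> ((a \<circ> enum V)(card V := a (enum V (card V)) * d)) * of_int (NC_moebius (card V) \<pi> {?P}))"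
      by (rule cumulant_entries_update[OF V last])
    also have "\<dots> = (\<Sum>\<pi>\<in>NC_on ?P. nest \<Phi> \<pi> (a \<circ> enum V) * of_int (NC_moebius (card V) \<pi> {?P}) * d)"
      using moment.nest_right[OF _ P(2,1) aP d] unfolding MP
      by (intro sum.cong refl) (simp only: mult.assoc comp_apply mult_of_int_commute)
    also have "\<dots> = cumulant \<phi> (entries a V) * d"
      unfolding cumulant_entries[OF V] sum_distrib_right ..
    finally have "cumulant \<phi> (entries (a(enum V (card V) := a (enum V (card V)) * d)) V) = cumulant \<phi> (entries a V) * d" .
    then show ?thesis by (simp only: c)
  qed
next
  fix V :: "nat set" and i and a :: "nat \<Rightarrow> 'a" and b c
  assume V: "finite V" "i \<in> V" and aV: "a ` V \<subseteq> A" and bc: "b \<in> A" "c \<in> A"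
  let ?P = "{1..card V}"
  have V': "V \<noteq> {}" using V by blast
  have P: "?P \<noteq> {}" "finite ?P" using enum_Min_Max(3)[OF V(1) V'] by auto
  have aP: "(a \<circ> enum V) ` ?P \<subseteq> A" using aV enum(1)[OF V(1)] by (auto simp: bij_betw_def)
  have "i \<in> enum V ` ?P" using bij_betw_imp_surj_on[OF enum(1)[OF V(1)]] V(2) by simp
  then obtain j where j: "j \<in> ?P" "i = enum V j" by blast
  show "cumulant \<phi> (entries (a(i := b + c)) V) = cumulant \<phi> (entries (a(i := b)) V) + cumulant \<phi> (entries (a(i := c)) V)"
    unfolding j(2) cumulant_entries_update[OF V(1) V' j(1)] sum.distrib[symmetric]
    by (rule sum.cong[OF refl], subst moment.nest_add[OF _ P(2,1) aP j(1) bc]) (auto simp: distrib_right)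
qed

text \<open>Induction on the size of \<open>V\<close>. The blocks of a partition with several blocks
  are smaller, so the relation holds for its nested moments; inversion then yields it for the
  one-block partition, which is the moment in question.\<close>

lemma moment_cumulant:
  assumes "finite V" "V \<noteq> {}" "a ` V \<subseteq> A"
  shows "\<phi> (prod_list (entries a V)) = (\<Sum>\<sigma>\<in>NC_on V. nest \<kappa> \<sigma> a)"
  using assms
proof (induction "card V" arbitrary: V a rule: less_induct)
  case less
  note V = less.prems
  define p b where "p = card V" and "b = a \<circ> enum V"
  have p: "p \<ge> 1" using enum_Min_Max(3)[OF V(1,2)] by (simp add: p_def)
  have P: "{1..p} \<noteq> {}" "finite {1..p}" using p by auto
  have img: "enum V ` {1..p} = V" and mono: "strict_mono_on {1..p} (enum V)"
    using enum[OF V(1)] by (auto simp: bij_betw_def p_def)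
  have bA: "b ` {1..p} \<subseteq> A" using V(3) img by (auto simp: b_def)
  have "sorted_list_of_set V = map (enum V) (sorted_list_of_set {1..p})"
    using sorted_list_of_set_strict_mono_image[OF mono P(2)] img by metis
  then have ent: "entries b {1..p} = entries a V"
    unfolding entries_def b_def by (metis map_map)
  have one: "nest F {{1..p}} b = F {1..p} (entries a V)" for F :: "nat set \<Rightarrow> 'a list \<Rightarrow> 'a"
    by (simp only: nest_one_block ent)
  have "\<phi> (prod_list (entries a V)) = nest \<Phi> {{1..p}} b" by (simp only: one)
  also have "\<dots> = (\<Sum>\<sigma>\<in>NC p. nest \<kappa> \<sigma> b)"
  proof (rule NC_moebius_inversion[OF p])
    show "nest \<kappa> {{1..p}} b = (\<Sum>\<pi>\<in>NC p. nest \<Phi> \<pi> b * of_int (NC_moebius p \<pi> {{1..p}}))"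
      using cumulant_entries[OF V(1,2), of a] by (simp only: one NC_eq p_def[symmetric] b_def[symmetric])
    fix \<pi> assume \<pi>: "\<pi> \<in> NC p" "\<pi> \<noteq> {{1..p}}"
    then have \<pi>N: "\<pi> \<in> NC_on {1..p}" by (simp add: NC_eq)
    show "nest \<Phi> \<pi> b = (\<Sum>\<sigma>\<in>below {1..p} \<pi>. nest \<kappa> \<sigma> b)"
    proof (rule nest_sum_below[OF moment.bimodule_eval_axioms cumul.bimodule_eval_axioms \<pi>N P(2,1) bA])
      fix W c assume W: "W \<in> \<pi>" and cW: "c ` W \<subseteq> A"
      note bW = NC_on_block[OF \<pi>N P(2) W]
      have "W \<noteq> {1..p}"
      proof
        assume eq: "W = {1..p}"
        have "U = W" if "U \<in> \<pi>" for U
          using NC_on_block[OF \<pi>N P(2) that] NC_on_disjoint[OF \<pi>N that W] eq by blast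
        then have "\<pi> = {{1..p}}" using W eq by blast
        then show False using \<pi>(2) by blast
      qed
      then have "card W < card {1..p}" using bW P(2) by (intro psubset_card_mono) auto
      then show "\<phi> (prod_list (entries c W)) = (\<Sum>\<tau>\<in>NC_on W. nest \<kappa> \<tau> c)"
        using less.hyps[of W c] bW cW by (simp add: p_def)
    qed
  qed
  \<comment> \<open>The inversion took place on \<open>{1..p}\<close>; the increasing enumeration
    carries the result back to the positions of \<open>V\<close>.\<close>
  also have "\<dots> = (\<Sum>\<sigma>\<in>NC_on {1..p}. nest \<kappa> ((`) (enum V) ` \<sigma>) a)"
    unfolding NC_eq b_def
    using cumul.nest_relabel[OF _ P(2,1) mono _ refl, of _ a] V(3) img by (intro sum.cong) auto
  also have "\<dots> = (\<Sum>\<sigma>\<in>NC_on V. nest \<kappa> \<sigma> a)"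
    using sum.reindex_bij_betw[OF bij_betw_NC_on_image[OF mono], of "\<lambda>\<sigma>. nest \<kappa> \<sigma> a"] img by simp
  finally show ?case .
qed

lemma moment_cumulant_nest:
  assumes "\<pi> \<in> NC_on P" "finite P" "P \<noteq> {}" "a ` P \<subseteq> A"
  shows "nest \<Phi> \<pi> a = (\<Sum>\<sigma>\<in>below P \<pi>. nest \<kappa> \<sigma> a)"
  using moment_cumulant NC_on_block[OF assms(1,2)]
  by (intro nest_sum_below[OF moment.bimodule_eval_axioms cumul.bimodule_eval_axioms assms]) auto

end

section \<open>Partitions as equivalence relations\<close>

text \<open>In this language refinement is inclusion of relations, and a meet of partitions is an
  intersection.\<close>

definition same_block :: "nat set set \<Rightarrow> nat \<Rightarrow> nat \<Rightarrow> bool" where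
  "same_block \<pi> i j \<longleftrightarrow> (\<exists>V\<in>\<pi>. i \<in> V \<and> j \<in> V)"

lemma same_block_sym: "same_block \<pi> i j \<Longrightarrow> same_block \<pi> j i"
  by (auto simp: same_block_def)

lemma same_block_trans:
  "partition_on P \<pi> \<Longrightarrow> same_block \<pi> i j \<Longrightarrow> same_block \<pi> j k \<Longrightarrow> same_block \<pi> i k"
  unfolding same_block_def partition_on_def disjoint_def by blast

lemma same_block_in: "partition_on P \<pi> \<Longrightarrow> same_block \<pi> i j \<Longrightarrow> i \<in> P \<and> j \<in> P"
  unfolding same_block_def partition_on_def by blast

lemma same_block_in_block:
  "partition_on P \<pi> \<Longrightarrow> V \<in> \<pi> \<Longrightarrow> i \<in> V \<Longrightarrow> same_block \<pi> i j \<longleftrightarrow> j \<in> V"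
  unfolding same_block_def partition_on_def disjoint_def by blast

lemma refines_iff_same_block:
  assumes "partition_on P \<sigma>" "partition_on P \<pi>"
  shows "refines P \<sigma> \<pi> \<longleftrightarrow> (\<forall>i j. same_block \<sigma> i j \<longrightarrow> same_block \<pi> i j)"
proof
  assume "refines P \<sigma> \<pi>"
  then show "\<forall>i j. same_block \<sigma> i j \<longrightarrow> same_block \<pi> i j"
    unfolding refines_def same_block_def by blast
next
  assume *: "\<forall>i j. same_block \<sigma> i j \<longrightarrow> same_block \<pi> i j"
  have "\<exists>Y\<in>\<pi>. X \<subseteq> Y" if X: "X \<in> \<sigma>" for X
  proof -
    have "X \<noteq> {}" using X partition_onD3[OF assms(1)] by blast
    then obtain i where i: "i \<in> X" by blast
    then have "i \<in> P" using X assms(1) by (auto simp: partition_on_def)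
    then obtain Y where Y: "Y \<in> \<pi>" "i \<in> Y" using assms(2) by (auto simp: partition_on_def)
    have "j \<in> Y" if "j \<in> X" for j
      using * same_block_in_block[OF assms(1) X i] same_block_in_block[OF assms(2) Y] that by blast
    then show ?thesis using Y by blast
  qed
  then show "refines P \<sigma> \<pi>" using assms by (simp add: refines_def)
qed

text \<open>The right-hand side is a Horn condition on the relation and is therefore inherited by
  intersections, which makes meets of noncrossing partitions noncrossing.\<close>

lemma noncrossing_iff_same_block:
  assumes "partition_on P \<pi>"
  shows "noncrossing \<pi> \<longleftrightarrow>
    (\<forall>a b c d. a < b \<longrightarrow> b < c \<longrightarrow> c < d \<longrightarrow> same_block \<pi> a c \<longrightarrow> same_block \<pi> b d \<longrightarrow> same_block \<pi> a b)"
proof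
  assume nc: "noncrossing \<pi>"
  show "\<forall>a b c d. a < b \<longrightarrow> b < c \<longrightarrow> c < d \<longrightarrow> same_block \<pi> a c \<longrightarrow> same_block \<pi> b d \<longrightarrow> same_block \<pi> a b"
  proof (intro allI impI)
    fix a b c d assume *: "a < b" "b < c" "c < d" "same_block \<pi> a c" "same_block \<pi> b d"
    then obtain V W where "V \<in> \<pi>" "W \<in> \<pi>" "a \<in> V" "c \<in> V" "b \<in> W" "d \<in> W" by (auto simp: same_block_def)
    moreover have "V = W" using noncrossingD[OF nc, of V W a b c d] calculation * by blast
    ultimately show "same_block \<pi> a b" by (auto simp: same_block_def)
  qed
next
  assume *: "\<forall>a b c d. a < b \<longrightarrow> b < c \<longrightarrow> c < d \<longrightarrow> same_block \<pi> a c \<longrightarrow> same_block \<pi> b d \<longrightarrow> same_block \<pi> a b"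
  show "noncrossing \<pi>"
  proof (rule noncrossingI)
    fix V W a b c d
    assume V: "V \<in> \<pi>" "W \<in> \<pi>" "a \<in> V" "b \<in> W" "c \<in> V" "d \<in> W" and less: "a < b" "b < c" "c < d"
    have "same_block \<pi> a c" "same_block \<pi> b d" using V by (auto simp: same_block_def)
    then have "same_block \<pi> a b" using * less by blast
    then have "b \<in> V" using same_block_in_block[OF assms V(1,3)] by blast
    then show "V = W" using V assms by (auto simp: partition_on_def disjoint_def)
  qed
qed

lemma partition_of_equivalence:
  assumes "\<And>i. i \<in> P \<Longrightarrow> R i i" "\<And>i j. R i j \<Longrightarrow> R j i" "\<And>i j k. R i j \<Longrightarrow> R j k \<Longrightarrow> R i k"
  obtains \<pi> where "partition_on P \<pi>" "\<And>i j. same_block \<pi> i j \<longleftrightarrow> i \<in> P \<and> j \<in> P \<and> R i j"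
proof
  define r where "r = {(i, j). i \<in> P \<and> j \<in> P \<and> R i j}"
  have "refl_on P r" using assms(1) by (auto simp: refl_on_def r_def)
  moreover have "sym r" using assms(2) by (auto simp: sym_def r_def)
  moreover have "trans r" unfolding trans_def r_def using assms(3) by blast
  moreover have "r \<subseteq> P \<times> P" by (auto simp: r_def)
  ultimately have eq: "equiv P r" by (simp add: equiv_def)
  show "partition_on P (P // r)" by (rule partition_on_quotient[OF eq])
  show "same_block (P // r) i j \<longleftrightarrow> i \<in> P \<and> j \<in> P \<and> R i j" for i j
  proof
    assume "same_block (P // r) i j"
    then obtain X where "X \<in> P // r" "i \<in> X" "j \<in> X" by (auto simp: same_block_def)
    then have "(i, j) \<in> r" using quotient_eq_iff[OF eq, of X X i j] by blast
    then show "i \<in> P \<and> j \<in> P \<and> R i j" by (simp add: r_def)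
  next
    assume ij: "i \<in> P \<and> j \<in> P \<and> R i j"
    then have "r `` {i} \<in> P // r" "i \<in> r `` {i}" "j \<in> r `` {i}"
      using assms(1) by (auto simp: quotient_def r_def)
    then show "same_block (P // r) i j" unfolding same_block_def by blast
  qed
qed

section \<open>The Kreweras complement\<close>

text \<open>\<open>krew \<pi> i j\<close> says that no block of \<open>\<pi>\<close> is split by the positions from \<open>i + 1\<close> to \<open>j\<close>
  (in case \<open>i \<le> j\<close>). This form makes transitivity a tautology.\<close>

definition krew :: "nat set set \<Rightarrow> nat \<Rightarrow> nat \<Rightarrow> bool" where
  "krew \<pi> i j \<longleftrightarrow> (\<forall>V\<in>\<pi>. \<forall>u\<in>V. \<forall>v\<in>V. ((i < u) = (j < u)) = ((i < v) = (j < v)))"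

lemma krew_refl: "krew \<pi> i i" and krew_sym: "krew \<pi> i j \<Longrightarrow> krew \<pi> j i"
  by (auto simp: krew_def)

lemma krew_trans: "krew \<pi> i j \<Longrightarrow> krew \<pi> j k \<Longrightarrow> krew \<pi> i k"
  unfolding krew_def by (intro ballI) metis

text \<open>Suppose a block has u in (a,b] and v outside. By the first relation v lies in (a,c],
  hence in (b,c], which is contained in (b,d]; as u does not lie in (b,d], the second relation
  fails.\<close>

lemma krew_noncrossing:
  assumes "a < b" "b < c" "c < d" "krew \<pi> a c" "krew \<pi> b d"
  shows "krew \<pi> a b"
  unfolding krew_def
proof (intro ballI)
  fix V u v assume "V \<in> \<pi>" "u \<in> V" "v \<in> V"
  then have "((a < u) = (c < u)) = ((a < v) = (c < v))" "((b < u) = (d < u)) = ((b < v) = (d < v))"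
    using assms(4,5) unfolding krew_def by blast+
  then show "((a < u) = (b < u)) = ((a < v) = (b < v))" using assms(1-3) by linarith
qed

text \<open>The odd positions between 2i and 2j carry the letters i+1, ..., j. A block of
  \<open>\<pi>\<close> crosses a block through 2i and 2j exactly if it has letters inside and
  outside this range.\<close>

lemma noncrossing_alternating_union_iff:
  assumes "\<pi> \<in> NC p" "\<sigma> \<in> NC p"
  shows "noncrossing (alternating_union \<pi> \<sigma>) \<longleftrightarrow> (\<forall>i j. same_block \<sigma> i j \<longrightarrow> krew \<pi> i j)"
proof
  note \<pi> = NC_onD[OF assms(1)[unfolded NC_eq]] and \<sigma> = NC_onD[OF assms(2)[unfolded NC_eq]]
  \<comment> \<open>Positivity keeps the truncated difference \<open>2 * u - 1\<close> odd; for u =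
    0 it would be 0.\<close>
  have pos: "u \<ge> 1" if "V \<in> \<pi>" "u \<in> V" for V u using that \<pi>(1) by auto
  assume nc: "noncrossing (alternating_union \<pi> \<sigma>)"
  have key: False if S: "S \<in> \<sigma>" "i \<in> S" "j \<in> S" and V: "V \<in> \<pi>" "u \<in> V" "v \<in> V"
    and u: "i < u" "u \<le> j" and v: "\<not> (i < v \<and> v \<le> j)" for S i j V u v
  proof -
    let ?V = "(\<lambda>i. 2 * i - 1) ` V" and ?S = "(\<lambda>i. 2 * i) ` S"
    have in_au: "?V \<in> alternating_union \<pi> \<sigma>" "?S \<in> alternating_union \<pi> \<sigma>"
      using S V by (auto simp: alternating_union_def)
    have "?V = ?S"
    proof (cases "j < v")
      case True
      then show ?thesis
        using u by (intro noncrossingD[OF nc in_au(2,1), of "2 * i" "2 * u - 1" "2 * j" "2 * v - 1", symmetric])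
          (use S V in auto)
    next
      case False
      then have "v \<le> i" using v by auto
      then show ?thesis
        using u pos[OF V(1,3)] by (intro noncrossingD[OF nc in_au, of "2 * v - 1" "2 * i" "2 * u - 1" "2 * j"])
          (use S V in auto)
    qed
    moreover have "2 * i \<in> ?S" using S by blast
    ultimately obtain x where "x \<in> V" "2 * i = 2 * x - 1" by blast
    then show False using pos[OF V(1), of x] by presburger
  qed
  show "\<forall>i j. same_block \<sigma> i j \<longrightarrow> krew \<pi> i j"
  proof (intro allI impI)
    have wlog: "krew \<pi> i j" if S: "S \<in> \<sigma>" "i \<in> S" "j \<in> S" and ij: "i \<le> j" for S i j
      unfolding krew_def
    proof (intro ballI)
      fix V u v assume V: "V \<in> \<pi>" "u \<in> V" "v \<in> V"
      have "(i < u \<and> u \<le> j) = (i < v \<and> v \<le> j)"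
        using key[OF S V] key[OF S V(1,3,2)] by blast
      then show "((i < u) = (j < u)) = ((i < v) = (j < v))" using ij by linarith
    qed
    fix i j assume "same_block \<sigma> i j"
    then obtain S where S: "S \<in> \<sigma>" "i \<in> S" "j \<in> S" by (auto simp: same_block_def)
    show "krew \<pi> i j"
      using wlog[OF S] wlog[OF S(1,3,2)] krew_sym by (cases "i \<le> j") auto
  qed
next
  note \<pi> = NC_onD[OF assms(1)[unfolded NC_eq]] and \<sigma> = NC_onD[OF assms(2)[unfolded NC_eq]]
  have pos: "u \<ge> 1" if "V \<in> \<pi>" "u \<in> V" for V u using that \<pi>(1) by auto
  assume k: "\<forall>i j. same_block \<sigma> i j \<longrightarrow> krew \<pi> i j"
  show "noncrossing (alternating_union \<pi> \<sigma>)"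
  proof (rule noncrossingI)
    fix V W a b c d
    assume VW: "V \<in> alternating_union \<pi> \<sigma>" "W \<in> alternating_union \<pi> \<sigma>"
      and ab: "a \<in> V" "b \<in> W" "c \<in> V" "d \<in> W" "a < b" "b < c" "c < d"
    have shape: "(\<exists>U'\<in>\<pi>. U = (\<lambda>i. 2 * i - 1) ` U') \<or> (\<exists>U'\<in>\<sigma>. U = (\<lambda>i. 2 * i) ` U')"
      if "U \<in> alternating_union \<pi> \<sigma>" for U
      using that by (simp add: alternating_union_def image_iff)
    consider (oo) V' W' where "V' \<in> \<pi>" "W' \<in> \<pi>" "V = (\<lambda>i. 2 * i - 1) ` V'" "W = (\<lambda>i. 2 * i - 1) ` W'"
      | (ee) V' W' where "V' \<in> \<sigma>" "W' \<in> \<sigma>" "V = (\<lambda>i. 2 * i) ` V'" "W = (\<lambda>i. 2 * i) ` W'"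
      | (oe) V' W' where "V' \<in> \<pi>" "W' \<in> \<sigma>" "V = (\<lambda>i. 2 * i - 1) ` V'" "W = (\<lambda>i. 2 * i) ` W'"
      | (eo) V' W' where "V' \<in> \<sigma>" "W' \<in> \<pi>" "V = (\<lambda>i. 2 * i) ` V'" "W = (\<lambda>i. 2 * i - 1) ` W'"
      using shape[OF VW(1)] shape[OF VW(2)] by metis
    then show "V = W"
    proof cases
      case oo
      then obtain a' b' c' d' where *: "a' \<in> V'" "b' \<in> W'" "c' \<in> V'" "d' \<in> W'"
        "a = 2 * a' - 1" "b = 2 * b' - 1" "c = 2 * c' - 1" "d = 2 * d' - 1" using ab by (auto elim!: imageE)
      then have "V' = W'" using ab noncrossingD[OF \<pi>(2) oo(1,2), of a' b' c' d'] by linarith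
      then show ?thesis using oo by simp
    next
      case ee
      then obtain a' b' c' d' where *: "a' \<in> V'" "b' \<in> W'" "c' \<in> V'" "d' \<in> W'"
        "a = 2 * a'" "b = 2 * b'" "c = 2 * c'" "d = 2 * d'" using ab by (auto elim!: imageE)
      then have "V' = W'" using ab noncrossingD[OF \<sigma>(2) ee(1,2), of a' b' c' d'] by linarith
      then show ?thesis using ee by simp
    next
      case oe
      then obtain u i v j where *: "u \<in> V'" "i \<in> W'" "v \<in> V'" "j \<in> W'"
        "a = 2 * u - 1" "b = 2 * i" "c = 2 * v - 1" "d = 2 * j" using ab by (auto elim!: imageE)
      then have "krew \<pi> i j" using k oe by (auto simp: same_block_def)
      then have "((i < u) = (j < u)) = ((i < v) = (j < v))" using * oe(1) unfolding krew_def by blast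
      then show ?thesis using * ab by linarith
    next
      case eo
      then obtain u i v j where *: "u \<in> W'" "i \<in> V'" "v \<in> W'" "j \<in> V'"
        "a = 2 * i" "b = 2 * u - 1" "c = 2 * j" "d = 2 * v - 1" using ab by (auto elim!: imageE)
      then have "krew \<pi> i j" using k eo by (auto simp: same_block_def)
      then have "((i < u) = (j < u)) = ((i < v) = (j < v))" using * eo(2) unfolding krew_def by blast
      then show ?thesis using * ab by linarith
    qed
  qed
qed

text \<open>\<open>krew \<pi>\<close> is an equivalence that is itself noncrossing, so its classes
  form an admissible partition. Admissibility of another one means that its relation is contained in
  \<open>krew \<pi>\<close>; hence this one is the maximum, unique by antisymmetry.\<close>

lemma Kreweras:
  assumes "\<pi> \<in> NC p"
  shows "Kreweras p \<pi> \<in> NC p"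
    and "same_block (Kreweras p \<pi>) i j \<longleftrightarrow> i \<in> {1..p} \<and> j \<in> {1..p} \<and> krew \<pi> i j"
proof -
  obtain \<kappa> where \<kappa>: "partition_on {1..p} \<kappa>"
    "\<And>i j. same_block \<kappa> i j \<longleftrightarrow> i \<in> {1..p} \<and> j \<in> {1..p} \<and> krew \<pi> i j"
    by (rule partition_of_equivalence[of "{1..p}" "krew \<pi>", OF krew_refl krew_sym krew_trans]) simp_all
  have "noncrossing \<kappa>"
    unfolding noncrossing_iff_same_block[OF \<kappa>(1)] \<kappa>(2)
    by (intro allI impI conjI) (auto intro: krew_noncrossing)
  then have NC: "\<kappa> \<in> NC p" using \<kappa>(1) by (simp add: NC_def)
  have part: "partition_on {1..p} \<sigma>" if "\<sigma> \<in> NC p" for \<sigma> using that by (simp add: NC_def)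
  have max: "refines {1..p} \<sigma> \<kappa>" if \<sigma>: "\<sigma> \<in> NC p" "noncrossing (alternating_union \<pi> \<sigma>)" for \<sigma>
    unfolding refines_iff_same_block[OF part[OF \<sigma>(1)] \<kappa>(1)] \<kappa>(2)
    using \<sigma>(2) same_block_in[OF part[OF \<sigma>(1)]]
    unfolding noncrossing_alternating_union_iff[OF assms \<sigma>(1)] by blast
  have nc: "noncrossing (alternating_union \<pi> \<kappa>)"
    unfolding noncrossing_alternating_union_iff[OF assms NC] \<kappa>(2) by blast
  have "Kreweras p \<pi> = \<kappa>"
    unfolding Kreweras_def
  proof (rule the_equality)
    show "\<kappa> \<in> NC p \<and> noncrossing (alternating_union \<pi> \<kappa>) \<and>
        (\<forall>\<sigma>'\<in>NC p. noncrossing (alternating_union \<pi> \<sigma>') \<longrightarrow> refines {1..p} \<sigma>' \<kappa>)"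
      using NC nc max by blast
    fix \<sigma> assume "\<sigma> \<in> NC p \<and> noncrossing (alternating_union \<pi> \<sigma>) \<and>
        (\<forall>\<sigma>'\<in>NC p. noncrossing (alternating_union \<pi> \<sigma>') \<longrightarrow> refines {1..p} \<sigma>' \<sigma>)"
    then show "\<sigma> = \<kappa>" using NC nc max refines_asym by blast
  qed
  then show "Kreweras p \<pi> \<in> NC p"
    "same_block (Kreweras p \<pi>) i j \<longleftrightarrow> i \<in> {1..p} \<and> j \<in> {1..p} \<and> krew \<pi> i j"
    using NC \<kappa>(2) by auto
qed

text \<open>It suffices to link v with w = v + 1. If w is not the first element of its
  \<open>\<pi>\<close>-block, let u be its predecessor there: the letters u+1, ..., v lie between
  neighbours of that block, so \<open>krew \<pi> u v\<close>. If w is the first and d the last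
  element, the letters w, ..., d form a union of blocks, so \<open>krew \<pi> v d\<close>. In both
  cases the \<open>\<pi>\<close>-block gives the second half of the link.\<close>

lemma join_Kreweras:
  assumes \<pi>: "\<pi> \<in> NC p" and \<rho>: "\<rho> \<in> NC p" and r: "refines {1..p} \<pi> \<rho>" "refines {1..p} (Kreweras p \<pi>) \<rho>" and p: "p \<ge> 1"
  shows "\<rho> = {{1..p}}"
proof -
  note \<pi>N = \<pi>[unfolded NC_eq] and \<rho>N = \<rho>[unfolded NC_eq]
  have part: "partition_on {1..p} \<pi>" "partition_on {1..p} \<rho>" "partition_on {1..p} (Kreweras p \<pi>)"
    using NC_onD(5)[OF \<pi>N] NC_onD(5)[OF \<rho>N] Kreweras(1)[OF \<pi>] by (auto simp: NC_def)
  have \<pi>\<rho>: "same_block \<rho> i j" if "same_block \<pi> i j" for i j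
    using r(1) that refines_iff_same_block[OF part(1,2)] by blast
  have kr: "same_block \<rho> i j" if "i \<in> {1..p}" "j \<in> {1..p}" "krew \<pi> i j" for i j
    using r(2) that refines_iff_same_block[OF part(3,2)] Kreweras(2)[OF \<pi>] by blast
  have step: "same_block \<rho> v (v + 1)" if v: "v \<ge> 1" "v + 1 \<le> p" for v
  proof -
    let ?w = "v + 1"
    have "?w \<in> \<Union>\<pi>" unfolding NC_onD(1)[OF \<pi>N] using v by simp
    then obtain V where V: "V \<in> \<pi>" "?w \<in> V" by blast
    note b = NC_on_block[OF \<pi>N finite_atLeastAtMost V(1)]
    have outside: "U = V" if "U \<in> \<pi>" "x \<in> U" "y \<in> U" "a \<in> V" "d \<in> V" "a \<le> x" "x \<le> d" "\<not> (a \<le> y \<and> y \<le> d)" for U x y a d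
    proof (rule ccontr)
      assume ne: "U \<noteq> V"
      have "x \<noteq> a" "x \<noteq> d" using NC_on_disjoint[OF \<pi>N that(1) V(1)] that ne by blast+
      then have x: "a < x" "x < d" using that by auto
      have "y < a \<or> d < y" using that by linarith
      then show False
      proof
        assume 1: "y < a"
        then show False using noncrossingD[OF NC_onD(2)[OF \<pi>N] that(1) V(1) that(3,4,2,5)] x ne by blast
      next
        assume 2: "d < y"
        then show False using noncrossingD[OF NC_onD(2)[OF \<pi>N] V(1) that(1,4,2,5,3)] x ne by blast
      qed
    qed
    show ?thesis
    proof (cases "?w = Min V")
      case True
      define d where "d = Max V"
      have d: "d \<in> V" "?w \<le> d" using b V by (auto simp: d_def)
      have "krew \<pi> v d"
        unfolding krew_def
      proof (intro ballI)
        fix U x y assume U: "U \<in> \<pi>" "x \<in> U" "y \<in> U"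
        have "(?w \<le> x \<and> x \<le> d) = (?w \<le> y \<and> y \<le> d)"
        proof (cases "U = V")
          case True': True
          then have "?w \<le> z \<and> z \<le> d" if "z \<in> U" for z
            unfolding True d_def using that b by simp
          then show ?thesis using U by blast
        next
          case False
          then show ?thesis using outside[OF U V(2) d(1)] outside[OF U(1,3,2) V(2) d(1)] by blast
        qed
        then show "((v < x) = (d < x)) = ((v < y) = (d < y))" using d by linarith
      qed
      moreover have "d \<in> {1..p}" using d b by blast
      ultimately have "same_block \<rho> v d" using kr v by auto
      moreover have "same_block \<rho> d ?w" using \<pi>\<rho> V d by (auto simp: same_block_def)
      ultimately show ?thesis using same_block_trans[OF part(2)] by blast
    next
      case False
      then have mw: "Min V < ?w" using b V by (metis Min_le le_neq_implies_less)
      define u where "u = Max {x \<in> V. x < ?w}"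
      have "u \<in> {x \<in> V. x < ?w}"
        unfolding u_def using b(1) mw Min_in[OF b(1,2)] by (intro Max_in) (simp, blast)
      then have u: "u \<in> V" "u < ?w" by auto
      have umax: "x \<le> u" if "x \<in> V" "x < ?w" for x unfolding u_def using that b by (intro Max_ge) auto
      have "krew \<pi> u v"
        unfolding krew_def
      proof (intro ballI)
        fix U x y assume U: "U \<in> \<pi>" "x \<in> U" "y \<in> U"
        have "(u < x \<and> x < ?w) = (u < y \<and> y < ?w)"
        proof (cases "U = V")
          case True
          then show ?thesis using umax U by (meson leD)
        next
          case False
          then have "z \<noteq> u" "z \<noteq> ?w" if "z \<in> U" for z
            using NC_on_disjoint[OF \<pi>N U(1) V(1)] u V that by blast+
          then have "(u < z \<and> z < ?w) = (u \<le> z \<and> z \<le> ?w)" if "z \<in> U" for z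
            using that by (metis le_less)
          then show ?thesis
            using outside[OF U u(1) V(2)] outside[OF U(1,3,2) u(1) V(2)] False U by blast
        qed
        then show "((u < x) = (v < x)) = ((u < y) = (v < y))" using u by linarith
      qed
      moreover have "u \<in> {1..p}" using u b by blast
      ultimately have "same_block \<rho> v u" using kr[of u v] same_block_sym v by auto
      moreover have "same_block \<rho> u ?w" using \<pi>\<rho> V u by (auto simp: same_block_def)
      ultimately show ?thesis using same_block_trans[OF part(2)] by blast
    qed
  qed
  have "1 \<in> \<Union>\<rho>" unfolding NC_onD(1)[OF \<rho>N] using p by simp
  then obtain W where W: "W \<in> \<rho>" "1 \<in> W" by blast
  have "v + 1 \<le> p \<longrightarrow> v + 1 \<in> W" for v
  proof (induction v)
    case 0
    show ?case using W by simp
  next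
    case (Suc v)
    show ?case
    proof
      assume "Suc v + 1 \<le> p"
      then have "same_block \<rho> (v + 1) (Suc v + 1)" "v + 1 \<in> W" using step[of "v + 1"] Suc by auto
      then show "Suc v + 1 \<in> W" using same_block_in_block[OF part(2) W(1)] by blast
    qed
  qed
  then have "i \<in> W" if "i \<in> {1..p}" for i using that by (metis atLeastAtMost_iff le_add_diff_inverse2)
  then have WP: "W = {1..p}" using NC_on_block[OF \<rho>N finite_atLeastAtMost W(1)] by blast
  have "U = W" if "U \<in> \<rho>" for U
    using NC_on_block[OF \<rho>N finite_atLeastAtMost that] NC_on_disjoint[OF \<rho>N that W(1)] WP by blast
  then show ?thesis using W WP by blast
qed

lemma two_block_NC:
  assumes "1 \<le> i" "i < j" "j \<le> p"
  shows "{{i<..j}, {1..p} - {i<..j}} \<in> NC p" "{{i<..j}, {1..p} - {i<..j}} \<noteq> {{1..p}}"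
proof -
  let ?S = "{i<..j}"
  have "i \<in> {1..p} - ?S" "j \<in> ?S" using assms by auto
  then have ne: "{1..p} - ?S \<noteq> {}" "?S \<noteq> {}" by blast+
  show "{?S, {1..p} - ?S} \<noteq> {{1..p}}"
    using ne \<open>i \<in> {1..p} - ?S\<close> by (metis DiffD1 DiffD2 insertCI singletonD)
  have "partition_on {1..p} {?S, {1..p} - ?S}"
    using assms ne by (auto simp: partition_on_def disjoint_def)
  moreover have "noncrossing {?S, {1..p} - ?S}"
    by (rule noncrossingI) auto
  ultimately show "{?S, {1..p} - ?S} \<in> NC p" by (simp add: NC_def)
qed

text \<open>The partition \<open>\<sigma>\<close> lies strictly below the Kreweras complement and
  hence splits one of its blocks, \<open>W\<close>, properly. Cutting out the stretch up to the end
  of an interval block of \<open>\<sigma>\<close> within \<open>W\<close> gives a two-block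
  partition that neither \<open>\<pi>\<close> nor \<open>\<sigma>\<close> crosses.\<close>

lemma proper_join:
  assumes \<pi>: "\<pi> \<in> NC p" and \<sigma>: "\<sigma> \<in> NC p" and nc: "noncrossing (alternating_union \<pi> \<sigma>)"
    and ne: "\<sigma> \<noteq> Kreweras p \<pi>"
  obtains \<rho> where "\<rho> \<in> NC p" "refines {1..p} \<pi> \<rho>" "refines {1..p} \<sigma> \<rho>" "\<rho> \<noteq> {{1..p}}"
proof -
  define \<kappa> where "\<kappa> = Kreweras p \<pi>"
  have \<kappa>: "\<kappa> \<in> NC p" "\<And>i j. same_block \<kappa> i j \<longleftrightarrow> i \<in> {1..p} \<and> j \<in> {1..p} \<and> krew \<pi> i j"
    using Kreweras[OF \<pi>] by (auto simp: \<kappa>_def)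
  note \<kappa>N = \<kappa>(1)[unfolded NC_eq] and \<sigma>N = \<sigma>[unfolded NC_eq] and \<pi>N = \<pi>[unfolded NC_eq]
  note part = NC_onD(5)[OF \<kappa>N] NC_onD(5)[OF \<sigma>N] NC_onD(5)[OF \<pi>N]
  have \<sigma>\<kappa>: "same_block \<kappa> i j" if "same_block \<sigma> i j" for i j
    using nc that same_block_in[OF part(2) that]
    unfolding noncrossing_alternating_union_iff[OF \<pi> \<sigma>] \<kappa>(2) by blast
  then have ref: "refines {1..p} \<sigma> \<kappa>" using refines_iff_same_block[OF part(2,1)] by blast
  have "\<not> \<kappa> \<subseteq> \<sigma>"
  proof
    assume "\<kappa> \<subseteq> \<sigma>"
    then have "refines {1..p} \<kappa> \<sigma>" using part by (auto simp: refines_def)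
    then show False using ref refines_asym ne \<kappa>_def by blast
  qed
  then obtain W where W: "W \<in> \<kappa>" "W \<notin> \<sigma>" by blast
  note bW = NC_on_block[OF \<kappa>N finite_atLeastAtMost W(1)]
  define \<tau> where "\<tau> = {U \<in> \<sigma>. U \<subseteq> W}"
  have \<tau>: "\<tau> \<in> NC_on W"
    using refines_obtains_subset[OF ref W(1)] noncrossing_subset[OF NC_onD(2)[OF \<sigma>N], of \<tau>]
    by (auto simp: NC_on_def \<tau>_def)
  have "card \<tau> > 1"
    using NC_on_card1[OF \<tau> bW(1,2)] W(2) by (auto simp: \<tau>_def)
  then obtain U where U: "interval_block \<tau> U" "Min W \<notin> U" using exists_interval_block[OF \<tau> bW(1)] by blast
  have U\<tau>: "U \<in> \<tau>" using U interval_block_in by blast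
  then have U\<sigma>: "U \<in> \<sigma>" "U \<subseteq> W" by (auto simp: \<tau>_def)
  note bU = NC_on_block[OF \<tau> bW(1) U\<tau>]
  \<comment> \<open>The relation \<open>krew \<pi> i j\<close> is about the letters i+1, ..., j. The
    cut therefore starts right after the neighbour \<open>i\<close> of \<open>U\<close> in
    \<open>W\<close>, not at \<open>Min U\<close>, and includes letters in between that lie outside
    \<open>W\<close>.\<close>
  define i j where "i = left_nbr W U" and "j = Max U"
  have i: "i \<in> W" "i < Min U" "\<And>x. x \<in> W \<Longrightarrow> x < Min U \<Longrightarrow> x \<le> i"
    using left_nbr[OF bW(1) bU(3,2) U(2)] by (auto simp: i_def)
  have j: "j \<in> U" unfolding j_def using Max_in[OF bU(1,2)] .
  then have jW: "j \<in> W" "Min U \<le> j" using bU by auto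
  have ij: "1 \<le> i" "i < j" "j \<le> p" using i jW bW(3) by auto
  let ?S = "{i<..j}"
  let ?\<rho> = "{?S, {1..p} - ?S}"
  have kij: "krew \<pi> i j" using \<kappa>(2) W(1) i jW by (auto simp: same_block_def)
  have refI: "refines {1..p} \<xi> ?\<rho>" if \<xi>: "partition_on {1..p} \<xi>"
    and sat: "\<And>X a b. X \<in> \<xi> \<Longrightarrow> a \<in> X \<Longrightarrow> b \<in> X \<Longrightarrow> a \<in> ?S \<Longrightarrow> b \<in> ?S" for \<xi>
  proof -
    have "\<exists>Y\<in>?\<rho>. X \<subseteq> Y" if X: "X \<in> \<xi>" for X
    proof -
      have XP: "X \<subseteq> {1..p}" using X \<xi> by (auto simp: partition_on_def)
      show ?thesis
      proof (cases "X \<inter> ?S = {}")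
        case True
        then have "X \<subseteq> {1..p} - ?S" using XP by blast
        then show ?thesis by (intro bexI[of _ "{1..p} - ?S"]) simp_all
      next
        case False
        then obtain a where "a \<in> X" "a \<in> ?S" by blast
        then have "X \<subseteq> ?S" using sat[OF X] by (intro subsetI)
        then show ?thesis by (intro bexI[of _ ?S]) simp_all
      qed
    qed
    then show ?thesis using \<xi> two_block_NC(1)[OF ij] by (simp add: refines_def NC_def)
  qed
  have "refines {1..p} \<pi> ?\<rho>"
  proof (rule refI[OF part(3)])
    fix X a b assume "X \<in> \<pi>" "a \<in> X" "b \<in> X" "a \<in> ?S"
    then have "((i < a) = (j < a)) = ((i < b) = (j < b))" "i < a" "a \<le> j" using kij unfolding krew_def by auto
    then show "b \<in> ?S" using ij by (auto simp: not_less)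
  qed
  moreover have "refines {1..p} \<sigma> ?\<rho>"
  proof (rule refI[OF part(2)])
    fix X a b assume X: "X \<in> \<sigma>" "a \<in> X" "b \<in> X" and a: "a \<in> ?S"
    show "b \<in> ?S"
    proof (rule ccontr)
      assume b: "b \<notin> ?S"
      have ab: "same_block \<kappa> a b" using \<sigma>\<kappa> X by (auto simp: same_block_def)
      then have kab: "krew \<pi> a b" "a \<in> {1..p}" by (auto simp: \<kappa>(2))
      \<comment> \<open>Apart from coinciding ends, the pairs (a,b) and (i,j) cross, and crossing
        related pairs merge. This puts \<open>a\<close> into \<open>W\<close>, then into its
        interval block \<open>U\<close>; so \<open>X = U\<close>, which lies inside the cut,
        contrary to the choice of \<open>b\<close>.\<close>
      have "krew \<pi> i a"
      proof -
        consider "b = i" | "a = j" | "b < i" "a < j" | "j < b" "a < j" using a b by fastforce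
        then show ?thesis
        proof cases
          case 3
          then have "krew \<pi> b i" using krew_noncrossing[of b i a j \<pi>] kab kij krew_sym a by auto
          then show ?thesis using kab krew_trans krew_sym by blast
        next
          case 4
          then show ?thesis using krew_noncrossing[of i a j b \<pi>] kab kij a by auto
        qed (use kab kij krew_sym in auto)
      qed
      moreover have "i \<in> {1..p}" using ij by simp
      ultimately have "same_block \<kappa> i a" using kab by (simp add: \<kappa>(2))
      then have aW: "a \<in> W" using same_block_in_block[OF part(1) W(1) i(1)] by blast
      have "\<not> a < Min U" using i(3)[OF aW] a by auto
      then have "a \<in> U" using interval_blockD[OF U(1) \<tau> aW] a by (auto simp: j_def)
      then have "X = U" using NC_on_disjoint[OF \<sigma>N X(1) U\<sigma>(1) X(2)] by blast
      then have "Min U \<le> b" "b \<le> j" using X bU by (auto simp: j_def)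
      then show False using b i by auto
    qed
  qed
  ultimately show ?thesis using that two_block_NC[OF ij] by blast
qed

section \<open>Cumulants of products\<close>

text \<open>Positions \<open>2 r - 1\<close> and \<open>2 r\<close> carry the two factors of letter number \<open>r\<close>.\<close>

definition letter :: "nat \<Rightarrow> nat" where
  "letter j = (j + 1) div 2"

text \<open>As a preimage it respects unions, differences and disjointness. Since
  \<open>letter 0 = 0\<close>, the position 0 would be unpaired; the hypotheses that exclude 0 below
  keep it out.\<close>

definition doubled :: "nat set \<Rightarrow> nat set" where
  "doubled V = letter -` V"

lemma letter_odd_even: "i \<ge> 1 \<Longrightarrow> letter (2 * i - 1) = i" "letter (2 * i) = i" "0 < i \<Longrightarrow> letter (2 * i - Suc 0) = i"
  by (auto simp: letter_def)

lemma letter_mono: "i \<le> j \<Longrightarrow> letter i \<le> letter j"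
  by (simp add: letter_def div_le_mono)

lemma letter_eq_iff: "i \<ge> 1 \<Longrightarrow> letter j = i \<longleftrightarrow> j = 2 * i - 1 \<or> j = 2 * i"
  unfolding letter_def by presburger

lemma in_doubled: "j \<in> doubled V \<longleftrightarrow> letter j \<in> V"
  by (simp add: doubled_def)

lemma doubled_diff: "doubled (P - V) = doubled P - doubled V"
  by (auto simp: doubled_def)

lemma inj_doubled: "doubled V = doubled W \<Longrightarrow> V = W"
  using letter_odd_even(2) unfolding doubled_def by (metis subsetI subset_antisym vimage_eq)

lemma doubled_insert:
  "b \<ge> 1 \<Longrightarrow> doubled (insert b W) = insert (2 * b) (insert (2 * b - 1) (doubled W))"
  using letter_eq_iff by (auto simp: doubled_def)

lemma finite_doubled: "finite V \<Longrightarrow> finite (doubled V)"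
proof (rule finite_subset)
  show "doubled V \<subseteq> (\<lambda>i. 2 * i) ` V \<union> (\<lambda>i. 2 * i - 1) ` V"
  proof
    fix j assume "j \<in> doubled V"
    then have "letter j \<in> V" by (simp add: in_doubled)
    moreover have "j = 2 * letter j \<or> j = 2 * letter j - 1" unfolding letter_def by presburger
    ultimately show "j \<in> (\<lambda>i. 2 * i) ` V \<union> (\<lambda>i. 2 * i - 1) ` V" by blast
  qed
qed auto

lemma doubled_nonempty: "V \<noteq> {} \<Longrightarrow> doubled V \<noteq> {}"
  using letter_odd_even(2) by (metis in_doubled equals0D ex_in_conv)

lemma doubled_interval: "doubled {1..p} = {1..2 * p}"
  by (auto simp: doubled_def letter_def)

lemma Min_Max_doubled:
  assumes "finite V" "V \<noteq> {}" "0 \<notin> V"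
  shows "Min (doubled V) = 2 * Min V - 1" "Max (doubled V) = 2 * Max V"
proof -
  have m: "Min V \<in> V" "Max V \<in> V" using assms by auto
  then have "Min V \<ge> 1" using assms(3) by (cases "Min V") auto
  show "Min (doubled V) = 2 * Min V - 1"
  proof (rule Min_eqI[OF finite_doubled[OF assms(1)]])
    show "2 * Min V - 1 \<le> j" if "j \<in> doubled V" for j
      using that Min_le[OF assms(1), of "letter j"] by (simp add: in_doubled) (simp add: letter_def)
    show "2 * Min V - 1 \<in> doubled V" using m \<open>Min V \<ge> 1\<close> by (simp add: in_doubled letter_odd_even)
  qed
  show "Max (doubled V) = 2 * Max V"
  proof (rule Max_eqI[OF finite_doubled[OF assms(1)]])
    show "j \<le> 2 * Max V" if "j \<in> doubled V" for j
      using that Max_ge[OF assms(1), of "letter j"] by (simp add: in_doubled) (simp add: letter_def)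
    show "2 * Max V \<in> doubled V" using m by (simp add: in_doubled letter_odd_even)
  qed
qed

lemma doubled_partition:
  assumes "\<pi> \<in> NC_on P"
  shows "doubled ` \<pi> \<in> NC_on (doubled P)"
proof -
  note \<pi> = NC_onD[OF assms]
  have "\<Union>(doubled ` \<pi>) = doubled P" using \<pi>(1) by (auto simp: doubled_def)
  moreover have "disjoint (doubled ` \<pi>)"
  proof (rule disjointI)
    fix X Y assume "X \<in> doubled ` \<pi>" "Y \<in> doubled ` \<pi>" "X \<noteq> Y"
    then obtain V W where VW: "V \<in> \<pi>" "W \<in> \<pi>" "X = doubled V" "Y = doubled W" "V \<noteq> W" by blast
    then have "V \<inter> W = {}" using disjointD[OF \<pi>(3)] by blast
    then show "X \<inter> Y = {}" using VW(3,4) by (auto simp: doubled_def)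
  qed
  moreover have "{} \<notin> doubled ` \<pi>" using \<pi>(4) doubled_nonempty by (metis imageE)
  moreover have "noncrossing (doubled ` \<pi>)"
  proof (rule noncrossingI)
    fix V W a b c d
    assume "V \<in> doubled ` \<pi>" "W \<in> doubled ` \<pi>" and ab: "a \<in> V" "b \<in> W" "c \<in> V" "d \<in> W" "a < b" "b < c" "c < d"
    then obtain V' W' where *: "V' \<in> \<pi>" "W' \<in> \<pi>" "V = doubled V'" "W = doubled W'" by blast
    then have l: "letter a \<in> V'" "letter c \<in> V'" "letter b \<in> W'" "letter d \<in> W'"
      using ab by (auto simp: in_doubled)
    show "V = W"
    proof (rule ccontr)
      assume "V \<noteq> W"
      then have ne: "V' \<noteq> W'" using * by blast
      then have "letter a \<noteq> letter b" "letter b \<noteq> letter c" "letter c \<noteq> letter d"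
        using NC_on_disjoint[OF assms *(1,2)] l by metis+
      then have "letter a < letter b" "letter b < letter c" "letter c < letter d"
        using letter_mono ab by (metis le_neq_implies_less less_imp_le)+
      then show False using noncrossingD[OF \<pi>(2) *(1,2) l(1,3,2,4)] ne by blast
    qed
  qed
  ultimately show ?thesis by (auto simp: NC_on_def partition_on_def)
qed

lemma prod_list_entries_doubled:
  fixes a :: "nat \<Rightarrow> 'a::monoid_mult"
  assumes "finite V" "0 \<notin> V"
  shows "prod_list (entries a (doubled V)) = prod_list (entries (\<lambda>i. a (2 * i - 1) * a (2 * i)) V)"
  using assms
proof (induction V rule: finite_linorder_max_induct)
  case empty
  show ?case by (simp add: doubled_def entries_def)
next
  case (insert b W)
  have b: "b \<ge> 1" using insert.prems by (cases b) auto
  have fin: "finite (doubled W)" using insert finite_doubled by blast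
  have less: "j < 2 * b - 1" if "j \<in> doubled W" for j
  proof -
    have "letter j < b" using that insert by (auto simp: in_doubled)
    then show ?thesis unfolding letter_def by presburger
  qed
  have "sorted_list_of_set (doubled (insert b W)) = sorted_list_of_set (doubled W) @ [2 * b - 1] @ [2 * b]"
  proof -
    have "sorted_list_of_set (insert (2 * b) (insert (2 * b - 1) (doubled W))) =
        sorted_list_of_set (insert (2 * b - 1) (doubled W)) @ [2 * b]"
      by (rule sorted_list_of_set_insert_greater) (use fin less b in fastforce)+
    also have "sorted_list_of_set (insert (2 * b - 1) (doubled W)) = sorted_list_of_set (doubled W) @ [2 * b - 1]"
      by (rule sorted_list_of_set_insert_greater) (use fin less in auto)
    finally show ?thesis using b by (simp add: doubled_insert)
  qed
  moreover have "sorted_list_of_set (insert b W) = sorted_list_of_set W @ [b]"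
    by (rule sorted_list_of_set_insert_greater) (use insert in auto)
  ultimately show ?case using insert by (simp add: entries_def mult.assoc)
qed

lemma interval_block_doubled:
  assumes "\<pi> \<in> NC_on P" "finite P" "0 \<notin> P" "interval_block \<pi> V"
  shows "interval_block (doubled ` \<pi>) (doubled V)"
proof -
  have V: "V \<in> \<pi>" using assms(4) interval_block_in by blast
  note b = NC_on_block[OF assms(1,2) V]
  have "0 \<notin> V" using b(3) assms(3) by blast
  note mm = Min_Max_doubled[OF b(1,2) this]
  have "j \<in> doubled V" if j: "j \<in> \<Union>(doubled ` \<pi>)" "Min (doubled V) \<le> j \<and> j \<le> Max (doubled V)" for j
  proof (rule ccontr)
    assume "j \<notin> doubled V"
    moreover have "letter j \<in> P" using j(1) NC_onD(1)[OF doubled_partition[OF assms(1)]] by (simp add: in_doubled)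
    ultimately have "letter j < Min V \<or> Max V < letter j"
      using interval_blockD[OF assms(4,1)] by (simp add: in_doubled)
    then show False using j(2) unfolding mm letter_def by linarith
  qed
  then show ?thesis using V by (auto simp: interval_block_def)
qed

context amalgamated_space
begin

text \<open>Grouping factors is harmless for moments: the left neighbour of a doubled block is an
  even position \<open>2 * l\<close>, so the value of the block multiplies the product at letter
  \<open>l\<close> from the right, exactly as without doubling.\<close>

lemma nest_moment_doubled:
  assumes "\<pi> \<in> NC_on P" "finite P" "P \<noteq> {}" "0 \<notin> P" "a ` doubled P \<subseteq> A"
  shows "nest \<Phi> (doubled ` \<pi>) a = nest \<Phi> \<pi> (\<lambda>i. a (2 * i - 1) * a (2 * i))"
  using assms
proof (induction arbitrary: a rule: NC_induct)
  case (one_block P)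
  then show ?case by (simp add: nest_one_block prod_list_entries_doubled)
next
  case (remove \<pi> P V)
  define f where "f = (\<lambda>i. a (2 * i - 1) * a (2 * i))"
  have V0: "0 \<notin> V" using remove by blast
  have two: "2 * i - 1 \<in> doubled P" "2 * i \<in> doubled P" if "i \<in> P" for i
    using that remove.prems(1) by (cases i; simp add: in_doubled letter_def)+
  have fA: "f ` P \<subseteq> A" unfolding f_def using two remove.prems(2) A_closed(2) by blast
  define l v where "l = left_nbr P V" and "v = \<phi> (prod_list (entries f V))"
  note r1 = moment.nest_remove[OF remove.hyps(1-3,8) fA l_def v_def]
  note d\<pi> = doubled_partition[OF remove.hyps(1)] and fd = finite_doubled[OF remove.hyps(2)]
  note mP = Min_Max_doubled[OF remove.hyps(2) _ remove.prems(1)] and mV = Min_Max_doubled[OF remove.hyps(6,7) V0]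
  have ne: "P \<noteq> {}" using remove.hyps by blast
  have "0 \<noteq> Min P" using remove.hyps(8) remove.prems(1) by force
  then have "Min (doubled P) \<in> doubled P - doubled V"
    unfolding mP(1)[OF ne] using remove.hyps(8) by (simp add: in_doubled letter_odd_even)
  moreover have "2 * l = left_nbr (doubled P) (doubled V)"
    unfolding left_nbr_def
  proof (rule Max_eqI[symmetric])
    show "y \<le> 2 * l" if y: "y \<in> {i \<in> doubled P. i < Min (doubled V)}" for y
    proof -
      have "letter y \<in> P" "letter y < Min V" using y unfolding mV(1) by (auto simp: in_doubled letter_def)
      then have "letter y \<le> l" using r1(6) by blast
      then show ?thesis by (simp add: letter_def)
    qed
    have "l \<in> P" "l < Min V" using r1(3,5) by blast+
    then show "2 * l \<in> {i \<in> doubled P. i < Min (doubled V)}"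
      unfolding mV(1) by (simp add: in_doubled letter_odd_even)
  qed (use fd in simp)
  moreover have "v = \<Phi> (doubled V) (entries a (doubled V))"
    unfolding v_def f_def prod_list_entries_doubled[OF remove.hyps(6) V0] ..
  ultimately have r2: "nest \<Phi> (doubled ` \<pi>) a = nest \<Phi> (doubled ` \<pi> - {doubled V}) (a(2 * l := a (2 * l) * v))"
    "a(2 * l := a (2 * l) * v) ` (doubled P - doubled V) \<subseteq> A"
    using moment.nest_remove(1,2)[OF d\<pi> fd interval_block_doubled[OF remove.hyps(1,2) remove.prems(1) remove.hyps(3)]
      _ remove.prems(2), of "2 * l" v] by blast+
  have "doubled ` \<pi> - {doubled V} = doubled ` (\<pi> - {V})" using inj_doubled by blast
  then have "nest \<Phi> (doubled ` \<pi>) a = nest \<Phi> (doubled ` (\<pi> - {V})) (a(2 * l := a (2 * l) * v))"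
    using r2(1) by simp
  also have "\<dots> = nest \<Phi> (\<pi> - {V}) (\<lambda>i. (a(2 * l := a (2 * l) * v)) (2 * i - 1) * (a(2 * l := a (2 * l) * v)) (2 * i))"
    by (rule remove.IH) (use remove.prems(1) r2(2) doubled_diff in auto)
  also have "\<dots> = nest \<Phi> (\<pi> - {V}) (f(l := f l * v))"
  proof (rule nest_cong_entries[OF NC_on_diff[OF remove.hyps(1,4)]])
    fix i assume "i \<in> P - V"
    then have "i \<ge> 1" using remove.prems(1) by (cases i) auto
    then have "2 * i - 1 \<noteq> 2 * l" by presburger
    then show "(a(2 * l := a (2 * l) * v)) (2 * i - 1) * (a(2 * l := a (2 * l) * v)) (2 * i) = (f(l := f l * v)) i"
      by (simp add: f_def mult.assoc)
  qed (use remove.hyps in auto)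
  also have "\<dots> = nest \<Phi> \<pi> f" using r1(1) by simp
  finally show ?case by (simp add: f_def)
qed

end

lemma one_block_NC: "p \<ge> 1 \<Longrightarrow> {{1..p}} \<in> NC p"
  unfolding NC_eq by (rule one_block_NC_on) simp

lemma refines_doubled_iff:
  assumes "\<sigma> \<in> NC_on {1..2 * p}" "\<rho> \<in> NC p"
  shows "refines {1..2 * p} \<sigma> (doubled ` \<rho>) \<longleftrightarrow> (\<forall>i j. same_block \<sigma> i j \<longrightarrow> same_block \<rho> (letter i) (letter j))"
proof -
  have "partition_on {1..2 * p} (doubled ` \<rho>)"
    using NC_onD(5)[OF doubled_partition] assms(2) by (metis NC_eq doubled_interval)
  moreover have "same_block (doubled ` \<rho>) i j \<longleftrightarrow> same_block \<rho> (letter i) (letter j)" for i j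
    by (auto simp: same_block_def in_doubled)
  ultimately show ?thesis using refines_iff_same_block[OF NC_onD(5)[OF assms(1)]] by blast
qed

text \<open>The partitions \<open>\<rho>\<close> whose doubling is coarser than \<open>\<sigma>\<close> are those above a single one, because
  noncrossing partitions are closed under common refinement.\<close>

lemma NC_moebius_sum_doubled:
  assumes \<sigma>: "\<sigma> \<in> NC_on {1..2 * p}" and p: "p \<ge> 1"
  shows "(\<Sum>\<rho> | \<rho> \<in> NC p \<and> refines {1..2 * p} \<sigma> (doubled ` \<rho>). NC_moebius p \<rho> {{1..p}}) =
    (if \<forall>\<rho>\<in>NC p. refines {1..2 * p} \<sigma> (doubled ` \<rho>) \<longrightarrow> \<rho> = {{1..p}} then 1 else 0)"
proof -
  define R where "R = {\<rho> \<in> NC p. refines {1..2 * p} \<sigma> (doubled ` \<rho>)}"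
  have part: "partition_on {1..p} \<rho>" if "\<rho> \<in> NC p" for \<rho> using that by (simp add: NC_def)
  have one: "{{1..p}} \<in> NC p" using one_block_NC[OF p] .
  have letters: "letter i \<in> {1..p}" "letter j \<in> {1..p}" if "same_block \<sigma> i j" for i j
    using same_block_in[OF NC_onD(5)[OF \<sigma>] that] by (auto simp: letter_def)
  \<comment> \<open>Besides making the meet of \<open>R\<close> meaningful, a member of
    \<open>R\<close> confines \<open>Q\<close> to \<open>{1..p}\<close>; over an empty family
    \<open>Q\<close> would relate everything.\<close>
  have oneR: "{{1..p}} \<in> R"
    unfolding R_def using one refines_doubled_iff[OF \<sigma> one] letters by (auto simp: same_block_def)
  define Q where "Q i j \<longleftrightarrow> (\<forall>\<rho>\<in>R. same_block \<rho> i j)" for i j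
  have Qin: "i \<in> {1..p} \<and> j \<in> {1..p}" if "Q i j" for i j
    using that oneR by (auto simp: Q_def same_block_def)
  have Qr: "Q i i" if "i \<in> {1..p}" for i
    unfolding Q_def
  proof
    fix \<rho> assume "\<rho> \<in> R"
    then have "{1..p} = \<Union>\<rho>" using partition_onD1[OF part[of \<rho>]] by (simp add: R_def)
    then have "i \<in> \<Union>\<rho>" using that by blast
    then show "same_block \<rho> i i" by (auto simp: same_block_def)
  qed
  have Qs: "Q j i" if "Q i j" for i j using that same_block_sym unfolding Q_def by blast
  have Qt: "Q i k" if "Q i j" "Q j k" for i j k
    using that same_block_trans[OF part] unfolding Q_def R_def by blast
  obtain \<rho>\<^sub>0 where \<rho>\<^sub>0: "partition_on {1..p} \<rho>\<^sub>0" "\<And>i j. same_block \<rho>\<^sub>0 i j \<longleftrightarrow> i \<in> {1..p} \<and> j \<in> {1..p} \<and> Q i j"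
    by (rule partition_of_equivalence[of "{1..p}" Q, OF Qr Qs Qt]) simp_all
  have sb: "same_block \<rho>\<^sub>0 i j \<longleftrightarrow> Q i j" for i j using \<rho>\<^sub>0(2) Qin by blast
  have "noncrossing \<rho>\<^sub>0"
    unfolding noncrossing_iff_same_block[OF \<rho>\<^sub>0(1)] sb
  proof (intro allI impI)
    fix a b c d assume *: "a < b" "b < c" "c < d" "Q a c" "Q b d"
    have "same_block \<rho> a b" if "\<rho> \<in> R" for \<rho>
    proof -
      have "noncrossing \<rho>" "partition_on {1..p} \<rho>" using that by (auto simp: R_def NC_def)
      moreover have "same_block \<rho> a c" "same_block \<rho> b d" using * that by (auto simp: Q_def)
      ultimately show ?thesis using noncrossing_iff_same_block *(1-3) by blast
    qed
    then show "Q a b" by (simp add: Q_def)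
  qed
  then have NC0: "\<rho>\<^sub>0 \<in> NC p" using \<rho>\<^sub>0(1) by (simp add: NC_def)
  have above: "\<rho> \<in> R \<longleftrightarrow> \<rho> \<in> NC p \<and> refines {1..p} \<rho>\<^sub>0 \<rho>" for \<rho>
  proof
    assume \<rho>: "\<rho> \<in> R"
    then have "\<rho> \<in> NC p" by (simp add: R_def)
    then show "\<rho> \<in> NC p \<and> refines {1..p} \<rho>\<^sub>0 \<rho>"
      using refines_iff_same_block[OF \<rho>\<^sub>0(1) part] \<rho> by (auto simp: sb Q_def)
  next
    assume \<rho>: "\<rho> \<in> NC p \<and> refines {1..p} \<rho>\<^sub>0 \<rho>"
    have "same_block \<rho> (letter i) (letter j)" if "same_block \<sigma> i j" for i j
    proof -
      have "Q (letter i) (letter j)"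
        unfolding Q_def R_def using refines_doubled_iff[OF \<sigma>] that by blast
      then show ?thesis using refines_iff_same_block[OF \<rho>\<^sub>0(1) part] \<rho> sb by blast
    qed
    then show "\<rho> \<in> R" unfolding R_def using \<rho> refines_doubled_iff[OF \<sigma>] by blast
  qed
  have "(\<Sum>\<rho> | \<rho> \<in> NC p \<and> refines {1..2 * p} \<sigma> (doubled ` \<rho>). NC_moebius p \<rho> {{1..p}}) =
      (\<Sum>\<rho> | \<rho> \<in> NC p \<and> refines {1..p} \<rho>\<^sub>0 \<rho>. NC_moebius p \<rho> {{1..p}})"
    using above by (intro sum.cong) (auto simp: R_def)
  also have "\<dots> = (if \<rho>\<^sub>0 = {{1..p}} then 1 else 0)" by (rule NC_moebius_sum_above[OF NC0 p])
  also have "\<rho>\<^sub>0 = {{1..p}} \<longleftrightarrow> (\<forall>\<rho>\<in>NC p. refines {1..2 * p} \<sigma> (doubled ` \<rho>) \<longrightarrow> \<rho> = {{1..p}})"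
  proof
    assume "\<rho>\<^sub>0 = {{1..p}}"
    then show "\<forall>\<rho>\<in>NC p. refines {1..2 * p} \<sigma> (doubled ` \<rho>) \<longrightarrow> \<rho> = {{1..p}}"
      using above refines_one_block[of "{1..p}"] part refines_asym p unfolding R_def
      by (metis (mono_tags, lifting) atLeastatMost_empty_iff2 leD mem_Collect_eq)
  next
    assume "\<forall>\<rho>\<in>NC p. refines {1..2 * p} \<sigma> (doubled ` \<rho>) \<longrightarrow> \<rho> = {{1..p}}"
    moreover have "\<rho>\<^sub>0 \<in> R" using above NC0 refines_refl[OF \<rho>\<^sub>0(1)] by blast
    ultimately show "\<rho>\<^sub>0 = {{1..p}}" by (auto simp: R_def)
  qed
  finally show ?thesis .
qed

lemma sorted_list_of_set_interval: "sorted_list_of_set {1..p} = [1..<Suc p]"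
  using sorted_list_of_set_range[of 1 "Suc p"] by (simp only: atLeastLessThanSuc_atLeastAtMost)

lemma entries_interval: "entries f {1..p} = map f [1..<Suc p]"
  by (simp only: entries_def sorted_list_of_set_interval)

text \<open>The formula for cumulants with products as entries. The doubled partitions are the
  noncrossing ones above the pairing {1,2}, {3,4}, ..., so the condition says that the join of
  \<open>\<sigma>\<close> with this pairing is the one-block partition.\<close>

lemma (in amalgamated_space) cumulant_products:
  assumes p: "p \<ge> 1" and a: "a ` {1..2 * p} \<subseteq> A"
  shows "cumulant \<phi> (entries (\<lambda>i. a (2 * i - 1) * a (2 * i)) {1..p}) =
    (\<Sum>\<sigma> | \<sigma> \<in> NC (2 * p) \<and> (\<forall>\<rho>\<in>NC p. refines {1..2 * p} \<sigma> (doubled ` \<rho>) \<longrightarrow> \<rho> = {{1..p}}). nest \<kappa> \<sigma> a)"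
proof -
  define f where "f = (\<lambda>i. a (2 * i - 1) * a (2 * i))"
  have P: "finite {1..p}" "{1..p} \<noteq> {}" using p by auto
  have P2: "finite {1..2 * p}" "{1..2 * p} \<noteq> {}" using p by auto
  let ?\<mu> = "\<lambda>\<pi>. of_int (NC_moebius p \<pi> {{1..p}}) :: 'a"
  have "cumulant \<phi> (entries f {1..p}) = (\<Sum>\<rho>\<in>NC p. nest \<Phi> \<rho> f * ?\<mu> \<rho>)"
  proof -
    have len: "length (entries f {1..p}) = p" by (simp add: entries_def)
    have e: "entries f {1..p} ! (i - 1) = f i" if "i \<in> {1..p}" for i
      unfolding entries_interval using that by (subst nth_map) (auto simp del: upt_Suc)
    have "moment_ext \<phi> \<rho> (entries f {1..p}) = nest \<Phi> \<rho> f" if "\<rho> \<in> NC p" for \<rho>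
      unfolding moment_ext_def
      by (rule nest_cong_entries[OF that[unfolded NC_eq] P]) (use e in simp)
    then show ?thesis unfolding cumulant_def len by (intro sum.cong) auto
  qed
  also have "\<dots> = (\<Sum>\<rho>\<in>NC p. \<Sum>\<sigma> | \<sigma> \<in> NC_on {1..2 * p} \<and> refines {1..2 * p} \<sigma> (doubled ` \<rho>). nest \<kappa> \<sigma> a * ?\<mu> \<rho>)"
  proof (rule sum.cong[OF refl])
    fix \<rho> assume "\<rho> \<in> NC p"
    then have \<rho>: "\<rho> \<in> NC_on {1..p}" by (simp add: NC_eq)
    have "nest \<Phi> \<rho> f = nest \<Phi> (doubled ` \<rho>) a"
      unfolding f_def using a by (intro nest_moment_doubled[OF \<rho> P, symmetric]) (simp, simp only: doubled_interval)
    also have "\<dots> = (\<Sum>\<sigma>\<in>below {1..2 * p} (doubled ` \<rho>). nest \<kappa> \<sigma> a)"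
      using moment_cumulant_nest[OF doubled_partition[OF \<rho>, unfolded doubled_interval] P2 a] .
    finally show "nest \<Phi> \<rho> f * ?\<mu> \<rho> =
        (\<Sum>\<sigma> | \<sigma> \<in> NC_on {1..2 * p} \<and> refines {1..2 * p} \<sigma> (doubled ` \<rho>). nest \<kappa> \<sigma> a * ?\<mu> \<rho>)"
      by (simp add: below_def sum_distrib_right)
  qed
  also have "\<dots> = (\<Sum>\<sigma>\<in>NC_on {1..2 * p}. \<Sum>\<rho> | \<rho> \<in> NC p \<and> refines {1..2 * p} \<sigma> (doubled ` \<rho>). nest \<kappa> \<sigma> a * ?\<mu> \<rho>)"
    by (rule sum.swap_restrict[OF finite_NC finite_NC_on[OF P2(1)]])
  also have "\<dots> = (\<Sum>\<sigma>\<in>NC_on {1..2 * p}. nest \<kappa> \<sigma> a *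
      of_int (\<Sum>\<rho> | \<rho> \<in> NC p \<and> refines {1..2 * p} \<sigma> (doubled ` \<rho>). NC_moebius p \<rho> {{1..p}}))"
    by (simp add: sum_distrib_left)
  also have "\<dots> = (\<Sum>\<sigma>\<in>NC_on {1..2 * p}.
      if \<forall>\<rho>\<in>NC p. refines {1..2 * p} \<sigma> (doubled ` \<rho>) \<longrightarrow> \<rho> = {{1..p}} then nest \<kappa> \<sigma> a else 0)"
  proof (rule sum.cong[OF refl])
    fix \<sigma> assume "\<sigma> \<in> NC_on {1..2 * p}"
    from NC_moebius_sum_doubled[OF this p]
    show "nest \<kappa> \<sigma> a * of_int (\<Sum>\<rho> | \<rho> \<in> NC p \<and> refines {1..2 * p} \<sigma> (doubled ` \<rho>). NC_moebius p \<rho> {{1..p}}) =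
        (if \<forall>\<rho>\<in>NC p. refines {1..2 * p} \<sigma> (doubled ` \<rho>) \<longrightarrow> \<rho> = {{1..p}} then nest \<kappa> \<sigma> a else 0)"
      by (simp only: if_distrib[of of_int] if_distrib[of "(*) (nest \<kappa> \<sigma> a)"] of_int_1 of_int_0 mult_1_right mult_zero_right)
  qed
  also have "\<dots> = (\<Sum>\<sigma> | \<sigma> \<in> NC (2 * p) \<and>
      (\<forall>\<rho>\<in>NC p. refines {1..2 * p} \<sigma> (doubled ` \<rho>) \<longrightarrow> \<rho> = {{1..p}}). nest \<kappa> \<sigma> a)"
    unfolding NC_eq[of "2 * p"] by (rule sum.inter_filter[symmetric, OF finite_NC_on[OF P2(1)]])
  finally show ?thesis by (simp add: f_def)
qed

section \<open>Partitions that separate odd and even positions\<close>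

lemma refines_alternating_union_iff:
  assumes "\<pi> \<in> NC p" "\<sigma> \<in> NC p" "\<rho> \<in> NC p" "alternating_union \<pi> \<sigma> \<in> NC_on {1..2 * p}"
  shows "refines {1..2 * p} (alternating_union \<pi> \<sigma>) (doubled ` \<rho>) \<longleftrightarrow>
    refines {1..p} \<pi> \<rho> \<and> refines {1..p} \<sigma> \<rho>"
proof -
  have part: "partition_on {1..p} \<xi>" if "\<xi> \<in> NC p" for \<xi> using that by (simp add: NC_def)
  have "partition_on {1..2 * p} (doubled ` \<rho>)"
    using NC_onD(5)[OF doubled_partition] assms(3) by (metis NC_eq doubled_interval)
  moreover have "(\<lambda>i. 2 * i - 1) ` V \<subseteq> doubled W \<longleftrightarrow> V \<subseteq> W" if "V \<in> \<pi>" for V W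
  proof -
    have "letter (2 * i - 1) = i" if "i \<in> V" for i
      using NC_onD(1)[OF assms(1)[unfolded NC_eq]] \<open>V \<in> \<pi>\<close> that by (intro letter_odd_even(1)) force
    then show ?thesis by (auto simp: in_doubled)
  qed
  moreover have "(\<lambda>i. 2 * i) ` V \<subseteq> doubled W \<longleftrightarrow> V \<subseteq> W" for V W
    by (auto simp: in_doubled letter_odd_even)
  ultimately show ?thesis
    using part assms(1-3) NC_onD(5)[OF assms(4)]
    by (simp add: refines_def alternating_union_def ball_Un)
qed

lemma alternating_union_partition:
  assumes "\<pi> \<in> NC p" "\<sigma> \<in> NC p" "noncrossing (alternating_union \<pi> \<sigma>)"
  shows "alternating_union \<pi> \<sigma> \<in> NC_on {1..2 * p}"
proof -
  note \<pi> = NC_onD[OF assms(1)[unfolded NC_eq]] and \<sigma> = NC_onD[OF assms(2)[unfolded NC_eq]]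
  let ?o = "\<lambda>i::nat. 2 * i - 1" and ?e = "\<lambda>i::nat. 2 * i"
  have un: "\<Union>((`) ?o ` \<pi>) = ?o ` {1..p}" "\<Union>((`) ?e ` \<sigma>) = ?e ` {1..p}" using \<pi>(1) \<sigma>(1) by blast+
  have inj: "inj_on ?o {1..p}" "inj_on ?e {1..p}" by (auto simp: inj_on_def)
  have d: "disjoint ((`) ?o ` \<pi>)" "disjoint ((`) ?e ` \<sigma>)"
    using disjoint_image[of ?o \<pi>] disjoint_image[of ?e \<sigma>] inj \<pi> \<sigma> by simp_all
  have "?o ` {1..p} \<inter> ?e ` {1..p} = {}"
  proof (rule ccontr)
    assume "?o ` {1..p} \<inter> ?e ` {1..p} \<noteq> {}"
    then obtain i j :: nat where "i \<ge> 1" "2 * i - 1 = 2 * j" by auto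
    then show False by presburger
  qed
  then have "disjoint (alternating_union \<pi> \<sigma>)"
    unfolding alternating_union_def by (intro disjoint_union d) (simp only: un)
  moreover have "\<Union>(alternating_union \<pi> \<sigma>) = {1..2 * p}"
  proof -
    have "\<Union>(alternating_union \<pi> \<sigma>) = ?o ` {1..p} \<union> ?e ` {1..p}"
      unfolding alternating_union_def Union_Un_distrib un ..
    also have "\<dots> = {1..2 * p}"
    proof
      show "{1..2 * p} \<subseteq> ?o ` {1..p} \<union> ?e ` {1..p}"
      proof
        fix j assume j: "j \<in> {1..2 * p}"
        then have "letter j \<in> {1..p}" by (auto simp: letter_def)
        moreover have "j = 2 * letter j \<or> j = 2 * letter j - 1" unfolding letter_def by presburger
        ultimately show "j \<in> ?o ` {1..p} \<union> ?e ` {1..p}" by blast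
      qed
    qed auto
    finally show ?thesis .
  qed
  moreover have "{} \<notin> alternating_union \<pi> \<sigma>" using \<pi>(4) \<sigma>(4) by (auto simp: alternating_union_def)
  ultimately show ?thesis using assms(3) by (auto simp: NC_on_def partition_on_def)
qed

lemma alternating_union_blocks:
  assumes "\<pi> \<in> NC p" "V \<in> alternating_union \<pi> \<sigma>"
  obtains "\<forall>i\<in>V. odd i" | "\<forall>i\<in>V. even i"
proof -
  have "\<forall>i\<in>V'. i \<ge> 1" if "V' \<in> \<pi>" for V' using that NC_onD(1)[OF assms(1)[unfolded NC_eq]] by auto
  then have "(\<forall>i\<in>V. odd i) \<or> (\<forall>i\<in>V. even i)" using assms(2) by (fastforce simp: alternating_union_def)
  then show ?thesis using that by blast
qed

text \<open>On positions of one parity \<open>letter\<close> is strictly increasing, so the blocks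
  of either parity become a noncrossing partition of \<open>{1..p}\<close> by relabelling.\<close>

lemma separated_is_alternating_union:
  assumes \<sigma>: "\<sigma> \<in> NC_on {1..2 * p}" and sep: "\<And>V. V \<in> \<sigma> \<Longrightarrow> (\<forall>i\<in>V. odd i) \<or> (\<forall>i\<in>V. even i)"
  obtains \<pi> \<tau> where "\<pi> \<in> NC p" "\<tau> \<in> NC p" "\<sigma> = alternating_union \<pi> \<tau>"
proof -
  note s = NC_onD[OF \<sigma>]
  have half: "(`) letter ` {V \<in> \<sigma>. \<forall>i\<in>V. even i = b} \<in> NC p" for b
  proof -
    let ?\<sigma> = "{V \<in> \<sigma>. \<forall>i\<in>V. even i = b}" and ?P = "{i \<in> {1..2 * p}. even i = b}"
    have un: "\<Union>?\<sigma> = ?P"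
    proof
      show "?P \<subseteq> \<Union>?\<sigma>"
      proof
        fix i assume i: "i \<in> ?P"
        then obtain V where V: "V \<in> \<sigma>" "i \<in> V" using s(1) by blast
        then have "\<forall>j\<in>V. even j = b" using sep[OF V(1)] i by auto
        then show "i \<in> \<Union>?\<sigma>" using V by blast
      qed
    qed (use s(1) in blast)
    have "?\<sigma> \<in> NC_on ?P"
      using un s(3,4) noncrossing_subset[OF s(2), of ?\<sigma>] by (auto simp: NC_on_def partition_on_def disjoint_def)
    moreover have "strict_mono_on ?P letter"
    proof (rule strict_mono_onI)
      fix i j assume ij: "i \<in> ?P" "j \<in> ?P" "i < j"
      then have "even i = even j" by simp
      then have "i + 2 \<le> j" using ij(3) by presburger
      then show "letter i < letter j" unfolding letter_def by presburger
    qed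
    moreover have "letter ` ?P = {1..p}"
    proof
      show "{1..p} \<subseteq> letter ` ?P"
      proof
        fix i assume i: "i \<in> {1..p}"
        show "i \<in> letter ` ?P"
        proof (cases b)
          case True
          then show ?thesis
            using i by (intro image_eqI[of _ _ "2 * i"]) (auto simp: letter_odd_even)
        next
          case False
          then show ?thesis
            using i by (intro image_eqI[of _ _ "2 * i - 1"]) (auto simp: letter_odd_even)
        qed
      qed
      show "letter ` ?P \<subseteq> {1..p}"
      proof (rule image_subsetI)
        fix i assume "i \<in> ?P"
        then have "1 \<le> i" "i \<le> 2 * p" by auto
        then show "letter i \<in> {1..p}" unfolding letter_def atLeastAtMost_iff by presburger
      qed
    qed
    ultimately show ?thesis unfolding NC_eq using NC_on_image[of ?P letter ?\<sigma>] by simp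
  qed
  have "\<sigma> = alternating_union ((`) letter ` {V \<in> \<sigma>. \<forall>i\<in>V. even i = False}) ((`) letter ` {V \<in> \<sigma>. \<forall>i\<in>V. even i = True})"
  proof -
    have cancel: "(`) f ` (`) g ` S = S" if "\<And>V. V \<in> S \<Longrightarrow> f ` g ` V = V" for f g :: "nat \<Rightarrow> nat" and S
    proof -
      have "(`) f ` (`) g ` S = (\<lambda>V. f ` g ` V) ` S" by (rule image_image)
      also have "\<dots> = (\<lambda>V. V) ` S" by (rule image_cong[OF refl]) (rule that)
      finally show ?thesis by simp
    qed
    have o: "(\<lambda>i. 2 * i - 1) ` letter ` V = V" if "\<forall>i\<in>V. even i = False" for V
    proof -
      have "2 * letter i - 1 = i" if "i \<in> V" for i
        using that \<open>\<forall>i\<in>V. even i = False\<close> unfolding letter_def by (auto elim: oddE)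
      then show ?thesis unfolding image_image by simp
    qed
    have e: "(\<lambda>i. 2 * i) ` letter ` V = V" if "\<forall>i\<in>V. even i = True" for V
    proof -
      have "2 * letter i = i" if "i \<in> V" for i
        using that \<open>\<forall>i\<in>V. even i = True\<close> unfolding letter_def by (auto elim: evenE)
      then show ?thesis unfolding image_image by simp
    qed
    have "(`) (\<lambda>i. 2 * i - 1) ` (`) letter ` {V \<in> \<sigma>. \<forall>i\<in>V. even i = False} = {V \<in> \<sigma>. \<forall>i\<in>V. even i = False}"
      by (rule cancel) (use o in blast)
    moreover have "(`) (\<lambda>i. 2 * i) ` (`) letter ` {V \<in> \<sigma>. \<forall>i\<in>V. even i = True} = {V \<in> \<sigma>. \<forall>i\<in>V. even i = True}"
      by (rule cancel) (use e in blast)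
    moreover have "\<sigma> = {V \<in> \<sigma>. \<forall>i\<in>V. even i = False} \<union> {V \<in> \<sigma>. \<forall>i\<in>V. even i = True}"
      using sep by blast
    ultimately show ?thesis unfolding alternating_union_def by (simp only:)
  qed
  then show ?thesis using that half by blast
qed

text \<open>The other inclusion follows by exchanging the roles. The first component is enough: in
  the intended use the second one is the Kreweras complement of the first.\<close>

lemma alternating_union_inj:
  assumes "\<pi> \<in> NC p" "\<pi>' \<in> NC p" "\<sigma> \<in> NC p" "\<sigma>' \<in> NC p" "alternating_union \<pi> \<sigma> = alternating_union \<pi>' \<sigma>'"
  shows "\<pi> \<subseteq> \<pi>'"
proof
  fix V assume V: "V \<in> \<pi>"
  have pos: "i \<ge> 1" if "U \<in> \<pi> \<or> U \<in> \<pi>'" "i \<in> U" for U i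
    using that NC_onD(1)[OF assms(1)[unfolded NC_eq]] NC_onD(1)[OF assms(2)[unfolded NC_eq]] by auto
  obtain i where i: "i \<in> V" using NC_onD(4)[OF assms(1)[unfolded NC_eq]] V by (metis ex_in_conv)
  let ?o = "\<lambda>i::nat. 2 * i - 1"
  have "?o ` V \<in> alternating_union \<pi> \<sigma>" unfolding alternating_union_def by (intro UnI1 imageI V)
  then have "?o ` V \<in> alternating_union \<pi>' \<sigma>'" by (simp only: assms(5))
  moreover have "?o ` V \<noteq> (\<lambda>i. 2 * i) ` W" for W
  proof
    assume "?o ` V = (\<lambda>i. 2 * i) ` W"
    then obtain j where "2 * i - 1 = 2 * j" using i by blast
    moreover have "i \<ge> 1" using pos[of V i] V i by blast
    ultimately show False by presburger
  qed
  ultimately obtain W where W: "W \<in> \<pi>'" "?o ` V = ?o ` W" by (auto simp: alternating_union_def)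
  have "letter ` ?o ` U = U" if "U \<in> \<pi> \<or> U \<in> \<pi>'" for U
    using pos[OF that] letter_odd_even(1) by (simp add: image_image)
  then have "V = W" using V W by metis
  then show "V \<in> \<pi>'" using W by blast
qed

section \<open>Freeness\<close>

lemma unital_subalgebra_hull: "unital_subalgebra scale (unital_subalgebra scale hull S)"
  by (rule hull_in) (auto simp: unital_subalgebra_def)

context amalgamated_space
begin

text \<open>\<open>free_over\<close> assigns roles to list indices, a nesting to positions;
  \<open>J\<close> consists of the indices whose position lies in \<open>I\<close>.\<close>

lemma free_mixed_cumulant:
  assumes free: "free_over scale D \<phi> X Y" and V: "finite V"
    and mixed: "V \<inter> I \<noteq> {}" "V - I \<noteq> {}"
    and c: "\<And>i. i \<in> V \<Longrightarrow> c i \<in> (if i \<in> I then unital_subalgebra scale hull (D \<union> X) else unital_subalgebra scale hull (D \<union> Y))"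
  shows "cumulant \<phi> (entries c V) = 0"
proof -
  let ?s = "sorted_list_of_set V"
  define J where "J = {k. k < card V \<and> ?s ! k \<in> I}"
  have len: "length (entries c V) = card V" using V by (simp add: entries_def)
  have sV: "?s ! k \<in> V" if "k < card V" for k
    using that V by (metis nth_mem sorted_list_of_set.length_sorted_key_list_of_set set_sorted_list_of_set)
  have ex: "\<exists>k<card V. ?s ! k = i" if "i \<in> V" for i
    using that V by (metis in_set_conv_nth sorted_list_of_set.length_sorted_key_list_of_set set_sorted_list_of_set)
  have nth: "entries c V ! k = c (?s ! k)" if "k < card V" for k
    using that V by (simp add: entries_def)
  obtain i j where "i \<in> V" "i \<in> I" "j \<in> V" "j \<notin> I" using mixed by blast
  then have "J \<noteq> {}" "J \<noteq> {..<card V}" using ex unfolding J_def by force+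
  moreover have "J \<subseteq> {..<card V}" by (auto simp: J_def)
  moreover have "entries c V ! k \<in> (if k \<in> J then unital_subalgebra scale hull (D \<union> X) else unital_subalgebra scale hull (D \<union> Y))"
    if "k < card V" for k
    using c[OF sV[OF that]] nth[OF that] that by (simp add: J_def)
  ultimately show ?thesis
    using free[unfolded free_over_def, rule_format, of J "entries c V"] unfolding len by blast
qed

lemma hull_subset_A: "X \<subseteq> A \<Longrightarrow> unital_subalgebra scale hull (D \<union> X) \<subseteq> A"
  by (rule hull_minimal) (use D_le_A subalgebra_A in auto)

lemma hull_bimodule:
  assumes "z \<in> unital_subalgebra scale hull (D \<union> X)" "d \<in> D"
  shows "z * d \<in> unital_subalgebra scale hull (D \<union> X)" "d * z \<in> unital_subalgebra scale hull (D \<union> X)"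
proof -
  have "d \<in> unital_subalgebra scale hull (D \<union> X)" using assms(2) hull_subset[of "D \<union> X"] by blast
  then show "z * d \<in> unital_subalgebra scale hull (D \<union> X)" "d * z \<in> unital_subalgebra scale hull (D \<union> X)"
    using assms(1) unital_subalgebra_hull[of scale "D \<union> X"] by (simp_all add: unital_subalgebra_def)
qed

text \<open>The sums are opened one at a time: \<open>e Q u\<close> has them closed on
  \<open>Q\<close>. As long as an entry outside \<open>Q\<close> is of one kind, opening a further
  sum to the other kind gives a mixed tensor, which vanishes however the remaining sums are
  opened.\<close>

lemma cumulant_sum_free:
  assumes free: "free_over scale D \<phi> X Y" and XY: "X \<subseteq> A" "Y \<subseteq> A" and P: "finite P" "P \<noteq> {}"
    and f: "\<And>i. i \<in> P \<Longrightarrow> f i \<in> unital_subalgebra scale hull (D \<union> X)"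
    and g: "\<And>i. i \<in> P \<Longrightarrow> g i \<in> unital_subalgebra scale hull (D \<union> Y)"
  shows "cumulant \<phi> (entries (\<lambda>i. f i + g i) P) = cumulant \<phi> (entries f P) + cumulant \<phi> (entries g P)"
proof -
  let ?HX = "unital_subalgebra scale hull (D \<union> X)" and ?HY = "unital_subalgebra scale hull (D \<union> Y)"
  note HA = hull_subset_A[OF XY(1)] hull_subset_A[OF XY(2)]
  define e where "e Q u = (\<lambda>i. if i \<in> Q then f i + g i else u i)" for Q and u :: "nat \<Rightarrow> 'a"
  have step: "cumulant \<phi> (entries (e (insert r Q) u) P) =
      cumulant \<phi> (entries (e Q (u(r := f r))) P) + cumulant \<phi> (entries (e Q (u(r := g r))) P)"
    if r: "r \<in> P" "r \<notin> Q" and u: "u ` P \<subseteq> A" for r Q u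
  proof -
    have eq: "e (insert r Q) u = (e Q u)(r := f r + g r)" "e Q (u(r := z)) = (e Q u)(r := z)" for z
      using r(2) by (auto simp: e_def)
    have "f i + g i \<in> A" if "i \<in> P" for i using A_closed(1) f[OF that] g[OF that] HA by blast
    then have "e Q u ` P \<subseteq> A" using u by (auto simp: e_def)
    then show ?thesis unfolding eq using f[OF r(1)] g[OF r(1)] HA by (intro cumul.F_add P(1) r(1)) blast+
  qed
  have mixed: "cumulant \<phi> (entries (e Q u) P) = 0"
    if "finite Q" "Q \<subseteq> P" "\<And>i. i \<in> P \<Longrightarrow> u i \<in> (if i \<in> I then ?HX else ?HY)" "(P - Q) \<inter> I \<noteq> {}" "P - Q - I \<noteq> {}" for Q u I
    using that
  proof (induction Q arbitrary: u I rule: finite_induct)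
    case empty
    have "e {} u = u" by (simp add: e_def)
    then show ?case using free_mixed_cumulant[OF free P(1), of I u] empty by simp
  next
    case (insert r Q)
    have r: "r \<in> P" "r \<notin> Q" using insert by auto
    have uA: "u ` P \<subseteq> A"
    proof
      fix z assume "z \<in> u ` P"
      then obtain i where "i \<in> P" "z = u i" by blast
      then show "z \<in> A" using insert.prems(2)[of i] HA by (auto split: if_splits)
    qed
    \<comment> \<open>The role of the new entry has to be recorded in \<open>I\<close>: its value
      does not determine it, since the two subalgebras both contain \<open>D\<close>.\<close>
    have 1: "cumulant \<phi> (entries (e Q (u(r := f r))) P) = 0"
    proof (rule insert.IH[of _ "insert r I"])
      show "(u(r := f r)) i \<in> (if i \<in> insert r I then ?HX else ?HY)" if "i \<in> P" for i
        using insert.prems(2)[OF that] f[OF r(1)] by (cases "i = r") auto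
    qed (use insert.prems r in blast)+
    have 2: "cumulant \<phi> (entries (e Q (u(r := g r))) P) = 0"
    proof (rule insert.IH[of _ "I - {r}"])
      show "(u(r := g r)) i \<in> (if i \<in> I - {r} then ?HX else ?HY)" if "i \<in> P" for i
        using insert.prems(2)[OF that] g[OF r(1)] by (cases "i = r") auto
    qed (use insert.prems r in blast)+
    show ?case unfolding step[OF r uA] using 1 2 by simp
  qed
  have fA: "f ` P \<subseteq> A" and gA: "g ` P \<subseteq> A" using f g HA by blast+
  have pure: "cumulant \<phi> (entries (e Q u) P) = cumulant \<phi> (entries u P)"
    if "finite Q" "Q \<subset> P" "u = f \<or> u = g" for Q u
    using that(1,2)
  proof (induction Q rule: finite_induct)
    case empty
    show ?case by (simp add: e_def)
  next
    case (insert r Q)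
    have r: "r \<in> P" "r \<notin> Q" using insert by auto
    have ne: "P - Q - {r} \<noteq> {}" using insert.prems by blast
    have fg: "cumulant \<phi> (entries (e Q (f(r := g r))) P) = 0"
      by (rule mixed[of Q _ "- {r}"]) (use insert f g r ne in \<open>auto split: if_splits\<close>)
    have gf: "cumulant \<phi> (entries (e Q (g(r := f r))) P) = 0"
      by (rule mixed[of Q _ "{r}"]) (use insert f g r ne in \<open>auto split: if_splits\<close>)
    have IH: "cumulant \<phi> (entries (e Q u) P) = cumulant \<phi> (entries u P)"
      using insert.IH insert.prems by blast
    from that(3) show ?case
    proof
      assume "u = f"
      then show ?thesis using step[OF r fA] fg IH by simp
    next
      assume "u = g"
      then show ?thesis using step[OF r gA] gf IH by simp
    qed
  qed
  \<comment> \<open>With all other sums closed, opening the one at \<open>r\<close> is the only step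
    at which both summands survive: no entry has a definite kind yet.\<close>
  obtain r where r: "r \<in> P" using P(2) by blast
  have Q: "finite (P - {r})" "P - {r} \<subset> P" "r \<notin> P - {r}" "insert r (P - {r}) = P" using P r by auto
  have "cumulant \<phi> (entries (\<lambda>i. f i + g i) P) = cumulant \<phi> (entries (e P f) P)"
    by (intro arg_cong[of _ _ "cumulant \<phi>"] entries_cong P(1)) (simp add: e_def)
  also have "\<dots> = cumulant \<phi> (entries (e (P - {r}) (f(r := f r))) P) + cumulant \<phi> (entries (e (P - {r}) (f(r := g r))) P)"
    using step[OF r Q(3) fA] Q(4) by simp
  also have "cumulant \<phi> (entries (e (P - {r}) (f(r := g r))) P) = cumulant \<phi> (entries (e (P - {r}) g) P)"
    by (intro arg_cong[of _ _ "cumulant \<phi>"] entries_cong P(1)) (auto simp: e_def)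
  also have "cumulant \<phi> (entries (e (P - {r}) (f(r := f r))) P) = cumulant \<phi> (entries f P)"
    using pure[OF Q(1,2)] by simp
  also have "cumulant \<phi> (entries (e (P - {r}) g) P) = cumulant \<phi> (entries g P)"
    using pure[OF Q(1,2)] by simp
  finally show ?thesis .
qed

lemma cumulant_product_free:
  assumes free: "free_over scale D \<phi> X Y" and XY: "X \<subseteq> A" "Y \<subseteq> A" and p: "p \<ge> 1"
    and a_odd: "\<And>i. i \<in> {1..2 * p} \<Longrightarrow> odd i \<Longrightarrow> a i \<in> unital_subalgebra scale hull (D \<union> X)"
    and a_even: "\<And>i. i \<in> {1..2 * p} \<Longrightarrow> even i \<Longrightarrow> a i \<in> unital_subalgebra scale hull (D \<union> Y)"
  shows "cumulant \<phi> (entries (\<lambda>i. a (2 * i - 1) * a (2 * i)) {1..p}) =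
    (\<Sum>\<pi>\<in>NC p. nest \<kappa> (alternating_union \<pi> (Kreweras p \<pi>)) a)"
proof -
  let ?HX = "unital_subalgebra scale hull (D \<union> X)" and ?HY = "unital_subalgebra scale hull (D \<union> Y)"
  note HA = hull_subset_A[OF XY(1)] hull_subset_A[OF XY(2)]
  have P2: "finite {1..2 * p}" "{1..2 * p} \<noteq> {}" using p by auto
  have aA: "a ` {1..2 * p} \<subseteq> A" using a_odd a_even HA by blast
  define T where "T = {\<sigma> \<in> NC (2 * p). \<forall>\<rho>\<in>NC p. refines {1..2 * p} \<sigma> (doubled ` \<rho>) \<longrightarrow> \<rho> = {{1..p}}}"
  define K where "K = (\<lambda>\<pi>. alternating_union \<pi> (Kreweras p \<pi>))"
  have K_NC: "noncrossing (K \<pi>)" "K \<pi> \<in> NC_on {1..2 * p}" if "\<pi> \<in> NC p" for \<pi>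
  proof -
    show nc: "noncrossing (K \<pi>)"
      unfolding K_def noncrossing_alternating_union_iff[OF that Kreweras(1)[OF that]] Kreweras(2)[OF that] by blast
    show "K \<pi> \<in> NC_on {1..2 * p}"
      using alternating_union_partition[OF that Kreweras(1)[OF that]] nc by (simp add: K_def)
  qed
  have KT: "K ` NC p \<subseteq> T"
  proof
    fix \<sigma> assume "\<sigma> \<in> K ` NC p"
    then obtain \<pi> where \<pi>: "\<pi> \<in> NC p" "\<sigma> = K \<pi>" by blast
    have "\<rho> = {{1..p}}" if "\<rho> \<in> NC p" "refines {1..2 * p} (K \<pi>) (doubled ` \<rho>)" for \<rho>
      using refines_alternating_union_iff[OF \<pi>(1) Kreweras(1)[OF \<pi>(1)] that(1)] K_NC[OF \<pi>(1)] that
        join_Kreweras[OF \<pi>(1) that(1) _ _ p] unfolding K_def by blast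
    then show "\<sigma> \<in> T" using K_NC(2)[OF \<pi>(1)] \<pi>(2) by (simp add: T_def NC_eq)
  qed
  have zero: "nest \<kappa> \<sigma> a = 0" if \<sigma>: "\<sigma> \<in> T - K ` NC p" for \<sigma>
  proof -
    have \<sigma>N: "\<sigma> \<in> NC_on {1..2 * p}" using \<sigma> by (simp add: T_def NC_eq)
    have "\<exists>V\<in>\<sigma>. \<not> ((\<forall>i\<in>V. odd i) \<or> (\<forall>i\<in>V. even i))"
    proof (rule ccontr)
      assume "\<not> ?thesis"
      then obtain \<pi> \<tau> where *: "\<pi> \<in> NC p" "\<tau> \<in> NC p" "\<sigma> = alternating_union \<pi> \<tau>"
        using separated_is_alternating_union[OF \<sigma>N] by metis
      have nc: "noncrossing (alternating_union \<pi> \<tau>)" using NC_onD(2)[OF \<sigma>N] * by simp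
      have "\<tau> \<noteq> Kreweras p \<pi>" using \<sigma> * by (auto simp: K_def)
      then obtain \<rho> where \<rho>: "\<rho> \<in> NC p" "refines {1..p} \<pi> \<rho>" "refines {1..p} \<tau> \<rho>" "\<rho> \<noteq> {{1..p}}"
        using proper_join[OF *(1,2) nc] by metis
      then have "refines {1..2 * p} \<sigma> (doubled ` \<rho>)"
        using refines_alternating_union_iff[OF *(1,2) \<rho>(1)] \<sigma>N * by simp
      then show False using \<sigma> \<rho> by (auto simp: T_def)
    qed
    then obtain V where V: "V \<in> \<sigma>" "V \<inter> {i. odd i} \<noteq> {}" "V - {i. odd i} \<noteq> {}" by auto
    note bV = NC_on_block[OF \<sigma>N P2(1) V(1)]
    show ?thesis
    proof (rule cumul.nest_zero_block[OF \<sigma>N P2, where B = "\<lambda>i. if i \<in> {i. odd i} then ?HX else ?HY" and V = V])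
      show "cumulant \<phi> (entries c V) = 0" if "\<And>i. i \<in> V \<Longrightarrow> c i \<in> (if i \<in> {i. odd i} then ?HX else ?HY)" for c
        using free_mixed_cumulant[OF free bV(1) V(2,3)] that by blast
    qed (use a_odd a_even HA V(1) hull_bimodule in auto)
  qed
  have inj: "inj_on K (NC p)"
  proof (rule inj_onI)
    fix \<pi> \<pi>' assume *: "\<pi> \<in> NC p" "\<pi>' \<in> NC p" "K \<pi> = K \<pi>'"
    show "\<pi> = \<pi>'"
      using alternating_union_inj[OF *(1,2) Kreweras(1)[OF *(1)] Kreweras(1)[OF *(2)]]
        alternating_union_inj[OF *(2,1) Kreweras(1)[OF *(2)] Kreweras(1)[OF *(1)]] *(3)
      unfolding K_def by (metis subset_antisym)
  qed
  have "cumulant \<phi> (entries (\<lambda>i. a (2 * i - 1) * a (2 * i)) {1..p}) = (\<Sum>\<sigma>\<in>T. nest \<kappa> \<sigma> a)"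
    unfolding T_def by (rule cumulant_products[OF p aA])
  also have "\<dots> = (\<Sum>\<sigma>\<in>K ` NC p. nest \<kappa> \<sigma> a)"
    using zero KT finite_NC by (intro sum.mono_neutral_right) (auto simp: T_def)
  also have "\<dots> = (\<Sum>\<pi>\<in>NC p. nest \<kappa> (K \<pi>) a)"
    by (rule sum.reindex_cong[OF inj refl refl])
  finally show ?thesis by (simp add: K_def)
qed

text \<open>The nested moments never leave \<open>A'\<close>: products of entries stay in it, and
  the absorbed values lie in \<open>D\<close>, which is contained in \<open>A'\<close>.\<close>

lemma cumulant_cong_subalgebra:
  assumes A': "unital_subalgebra scale A'" "D \<subseteq> A'" "A' \<subseteq> A" and \<psi>: "\<And>x. x \<in> A' \<Longrightarrow> \<psi> x = \<phi> x"
    and bs: "set bs \<subseteq> A'" "bs \<noteq> []"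
  shows "cumulant \<psi> bs = cumulant \<phi> bs"
proof -
  let ?P = "{1..length bs}"
  have P: "finite ?P" "?P \<noteq> {}" using bs(2) by (auto simp: Suc_le_eq)
  have prod: "prod_list cs \<in> A'" if "set cs \<subseteq> A'" for cs
    using that A'(1) by (induction cs) (auto simp: unital_subalgebra_def)
  have "moment_ext \<psi> \<pi> bs = moment_ext \<phi> \<pi> bs" if \<pi>: "\<pi> \<in> NC (length bs)" for \<pi>
  proof -
    have "nest \<Phi> \<pi> (\<lambda>i. bs ! (i - 1)) = nest (\<lambda>V bs. \<psi> (prod_list bs)) \<pi> (\<lambda>i. bs ! (i - 1)) \<and>
        nest \<Phi> \<pi> (\<lambda>i. bs ! (i - 1)) \<in> D"
    proof (rule nest_cong[OF \<pi>[unfolded NC_eq] P, where B = "\<lambda>_. A'" and D = D])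
      show "bs ! (i - 1) \<in> A'" if "i \<in> ?P" for i
        using that bs(1) by (intro subsetD[OF bs(1)] nth_mem) auto
      show "z * d \<in> A' \<and> d * z \<in> A'" if "z \<in> A'" "d \<in> D" for z d
        using that A' by (auto simp: unital_subalgebra_def)
      fix V c assume V: "V \<in> \<pi>" and c: "\<And>i. i \<in> V \<Longrightarrow> c i \<in> A'"
      have "finite V" using NC_on_block[OF \<pi>[unfolded NC_eq] P(1) V] by blast
      then have "prod_list (entries c V) \<in> A'" using c by (intro prod) (auto simp: set_entries)
      then show "\<phi> (prod_list (entries c V)) = \<psi> (prod_list (entries c V)) \<and> \<phi> (prod_list (entries c V)) \<in> D"
        using \<psi> A'(3) \<phi>_D by auto
    qed simp_all
    then show ?thesis by (simp add: moment_ext_def)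
  qed
  then show ?thesis unfolding cumulant_def by (intro sum.cong) auto
qed

end

section \<open>The tower\<close>

lemma tower_exp_Suc: "k \<le> Suc j \<Longrightarrow> tower_exp \<phi> k (Suc j) = tower_exp \<phi> k j \<circ> \<phi> (Suc j)"
proof -
  assume "k \<le> Suc j"
  have fold: "foldr (\<circ>) fs h = foldr (\<circ>) fs id \<circ> h" for fs and h :: "'a \<Rightarrow> 'a"
    by (induction fs) (simp_all add: comp_assoc)
  have "[k..<Suc (Suc j)] = [k..<Suc j] @ [Suc j]" using \<open>k \<le> Suc j\<close> by (rule upt_Suc_append)
  then have "tower_exp \<phi> k (Suc j) = foldr (\<circ>) (map \<phi> [k..<Suc j]) (\<phi> (Suc j))"
    unfolding tower_exp_def by (simp del: upt_Suc)
  then show ?thesis using fold[of "map \<phi> [k..<Suc j]" "\<phi> (Suc j)"] by (simp add: tower_exp_def del: upt_Suc)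
qed

context amalgamated_tower
begin

lemma A_mono: "i \<le> j \<Longrightarrow> A i \<subseteq> A j"
  by (rule lift_Suc_mono_le[of A]) (use increasing in auto)

text \<open>The bound admits \<open>j = k - 1\<close>: the composition is then empty and is the
  identity of \<open>A (k - 1)\<close>, which starts the induction.\<close>

lemma tower_exp_cond_exp:
  assumes "1 \<le> k" "k \<le> Suc j"
  shows "conditional_expectation scale (A j) (A (k - 1)) (tower_exp \<phi> k j)"
  using assms(2)
proof (induction j)
  case 0
  then have "k = 1" using assms(1) by simp
  then show ?case by (simp add: tower_exp_def conditional_expectation_def)
next
  case (Suc j)
  show ?case
  proof (cases "k = Suc (Suc j)")
    case True
    then show ?thesis by (simp add: tower_exp_def conditional_expectation_def)
  next
    case False
    then have k: "k \<le> Suc j" using Suc.prems by simp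
    have sub: "A (k - 1) \<subseteq> A j" using k by (intro A_mono) simp
    note ce1 = Suc.IH[OF k, unfolded conditional_expectation_def]
    have ce2: "conditional_expectation scale (A (Suc j)) (A j) (\<phi> (Suc j))" using cond_exp[of "Suc j"] by simp
    note ce2' = ce2[unfolded conditional_expectation_def]
    show ?thesis
      unfolding tower_exp_Suc[OF k] conditional_expectation_def comp_apply
    proof (intro conjI ballI allI)
      fix a assume a: "a \<in> A (Suc j)"
      then have \<phi>a: "\<phi> (Suc j) a \<in> A j" using ce2' by blast
      then show "tower_exp \<phi> k j (\<phi> (Suc j) a) \<in> A (k - 1)" using ce1 by blast
      show "tower_exp \<phi> k j (\<phi> (Suc j) (scale c a)) = scale c (tower_exp \<phi> k j (\<phi> (Suc j) a))" for c
        using ce1 ce2' a \<phi>a by metis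
      show "tower_exp \<phi> k j (\<phi> (Suc j) (a + b)) = tower_exp \<phi> k j (\<phi> (Suc j) a) + tower_exp \<phi> k j (\<phi> (Suc j) b)"
        if b: "b \<in> A (Suc j)" for b
      proof -
        have "\<phi> (Suc j) b \<in> A j" using ce2' b by blast
        moreover have "\<phi> (Suc j) (a + b) = \<phi> (Suc j) a + \<phi> (Suc j) b" using ce2' a b by blast
        ultimately show ?thesis using ce1 \<phi>a by metis
      qed
    next
      fix b assume "b \<in> A (k - 1)"
      moreover have "b \<in> A j" using sub calculation by blast
      ultimately show "tower_exp \<phi> k j (\<phi> (Suc j) b) = b" using ce1 ce2' by metis
    next
      fix b b' a assume b: "b \<in> A (k - 1)" "b' \<in> A (k - 1)" and a: "a \<in> A (Suc j)"
      have "\<phi> (Suc j) (b * a * b') = b * \<phi> (Suc j) a * b'" using ce2' b sub a by blast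
      moreover have "\<phi> (Suc j) a \<in> A j" using ce2' a by blast
      ultimately show "tower_exp \<phi> k j (\<phi> (Suc j) (b * a * b')) = b * tower_exp \<phi> k j (\<phi> (Suc j) a) * b'"
        using ce1 b by metis
    qed
  qed
qed

text \<open>The expectations with index above \<open>j\<close> are applied first, and they fix
  \<open>A j\<close> pointwise.\<close>

lemma tower_exp_restrict:
  assumes "k \<le> Suc j" "j \<le> N" "x \<in> A j"
  shows "tower_exp \<phi> k N x = tower_exp \<phi> k j x"
  using assms(2)
proof (induction N rule: dec_induct)
  case base
  show ?case ..
next
  case (step N)
  have "x \<in> A N" using assms(3) A_mono[OF step.hyps(1)] by blast
  then have "\<phi> (Suc N) x = x" using cond_exp[of "Suc N"] by (simp add: conditional_expectation_def)
  then show ?case using step assms(1) by (simp add: tower_exp_Suc)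
qed

lemma tower_amalgamated_space:
  assumes "1 \<le> k" "k \<le> Suc j"
  shows "amalgamated_space scale (A j) (A (k - 1)) (tower_exp \<phi> k j)"
proof
  show "A (k - 1) \<subseteq> A j" using assms by (intro A_mono) simp
qed (use subalgebra tower_exp_cond_exp[OF assms] in auto)

end

section \<open>Coefficients of the R-transforms\<close>

lemma R_transform_entries:
  assumes "w \<noteq> []" "set w \<subseteq> {1..s}"
  shows "R_transform \<phi> s a d w = cumulant \<phi> (entries (twisted_entry d a w) {1..length w})"
  unfolding R_transform_def entries_interval using assms by simp

lemma R_transform_outside: "w = [] \<or> \<not> set w \<subseteq> {1..s} \<Longrightarrow> R_transform \<phi> s a d w = 0"
  by (auto simp: R_transform_def)

lemma shift_vars_outside: "\<not> (\<forall>i\<in>set w. s < i) \<Longrightarrow> shift_vars s R d w = 0"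
  unfolding shift_vars_def by (simp only: if_False)

theorem theorem2p12:
  fixes scale :: "complex \<Rightarrow> 'a::ring_1 \<Rightarrow> 'a"
    and A :: "nat \<Rightarrow> 'a set" and \<phi>\<^sub>0 :: "'a \<Rightarrow> complex" and \<phi> :: "nat \<Rightarrow> 'a \<Rightarrow> 'a"
    and k m n N s :: nat and x y :: "nat \<Rightarrow> 'a"
  assumes "amalgamated_tower scale A \<phi>\<^sub>0 \<phi>"
    and "1 \<le> k" and "k < m" and "m < n" and "n < N"
    and "x ` {1..s} \<subseteq> (\<Union>j\<in>{k..m}. A j)"
    and "y ` {1..s} \<subseteq> (\<Union>j\<in>{m+1..n}. A j)"
    and "free_over scale (A (k - 1)) (tower_exp \<phi> k N) (x ` {1..s}) (y ` {1..s})"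
  shows "rseries_eq (A (k - 1))
           (R_transform (tower_exp \<phi> k N) (2 * s) (concat_vars s x y))
           (rseries_add (R_transform (tower_exp \<phi> k m) s x)
              (shift_vars s (R_transform (tower_exp \<phi> k n) s y))) \<and>
         rseries_eq (A (k - 1))
           (R_transform (tower_exp \<phi> k N) s (\<lambda>i. x i + y i))
           (rseries_add (R_transform (tower_exp \<phi> k m) s x) (R_transform (tower_exp \<phi> k n) s y)) \<and>
         rseries_eq (A (k - 1))
           (R_transform (tower_exp \<phi> k N) s (\<lambda>i. x i * y i))
           (boxed_conv (tower_exp \<phi> k m) (tower_exp \<phi> k n) s x y)"
proof -
  interpret amalgamated_tower scale A \<phi>\<^sub>0 \<phi> by fact
  define E where "E = tower_exp \<phi> k"
  define D where "D = A (k - 1)"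
  define X Y where "X = x ` {1..s}" and "Y = y ` {1..s}"
  have le: "k \<le> Suc m" "k \<le> Suc n" "k \<le> Suc N" "m \<le> N" "n \<le> N" using assms(3-5) by auto
  interpret m: amalgamated_space scale "A m" D "E m"
    unfolding E_def D_def using tower_amalgamated_space[OF assms(2) le(1)] .
  interpret n: amalgamated_space scale "A n" D "E n"
    unfolding E_def D_def using tower_amalgamated_space[OF assms(2) le(2)] .
  interpret N: amalgamated_space scale "A N" D "E N"
    unfolding E_def D_def using tower_amalgamated_space[OF assms(2) le(3)] .
  let ?HX = "unital_subalgebra scale hull (D \<union> X)" and ?HY = "unital_subalgebra scale hull (D \<union> Y)"
  have free: "free_over scale D (E N) X Y" using assms(8) by (simp add: D_def E_def X_def Y_def)
  have Xm: "X \<subseteq> A m"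
  proof -
    have "(\<Union>j\<in>{k..m}. A j) \<subseteq> A m" using A_mono by (intro UN_least) auto
    then show ?thesis using assms(6) by (simp add: X_def subset_trans)
  qed
  have Yn: "Y \<subseteq> A n"
  proof -
    have "(\<Union>j\<in>{m+1..n}. A j) \<subseteq> A n" using A_mono by (intro UN_least) auto
    then show ?thesis using assms(7) by (simp add: Y_def subset_trans)
  qed
  have mN: "A m \<subseteq> A N" and nN: "A n \<subseteq> A N" using A_mono le by auto
  have XN: "X \<subseteq> A N" and YN: "Y \<subseteq> A N" using Xm Yn mN nN by auto
  have cum: "cumulant (E j) (entries c V) = cumulant (E N) (entries c V)"
    if "k \<le> Suc j" "j \<le> N" "finite V" "V \<noteq> {}" "\<And>i. i \<in> V \<Longrightarrow> c i \<in> A j" for j c V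
  proof (rule N.cumulant_cong_subalgebra[OF subalgebra])
    show "D \<subseteq> A j" "A j \<subseteq> A N" using that(1,2) by (auto simp: D_def intro!: A_mono)
    show "E j z = E N z" if "z \<in> A j" for z
      using tower_exp_restrict[OF \<open>k \<le> Suc j\<close> \<open>j \<le> N\<close> that] by (simp add: E_def)
  qed (use that in \<open>auto simp: entries_def\<close>)
  note cum_m = cum[OF le(1,4)] and cum_n = cum[OF le(2,5)]
  have HX_m: "?HX \<subseteq> A m" and HY_n: "?HY \<subseteq> A n"
    using m.hull_subset_A[OF Xm] n.hull_subset_A[OF Yn] by auto
  have gen: "X \<subseteq> ?HX" "Y \<subseteq> ?HY" using hull_subset[of "D \<union> X"] hull_subset[of "D \<union> Y"] by auto
  have part1: "R_transform (E N) (2 * s) (concat_vars s x y) d w =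
      rseries_add (R_transform (E m) s x) (shift_vars s (R_transform (E n) s y)) d w"
    and part2: "R_transform (E N) s (\<lambda>i. x i + y i) d w =
      rseries_add (R_transform (E m) s x) (R_transform (E n) s y) d w"
    and part3: "R_transform (E N) s (\<lambda>i. x i * y i) d w = boxed_conv (E m) (E n) s x y d w"
    if d: "\<forall>r. d r \<in> D" for d w
  proof -
    define p where "p = length w"
    define tx ty where "tx = twisted_entry d x w" and "ty = twisted_entry d y w"
    have w_in: "w ! (r - 1) \<in> set w" if "r \<in> {1..p}" for r
      using that by (intro nth_mem) (auto simp: p_def)
    \<comment> \<open>The generated subalgebras contain \<open>D\<close>, so the twisted entries
      stay in them; this is how freeness controls the coefficients for every choice of
      \<open>d\<close>.\<close>
    have tw: "twisted_entry d z v r \<in> unital_subalgebra scale hull (D \<union> Z)"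
      if "z (v ! (r - 1)) \<in> unital_subalgebra scale hull (D \<union> Z)" for z v r Z
      using that N.hull_bimodule(2)[OF that, of "d r"] d by (cases "r = 1") (simp_all add: twisted_entry_def)
    have fin: "finite {1..p}" by simp
    show "R_transform (E N) (2 * s) (concat_vars s x y) d w =
      rseries_add (R_transform (E m) s x) (shift_vars s (R_transform (E n) s y)) d w"
    proof (cases "w \<noteq> [] \<and> set w \<subseteq> {1..2 * s}")
      case False
      have 1: "R_transform (E m) s x d w = 0"
      proof (rule R_transform_outside)
        have "{1..s} \<subseteq> {1..2 * s}" by auto
        then show "w = [] \<or> \<not> set w \<subseteq> {1..s}" using False by blast
      qed
      \<comment> \<open>For the empty word the condition in \<open>shift_vars\<close> holds
        vacuously, and the value is the 0 that \<open>R_transform\<close> assigns to this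
        word.\<close>
      have 2: "shift_vars s (R_transform (E n) s y) d w = 0"
      proof (cases "\<forall>i\<in>set w. s < i")
        case True
        have "w = [] \<or> \<not> set (map (\<lambda>i. i - s) w) \<subseteq> {1..s}"
        proof (cases "w = []")
          case False
          then obtain i where "i \<in> set w" "i \<notin> {1..2 * s}"
            using \<open>\<not> (w \<noteq> [] \<and> set w \<subseteq> {1..2 * s})\<close> by blast
          moreover from this have "i - s \<notin> {1..s}" using True by auto
          ultimately show ?thesis by (auto simp: image_subset_iff)
        qed simp
        then show ?thesis using True R_transform_outside[of "map (\<lambda>i. i - s) w"] by (simp add: shift_vars_def)
      qed (rule shift_vars_outside)
      show ?thesis using R_transform_outside[of w "2 * s"] False 1 2 by (simp add: rseries_add_def)
    next
      case True
      then have ne: "{1..p} \<noteq> {}" by (simp add: p_def Suc_le_eq)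
      have range: "w ! (r - 1) \<in> {1..2 * s}" if "r \<in> {1..p}" for r using w_in[OF that] True by blast
      define c where "c = twisted_entry d (concat_vars s x y) w"
      have L: "R_transform (E N) (2 * s) (concat_vars s x y) d w = cumulant (E N) (entries c {1..p})"
        using R_transform_entries[of w "2 * s" "E N" "concat_vars s x y" d] True by (simp add: c_def p_def)
      have c_x: "c r = tx r \<and> c r \<in> ?HX" if "r \<in> {1..p}" "w ! (r - 1) \<le> s" for r
      proof -
        have "x (w ! (r - 1)) \<in> X" using range[OF that(1)] that(2) by (auto simp: X_def)
        then have "concat_vars s x y (w ! (r - 1)) \<in> ?HX" using gen that by (auto simp: concat_vars_def)
        then have "c r \<in> ?HX" unfolding c_def by (rule tw)
        moreover have "c r = tx r"
          using that(2) by (cases "r = 1") (simp_all add: c_def tx_def twisted_entry_def concat_vars_def)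
        ultimately show ?thesis by blast
      qed
      have c_y: "c r \<in> ?HY" if "r \<in> {1..p}" "\<not> w ! (r - 1) \<le> s" for r
      proof -
        have "w ! (r - 1) - s \<in> {1..s}" using range[OF that(1)] that(2) by auto
        then have "concat_vars s x y (w ! (r - 1)) \<in> ?HY" using gen that by (auto simp: concat_vars_def Y_def)
        then show ?thesis unfolding c_def by (rule tw)
      qed
      have set_w: "set w = (\<lambda>r. w ! (r - 1)) ` {1..p}"
      proof
        show "set w \<subseteq> (\<lambda>r. w ! (r - 1)) ` {1..p}"
        proof
          fix i assume "i \<in> set w"
          then obtain k where "k < length w" "i = w ! k" by (metis in_set_conv_nth)
          then show "i \<in> (\<lambda>r. w ! (r - 1)) ` {1..p}" by (intro image_eqI[of _ _ "Suc k"]) (auto simp: p_def)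
        qed
      qed (use w_in in blast)
      \<comment> \<open>Since the word is nonempty, the pure cases exclude each other, so at most
        one summand on the right-hand side is nonzero; in the mixed case both are zero.\<close>
      consider (x) "\<forall>r\<in>{1..p}. w ! (r - 1) \<le> s" | (y) "\<forall>r\<in>{1..p}. s < w ! (r - 1)"
        | (mixed) "\<exists>r\<in>{1..p}. w ! (r - 1) \<le> s" "\<exists>r\<in>{1..p}. \<not> w ! (r - 1) \<le> s"
        by (metis leI)
      then show ?thesis
      proof cases
        case x
        then have "set w \<subseteq> {1..s}" using range unfolding set_w by auto
        then have "R_transform (E m) s x d w = cumulant (E m) (entries tx {1..p})"
          using R_transform_entries[of w s "E m" x d] True by (simp add: tx_def p_def)
        also have "\<dots> = cumulant (E m) (entries c {1..p})"
          using x c_x by (intro arg_cong[of _ _ "cumulant (E m)"] entries_cong) auto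
        also have "\<dots> = cumulant (E N) (entries c {1..p})"
          using x c_x HX_m by (intro cum_m fin ne) blast
        finally have "R_transform (E m) s x d w = cumulant (E N) (entries c {1..p})" .
        moreover have "\<not> (\<forall>i\<in>set w. s < i)" unfolding set_w using x ne by force
        note shift_vars_outside[OF this, of "R_transform (E n) s y" d]
        ultimately show ?thesis by (simp add: L rseries_add_def)
      next
        case y
        let ?w = "map (\<lambda>i. i - s) w"
        have "R_transform (E m) s x d w = 0"
          using y ne by (intro R_transform_outside) (force simp: set_w)
        moreover have "\<forall>i\<in>set w. s < i" unfolding set_w using y by simp
        moreover have "R_transform (E n) s y d ?w = cumulant (E N) (entries c {1..p})"
        proof -
          have "set ?w \<subseteq> {1..s}"
          proof
            fix i assume "i \<in> set ?w"
            then obtain r where r: "r \<in> {1..p}" "i = w ! (r - 1) - s" by (auto simp: set_w)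
            then have "s < w ! (r - 1)" using y by blast
            then show "i \<in> {1..s}" using range[OF r(1)] r(2) by auto
          qed
          then have "R_transform (E n) s y d ?w = cumulant (E n) (entries (twisted_entry d y ?w) {1..p})"
            using R_transform_entries[of ?w s "E n" y d] True by (simp add: p_def)
          also have "\<dots> = cumulant (E n) (entries c {1..p})"
          proof (intro arg_cong[of _ _ "cumulant (E n)"] entries_cong fin)
            \<comment> \<open>The elements \<open>d r\<close> belong to positions, not to letters,
              so shifting the letters by \<open>s\<close> leaves them in place.\<close>
            fix r assume r: "r \<in> {1..p}"
            then have "?w ! (r - 1) = w ! (r - 1) - s" by (intro nth_map) (auto simp: p_def)
            moreover have "s < w ! (r - 1)" using y r by blast
            ultimately show "twisted_entry d y ?w r = c r"
              by (cases "r = 1") (simp_all add: c_def twisted_entry_def concat_vars_def)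
          qed
          also have "\<dots> = cumulant (E N) (entries c {1..p})"
            using y c_y HY_n by (intro cum_n fin ne) (meson linorder_not_le subsetD)
          finally show ?thesis .
        qed
        ultimately show ?thesis by (simp add: L rseries_add_def shift_vars_def)
      next
        case mixed
        have "cumulant (E N) (entries c {1..p}) = 0"
        proof (rule N.free_mixed_cumulant[OF free fin, where I = "{r. w ! (r - 1) \<le> s}"])
          show "c i \<in> (if i \<in> {r. w ! (r - 1) \<le> s} then ?HX else ?HY)" if "i \<in> {1..p}" for i
            using conjunct2[OF c_x[OF that]] c_y[OF that] by simp
        qed (use mixed in blast)+
        moreover have "R_transform (E m) s x d w = 0"
          using mixed by (intro R_transform_outside) (force simp: set_w)
        moreover have "\<not> (\<forall>i\<in>set w. s < i)" unfolding set_w using mixed(1) by force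
        note shift_vars_outside[OF this, of "R_transform (E n) s y" d]
        ultimately show ?thesis by (simp add: L rseries_add_def)
      qed
    qed
    show "R_transform (E N) s (\<lambda>i. x i + y i) d w =
      rseries_add (R_transform (E m) s x) (R_transform (E n) s y) d w"
      and "R_transform (E N) s (\<lambda>i. x i * y i) d w = boxed_conv (E m) (E n) s x y d w"
    proof -
      consider (outside) "w = [] \<or> \<not> set w \<subseteq> {1..s}" | (inside) "w \<noteq> []" "set w \<subseteq> {1..s}" by blast
      then have "R_transform (E N) s (\<lambda>i. x i + y i) d w =
          rseries_add (R_transform (E m) s x) (R_transform (E n) s y) d w \<and>
        R_transform (E N) s (\<lambda>i. x i * y i) d w = boxed_conv (E m) (E n) s x y d w"
      proof cases
        case outside
        then have "boxed_conv (E m) (E n) s x y d w = 0" by (auto simp: boxed_conv_def)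
        moreover have "R_transform \<psi> s z d w = 0" for \<psi> z
          by (rule R_transform_outside[OF outside])
        ultimately show ?thesis by (simp add: rseries_add_def)
      next
        case inside
        then have ne: "{1..p} \<noteq> {}" and p1: "p \<ge> 1" by (simp_all add: p_def Suc_le_eq)
        have xr: "x (w ! (r - 1)) \<in> ?HX" and yr: "y (w ! (r - 1)) \<in> ?HY" if "r \<in> {1..p}" for r
          using w_in[OF that] inside(2) gen by (auto simp: X_def Y_def)
        have txr: "tx r \<in> ?HX" and tyr: "ty r \<in> ?HY" if "r \<in> {1..p}" for r
          unfolding tx_def ty_def by (rule tw, rule xr[OF that], rule tw, rule yr[OF that])
        have R: "R_transform \<psi> s z d w = cumulant \<psi> (entries (twisted_entry d z w) {1..p})" for \<psi> z
          using R_transform_entries[OF inside, of \<psi> z d] by (simp add: p_def)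
        have "R_transform (E N) s (\<lambda>i. x i + y i) d w = cumulant (E N) (entries (\<lambda>r. tx r + ty r) {1..p})"
          unfolding R by (intro arg_cong[of _ _ "cumulant (E N)"] entries_cong fin)
            (simp add: tx_def ty_def twisted_entry_def distrib_left)
        also have "\<dots> = cumulant (E N) (entries tx {1..p}) + cumulant (E N) (entries ty {1..p})"
          by (rule N.cumulant_sum_free[OF free XN YN fin ne txr tyr])
        also have "cumulant (E N) (entries tx {1..p}) = R_transform (E m) s x d w"
          unfolding R tx_def[symmetric] using txr HX_m by (intro cum_m[symmetric] fin ne) blast
        also have "cumulant (E N) (entries ty {1..p}) = R_transform (E n) s y d w"
          unfolding R ty_def[symmetric] using tyr HY_n by (intro cum_n[symmetric] fin ne) blast
        finally have sum: "R_transform (E N) s (\<lambda>i. x i + y i) d w =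
          rseries_add (R_transform (E m) s x) (R_transform (E n) s y) d w" by (simp add: rseries_add_def)
        \<comment> \<open>In d(xy) = (dx)y the element of \<open>D\<close> joins the factor from
          \<open>x\<close>. The factors from \<open>y\<close> thus appear untwisted, which is why
          the trivial R-transform of \<open>y\<close> occurs in the convolution.\<close>
        define a where "a = (\<lambda>j. let r = (j + 1) div 2 in if odd j then twisted_entry d x w r else y (w ! (r - 1)))"
        have r_in: "(j + 1) div 2 \<in> {1..p}" if "j \<in> {1..2 * p}" for j
          using that unfolding atLeastAtMost_iff by presburger
        have a_odd: "a j \<in> ?HX" if "j \<in> {1..2 * p}" "odd j" for j
          using txr[OF r_in[OF that(1)]] that(2) by (simp add: a_def tx_def Let_def)
        have a_even: "a j \<in> ?HY" if "j \<in> {1..2 * p}" "even j" for j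
          using yr[OF r_in[OF that(1)]] that(2) by (simp add: a_def Let_def)
        have "R_transform (E N) s (\<lambda>i. x i * y i) d w = cumulant (E N) (entries (\<lambda>r. a (2 * r - 1) * a (2 * r)) {1..p})"
          unfolding R
        proof (intro arg_cong[of _ _ "cumulant (E N)"] entries_cong fin)
          fix r assume "r \<in> {1..p}"
          then have "odd (2 * r - 1)" "(2 * r - 1 + 1) div 2 = r" by auto
          then have "a (2 * r - 1) = twisted_entry d x w r" "a (2 * r) = y (w ! (r - 1))"
            by (simp_all only: a_def Let_def if_True) simp_all
          then show "twisted_entry d (\<lambda>i. x i * y i) w r = a (2 * r - 1) * a (2 * r)"
            by (simp add: twisted_entry_def mult.assoc)
        qed
        also have "\<dots> = (\<Sum>\<pi>\<in>NC p. nest (\<lambda>_. cumulant (E N)) (alternating_union \<pi> (Kreweras p \<pi>)) a)"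
          by (rule N.cumulant_product_free[OF free XN YN p1 a_odd a_even])
        also have "\<dots> = (\<Sum>\<pi>\<in>NC p. nest (\<lambda>V. if \<forall>i\<in>V. odd i then cumulant (E m) else cumulant (E n))
            (alternating_union \<pi> (Kreweras p \<pi>)) a)"
        proof (rule sum.cong[OF refl])
          fix \<pi> assume \<pi>: "\<pi> \<in> NC p"
          note K = Kreweras(1)[OF \<pi>]
          have nc: "noncrossing (alternating_union \<pi> (Kreweras p \<pi>))"
            unfolding noncrossing_alternating_union_iff[OF \<pi> K] Kreweras(2)[OF \<pi>] by blast
          note AU = alternating_union_partition[OF \<pi> K nc]
          have P2: "finite {1..2 * p}" "{1..2 * p} \<noteq> {}" using p1 by auto
          \<comment> \<open>The expectations have to be exchanged inside the nesting. Absorbed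
            values lie in \<open>D\<close> and leave odd entries in \<open>?HX\<close> and even ones
            in \<open>?HY\<close>; so each block sees entries of one algebra only, on which the
            smaller expectation agrees with \<open>E N\<close>.\<close>
          have "nest (\<lambda>_. cumulant (E N)) (alternating_union \<pi> (Kreweras p \<pi>)) a =
              nest (\<lambda>V. if \<forall>i\<in>V. odd i then cumulant (E m) else cumulant (E n))
                (alternating_union \<pi> (Kreweras p \<pi>)) a \<and>
              nest (\<lambda>_. cumulant (E N)) (alternating_union \<pi> (Kreweras p \<pi>)) a \<in> D"
          proof (rule nest_cong[OF AU P2, where B = "\<lambda>i. if odd i then ?HX else ?HY" and D = D])
            show "a i \<in> (if odd i then ?HX else ?HY)" if "i \<in> {1..2 * p}" for i
              using a_odd[OF that] a_even[OF that] by simp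
            show "z * e \<in> (if odd i then ?HX else ?HY) \<and> e * z \<in> (if odd i then ?HX else ?HY)"
              if "z \<in> (if odd i then ?HX else ?HY)" "e \<in> D" for i z e
              using that N.hull_bimodule by (cases "odd i") auto
            fix V c
            assume V: "V \<in> alternating_union \<pi> (Kreweras p \<pi>)"
              and c: "\<And>i. i \<in> V \<Longrightarrow> c i \<in> (if odd i then ?HX else ?HY)"
            note bV = NC_on_block[OF AU P2(1) V]
            have "c i \<in> A N" if "i \<in> V" for i
              using c[OF that] HX_m HY_n mN nN by (cases "odd i") auto
            then have "c ` V \<subseteq> A N" by blast
            then have cD: "cumulant (E N) (entries c V) \<in> D"
              using N.cumul.F_closed[OF bV(1,2)] by blast
            have "cumulant (E N) (entries c V) =
              (if \<forall>i\<in>V. odd i then cumulant (E m) else cumulant (E n)) (entries c V)"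
            proof (cases "\<forall>i\<in>V. odd i")
              case True
              then have "c i \<in> A m" if "i \<in> V" for i using c[OF that] that HX_m by auto
              then have "cumulant (E N) (entries c V) = cumulant (E m) (entries c V)"
                by (rule cum_m[OF bV(1,2), symmetric])
              then show ?thesis unfolding if_P[OF True] .
            next
              case False
              \<comment> \<open>\<open>boxed_conv\<close> tests for purely odd blocks only; in an
                alternating union a block that fails the test is purely even, so the cumulant of
                \<open>E n\<close> is the right one.\<close>
              then have "\<forall>i\<in>V. even i" using alternating_union_blocks[OF \<pi> V] by blast
              then have "c i \<in> A n" if "i \<in> V" for i using c[OF that] that HY_n by auto
              then have "cumulant (E N) (entries c V) = cumulant (E n) (entries c V)"
                by (rule cum_n[OF bV(1,2), symmetric])
              then show ?thesis unfolding if_not_P[OF False] .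
            qed
            then show "cumulant (E N) (entries c V) =
                (if \<forall>i\<in>V. odd i then cumulant (E m) else cumulant (E n)) (entries c V) \<and>
              cumulant (E N) (entries c V) \<in> D" using cD by blast
          qed simp
          then show "nest (\<lambda>_. cumulant (E N)) (alternating_union \<pi> (Kreweras p \<pi>)) a =
              nest (\<lambda>V. if \<forall>i\<in>V. odd i then cumulant (E m) else cumulant (E n))
                (alternating_union \<pi> (Kreweras p \<pi>)) a" by blast
        qed
        also have "\<dots> = boxed_conv (E m) (E n) s x y d w"
          using inside by (simp add: boxed_conv_def a_def p_def)
        finally show ?thesis using sum by blast
      qed
      then show "R_transform (E N) s (\<lambda>i. x i + y i) d w =
          rseries_add (R_transform (E m) s x) (R_transform (E n) s y) d w"
        and "R_transform (E N) s (\<lambda>i. x i * y i) d w = boxed_conv (E m) (E n) s x y d w" by blast+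
    qed
  qed
  then show ?thesis unfolding rseries_eq_def D_def E_def by blast
qed

end
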